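(* The tautological homomorphism $$A_\sigma\longrightarrow \mathrm{End}_{\mathcal{Y}_\sigma}(L^\sigma)$$ is an isomorphism.
   Context: Fix integers $N_0>0$, $N_1\ge 0$ with $N_0\ge N_1$ and put $N=N_0+N_1$, $\hat I=\{0,\dots,N-1\}$ (identified with $\mathbb{Z}/N\mathbb{Z}$), $\tilde I=\{\tfrac12,\tfrac32,\dots,N-\tfrac12\}$ (indices read modulo $N$ where needed). Let $\Gamma\subset\mathbb{R}^2$ be the convex hull of $(0,0),(0,1),(N_0,0),(N_1,1)$, $\Delta\subset\mathbb{R}^3$ the cone over $\Gamma\times\{1\}$, and $\mathcal{X}=\mathrm{Spec}\,\mathbb{C}[\Delta^\vee\cap M]$ with $M=\mathrm{Hom}(\mathbb{Z}^3,\mathbb{Z})$, so $\mathcal{X}\cong\mathrm{Spec}\,\mathbb{C}[X,Y,Z,W]/(XY-Z^{N_1}W^{N_0})$. A partition $\sigma$ of $\Gamma$ is a pair of functions $\sigma_x:\tilde I\to\mathbb{Z}+\tfrac12$, $\sigma_y:\tilde I\to\{0,1\}$ such that $i\mapsto(\sigma_x(i),\sigma_y(i))$ is a bijection from $\tilde I$ onto $\{(\tfrac12,0),\dots,(N_0-\tfrac12,0),(\tfrac12,1),\dots,(N_1-\tfrac12,1)\}$, and $\sigma_x(i)>\sigma_x(j)$ whenever $i<j$, $\sigma_y(i)=\sigma_y(j)$. It corresponds to the division of $\Gamma$ into lattice triangles $\{T_i\}_{i\in\tilde I}$ of area $1/2$, where $T_i$ has vertices $(\sigma_x(i)\pm\tfrac12,\sigma_y(i))$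 and $(N_{\varepsilon}-\#\{j<i:\sigma_y(j)=\varepsilon\},\varepsilon)$ with $\varepsilon=1-\sigma_y(i)$. Let $\mathcal{Y}_\sigma\to\mathcal{X}$ be the corresponding toric crepant resolution. Put $\hat I_r=\{k\in\hat I:\sigma_y(k-\tfrac12)=\sigma_y(k+\tfrac12)\}$. The quiver $Q_\sigma$ has vertex set $\hat I$ and arrows $h_i^+:i-\tfrac12\to i+\tfrac12$, $h_i^-:i+\tfrac12\to i-\tfrac12$ ($i\in\tilde I$), and loops $r_k:k\to k$ ($k\in\hat I_r$). $A_\sigma$ is the path algebra over $\mathbb{C}$ (paths composed right to left) modulo the relations: - $h^+_i r_{i-1/2}=r_{i+1/2}h^+_i$ and $r_{i-1/2}h^-_i=h^-_i r_{i+1/2}$ if $i\pm\tfrac12\in\hat I_r$; - $h^+_i r_{i-1/2}=h^-_{i+1}h^+_{i+1}h^+_i$ and $r_{i-1/2}h^-_i=h^-_ih^-_{i+1}h^+_{i+1}$ if $i-\tfrac12\in\hat I_r$, $i+\tfrac12\notin\hat I_r$; - $h^+_ih^+_{i-1}h^-_{i-1}=r_{i+1/2}h^+_i$ and $h^+_{i-1}h^-_{i-1}h^-_i=h^-_ir_{i+1/2}$ if $i-\tfrac12\notin\hat I_r$, $i+\tfrac12\in\hat I_r$; - $h^+_ih^+_{i-1}h^-_{i-1}=h^-_{i+1}h^+_{i+1}h^+_i$ and $h^+_{i-1}h^-_{i-1}h^-_i=h^-_ih^-_{i+1}h^+_{i+1}$ if $i\pm\tfrac12\notin\hat I_r$;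 - $h^+_{k-1/2}h^-_{k-1/2}=h^-_{k+1/2}h^+_{k+1/2}$ for $k\in\hat I_r$. Put $\delta=(1,\dots,1)\in\mathbb{Z}^{\hat I}$. For $\theta$ with $\theta(\delta)=0$, an $A_\sigma$-module of dimension vector $\delta$ is $\theta$-(semi)stable if $\theta(\underline{\dim}\,S)<0$ (resp. $\le0$) for every nonzero proper submodule $S$. Let $\theta_0$ satisfy $\theta_0(\delta)=0$ and $(\theta_0)_k<0$ for all $k\neq0$. The moduli space $\mathfrak{M}^\sigma_{\theta_0}(\delta)$ of $\theta_0$-semistable $A_\sigma$-modules of dimension vector $\delta$ is a crepant resolution of $\mathcal{X}$ isomorphic to $\mathcal{Y}_\sigma$, and is identified with it. $L^\sigma=\bigoplus_{k\in\hat I}L_k^\sigma$ denotes the tautological vector bundle on it, $L^\sigma_k$ being the tautological line bundle at vertex $k$, normalized so that $L_0^\sigma\simeq\mathcal{O}_{\mathcal{Y}_\sigma}$. The tautological homomorphism sends each arrow to the tautological map between the corresponding tautological line bundles. *)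

theory Defs
  imports
    Complex_Main
    "HOL-Algebra.QuotRing"
    "HOL-Library.FuncSet"
    "Graph_Theory.Arc_Walk"
begin

section \<open>Path algebras\<close>

text \<open>
  A quiver is a digraph in the sense of \<^type>\<open>pre_digraph\<close>.  A path from u to v is a triple
  (u, p, v) where p is an arc walk, that is, the list of its arrows in the order in which they are
  traversed.  The triple keeps the trivial paths (u, [], u) apart.  An element of the path algebra
  is its family of coefficients.
\<close>

type_synonym ('v, 'e) path = "'v \<times> 'e list \<times> 'v"

definition paths :: "('v, 'e) pre_digraph \<Rightarrow> ('v, 'e) path set" where
  "paths Q = {(u, p, v). pre_digraph.awalk Q u p v}"

text \<open>
  Paths are composed from right to left: the coefficient of a path in f g is the sum over all its
  decompositions into an initial piece, measured by g, and a final piece, measured by f.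
\<close>

definition path_algebra :: "('v, 'e) pre_digraph \<Rightarrow> (('v, 'e) path \<Rightarrow> complex) ring" where
  "path_algebra Q =
    \<lparr> carrier = {f. finite {w. f w \<noteq> 0} \<and> {w. f w \<noteq> 0} \<subseteq> paths Q},
      monoid.mult = (\<lambda>f g (u, p, v). \<Sum>n\<le>length p. \<Sum>m\<in>verts Q.
          f (m, drop n p, v) * g (u, take n p, m)),
      one = (\<lambda>(u, p, v). if u \<in> verts Q \<and> p = [] \<and> v = u then 1 else 0),
      zero = (\<lambda>w. 0),
      add = (\<lambda>f g w. f w + g w) \<rparr>"

text \<open>The nontrivial path written, like a product, from right to left: its first arrow is last.\<close>

definition word :: "('v, 'e) pre_digraph \<Rightarrow> 'e list \<Rightarrow> ('v, 'e) path \<Rightarrow> complex" where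
  "word Q as = (\<lambda>w. if w = (tail Q (last as), rev as, head Q (hd as)) then 1 else 0)"


section \<open>Partitions\<close>

text \<open>
  A half-integer i is represented throughout by the integer i - 1/2.  So the index set of the
  triangles is {..<N}, and \<open>sx j\<close>, \<open>sy j\<close> stand for
  \<open>\<sigma>\<^sub>x (j + 1/2) - 1/2\<close>, \<open>\<sigma>\<^sub>y (j + 1/2)\<close>.
\<close>

definition is_partition :: "nat \<Rightarrow> nat \<Rightarrow> (nat \<Rightarrow> int) \<Rightarrow> (nat \<Rightarrow> nat) \<Rightarrow> bool" where
  "is_partition N0 N1 sx sy \<longleftrightarrow>
     bij_betw (\<lambda>j. (sx j, sy j)) {..<N0 + N1} ({0..<int N0} \<times> {0} \<union> {0..<int N1} \<times> {1}) \<and>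
     (\<forall>i j. i < j \<and> j < N0 + N1 \<and> sy i = sy j \<longrightarrow> sx i > sx j)"


section \<open>The quiver with relations and its moduli space\<close>

text \<open>\<open>HP j\<close>, \<open>HM j\<close> are the arrows \<open>h\<^sup>+\<close>, \<open>h\<^sup>-\<close> with index j + 1/2, and \<open>RL k\<close> is the loop at k.\<close>

datatype arrow = HP nat | HM nat | RL nat

type_synonym rep = "arrow \<Rightarrow> complex"

text \<open>Sections of the bundle L over an open set, one component for each vertex.\<close>
type_synonym bundle_section = "nat \<Rightarrow> rep \<Rightarrow> complex"

locale quiver_data =
  fixes N :: nat and sy :: "nat \<Rightarrow> nat" and \<theta> :: "nat \<Rightarrow> real"
begin

definition nxt :: "nat \<Rightarrow> nat" where "nxt j = (j + 1) mod N"

definition prv :: "nat \<Rightarrow> nat" where "prv j = (j + N - 1) mod N"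

text \<open>The vertex k lies between the half-integers encoded by \<open>prv k\<close> and k.\<close>

definition I_r :: "nat set" where "I_r = {k. k < N \<and> sy (prv k) = sy k}"

fun arrow_tail :: "arrow \<Rightarrow> nat" where
  "arrow_tail (HP j) = j"
| "arrow_tail (HM j) = nxt j"
| "arrow_tail (RL k) = k"

fun arrow_head :: "arrow \<Rightarrow> nat" where
  "arrow_head (HP j) = nxt j"
| "arrow_head (HM j) = j"
| "arrow_head (RL k) = k"

definition Q :: "(nat, arrow) pre_digraph" where
  "Q = \<lparr> verts = {..<N}, arcs = HP ` {..<N} \<union> HM ` {..<N} \<union> RL ` I_r,
         tail = arrow_tail, head = arrow_head \<rparr>"

text \<open>Pairs of parallel words, written from right to left, to be identified.\<close>

inductive_set relations :: "(arrow list \<times> arrow list) set" where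
  rr_plus: "\<lbrakk>j < N; j \<in> I_r; nxt j \<in> I_r\<rbrakk> \<Longrightarrow>
    ([HP j, RL j], [RL (nxt j), HP j]) \<in> relations"
| rr_minus: "\<lbrakk>j < N; j \<in> I_r; nxt j \<in> I_r\<rbrakk> \<Longrightarrow>
    ([RL j, HM j], [HM j, RL (nxt j)]) \<in> relations"
| rn_plus: "\<lbrakk>j < N; j \<in> I_r; nxt j \<notin> I_r\<rbrakk> \<Longrightarrow>
    ([HP j, RL j], [HM (nxt j), HP (nxt j), HP j]) \<in> relations"
| rn_minus: "\<lbrakk>j < N; j \<in> I_r; nxt j \<notin> I_r\<rbrakk> \<Longrightarrow>
    ([RL j, HM j], [HM j, HM (nxt j), HP (nxt j)]) \<in> relations"
| nr_plus: "\<lbrakk>j < N; j \<notin> I_r; nxt j \<in> I_r\<rbrakk> \<Longrightarrow>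
    ([HP j, HP (prv j), HM (prv j)], [RL (nxt j), HP j]) \<in> relations"
| nr_minus: "\<lbrakk>j < N; j \<notin> I_r; nxt j \<in> I_r\<rbrakk> \<Longrightarrow>
    ([HP (prv j), HM (prv j), HM j], [HM j, RL (nxt j)]) \<in> relations"
| nn_plus: "\<lbrakk>j < N; j \<notin> I_r; nxt j \<notin> I_r\<rbrakk> \<Longrightarrow>
    ([HP j, HP (prv j), HM (prv j)], [HM (nxt j), HP (nxt j), HP j]) \<in> relations"
| nn_minus: "\<lbrakk>j < N; j \<notin> I_r; nxt j \<notin> I_r\<rbrakk> \<Longrightarrow>
    ([HP (prv j), HM (prv j), HM j], [HM j, HM (nxt j), HP (nxt j)]) \<in> relations"
| loop: "k \<in> I_r \<Longrightarrow>
    ([HP (prv k), HM (prv k)], [HM k, HP k]) \<in> relations"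

definition rel_ideal :: "((nat, arrow) path \<Rightarrow> complex) set" where
  "rel_ideal = Idl\<^bsub>path_algebra Q\<^esub>
     {word Q as \<ominus>\<^bsub>path_algebra Q\<^esub> word Q bs | as bs. (as, bs) \<in> relations}"

definition A :: "((nat, arrow) path \<Rightarrow> complex) set ring" where
  "A = path_algebra Q Quot rel_ideal"

text \<open>
  After a choice of bases, a module with dimension vector (1,...,1) is a number \<open>x a\<close> for every
  arrow a, namely the matrix of a from the line at \<open>tail Q a\<close> to the line at \<open>head Q a\<close>.
\<close>

definition Rep :: "rep set" where
  "Rep = {x \<in> arcs Q \<rightarrow>\<^sub>E UNIV.
            \<forall>(as, bs) \<in> relations. prod_list (map x as) = prod_list (map x bs)}"

definition submodule :: "rep \<Rightarrow> (nat \<Rightarrow> complex set) \<Rightarrow> bool" where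
  "submodule x S \<longleftrightarrow>
     (\<forall>k<N. module.subspace ((*) :: complex \<Rightarrow> complex \<Rightarrow> complex) (S k)) \<and>
     (\<forall>a\<in>arcs Q. \<forall>z\<in>S (tail Q a). x a * z \<in> S (head Q a))"

definition \<theta>_semistable :: "rep \<Rightarrow> bool" where
  "\<theta>_semistable x \<longleftrightarrow>
     (\<forall>S. submodule x S \<and> (\<exists>k<N. S k \<noteq> {0}) \<and> (\<exists>k<N. S k \<noteq> UNIV) \<longrightarrow>
        (\<Sum>k<N. \<theta> k * real (vector_space.dim ((*) :: complex \<Rightarrow> complex \<Rightarrow> complex) (S k))) \<le> 0)"

definition Rep_ss :: "rep set" where
  "Rep_ss = {x \<in> Rep. \<theta>_semistable x}"

definition torus :: "(nat \<Rightarrow> complex) set" where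
  "torus = {g. \<forall>k<N. g k \<noteq> 0}"

definition act :: "(nat \<Rightarrow> complex) \<Rightarrow> rep \<Rightarrow> rep" where
  "act g x = (\<lambda>a\<in>arcs Q. g (head Q a) * x a / g (tail Q a))"

definition orbit :: "rep \<Rightarrow> rep set" where
  "orbit x = (\<lambda>g. act g x) ` torus"

inductive poly_fun :: "(rep \<Rightarrow> complex) \<Rightarrow> bool" where
  const: "poly_fun (\<lambda>x. c)"
| coord: "a \<in> arcs Q \<Longrightarrow> poly_fun (\<lambda>x. x a)"
| add: "poly_fun p \<Longrightarrow> poly_fun q \<Longrightarrow> poly_fun (\<lambda>x. p x + q x)"
| mult: "poly_fun p \<Longrightarrow> poly_fun q \<Longrightarrow> poly_fun (\<lambda>x. p x * q x)"

definition zariski_open :: "rep set \<Rightarrow> bool" where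
  "zariski_open W \<longleftrightarrow>
     (\<exists>P. (\<forall>p\<in>P. poly_fun p) \<and> W = {x \<in> Rep_ss. \<exists>p\<in>P. p x \<noteq> 0})"

definition regular_on :: "rep set \<Rightarrow> (rep \<Rightarrow> complex) \<Rightarrow> bool" where
  "regular_on W f \<longleftrightarrow>
     (\<forall>x\<in>W. \<exists>p q. poly_fun p \<and> poly_fun q \<and> q x \<noteq> 0 \<and> (\<forall>y\<in>W. q y \<noteq> 0 \<longrightarrow> f y = p y / q y))"

text \<open>
  For the stability parameters considered here semistable modules are stable, so the GIT quotient
  \<open>Rep_ss // torus\<close> is the space of orbits with the quotient of the Zariski topology, and its
  functions are the invariant functions upstairs.  The points of the quotient are orbits, hence
  the preimage in \<^term>\<open>Rep_ss\<close> of a set U of points is \<open>\<Union>U\<close>.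
\<close>

definition Y :: "rep set set" where
  "Y = orbit ` Rep_ss"

definition opens :: "rep set set set" where
  "opens = {U. U \<subseteq> Y \<and> zariski_open (\<Union>U)}"

definition O_Y :: "rep set set \<Rightarrow> (rep set \<Rightarrow> complex) set" where
  "O_Y U = {f \<in> extensional U. regular_on (\<Union>U) (\<lambda>x. f (orbit x))}"


section \<open>The tautological bundle and its endomorphisms\<close>

text \<open>
  The tautological line bundle at k is the descent of the trivial bundle on \<^term>\<open>Rep_ss\<close> on whose
  fibre the element g of the torus acts by g k.  The scalars in the torus act trivially on
  \<^term>\<open>Rep_ss\<close>, so one has to twist by a character for the bundle to descend; dividing by g 0 is
  the normalization for which the bundle at 0 is trivial.  Sections are equivariant functions.
\<close>

definition L_sections :: "nat \<Rightarrow> rep set set \<Rightarrow> (rep \<Rightarrow> complex) set" where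
  "L_sections k U = {s \<in> extensional (\<Union>U). regular_on (\<Union>U) s \<and>
     (\<forall>g\<in>torus. \<forall>x\<in>\<Union>U. s (act g x) = g k / g 0 * s x)}"

definition L :: "rep set set \<Rightarrow> bundle_section set" where
  "L U = (\<Pi>\<^sub>E k\<in>{..<N}. L_sections k U)"

definition sec_add :: "rep set set \<Rightarrow> bundle_section \<Rightarrow> bundle_section \<Rightarrow> bundle_section" where
  "sec_add U s t = (\<lambda>k\<in>{..<N}. \<lambda>x\<in>\<Union>U. s k x + t k x)"

definition sec_zero :: "rep set set \<Rightarrow> bundle_section" where
  "sec_zero U = (\<lambda>k\<in>{..<N}. \<lambda>x\<in>\<Union>U. 0)"

definition sec_smult :: "rep set set \<Rightarrow> (rep set \<Rightarrow> complex) \<Rightarrow> bundle_section \<Rightarrow> bundle_section" where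
  "sec_smult U f s = (\<lambda>k\<in>{..<N}. \<lambda>x\<in>\<Union>U. f (orbit x) * s k x)"

definition sec_restrict :: "rep set set \<Rightarrow> bundle_section \<Rightarrow> bundle_section" where
  "sec_restrict V s = (\<lambda>k\<in>{..<N}. restrict (s k) (\<Union>V))"

text \<open>Endomorphisms of L as a sheaf of modules over the structure sheaf.\<close>

definition End_L_carrier :: "(rep set set \<Rightarrow> bundle_section \<Rightarrow> bundle_section) set" where
  "End_L_carrier = {\<phi> \<in> (\<Pi>\<^sub>E U\<in>opens. L U \<rightarrow>\<^sub>E L U).
     (\<forall>U\<in>opens. \<forall>s\<in>L U. \<forall>t\<in>L U. \<phi> U (sec_add U s t) = sec_add U (\<phi> U s) (\<phi> U t)) \<and>
     (\<forall>U\<in>opens. \<forall>f\<in>O_Y U. \<forall>s\<in>L U. \<phi> U (sec_smult U f s) = sec_smult U f (\<phi> U s)) \<and>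
     (\<forall>U\<in>opens. \<forall>V\<in>opens. V \<subseteq> U \<longrightarrow>
        (\<forall>s\<in>L U. \<phi> V (sec_restrict V s) = sec_restrict V (\<phi> U s)))}"

definition End_L :: "(rep set set \<Rightarrow> bundle_section \<Rightarrow> bundle_section) ring" where
  "End_L =
    \<lparr> carrier = End_L_carrier,
      monoid.mult = (\<lambda>\<phi> \<psi>. \<lambda>U\<in>opens. \<lambda>s\<in>L U. \<phi> U (\<psi> U s)),
      one = (\<lambda>U\<in>opens. \<lambda>s\<in>L U. s),
      zero = (\<lambda>U\<in>opens. \<lambda>s\<in>L U. sec_zero U),
      add = (\<lambda>\<phi> \<psi>. \<lambda>U\<in>opens. \<lambda>s\<in>L U. sec_add U (\<phi> U s) (\<psi> U s)) \<rparr>"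

text \<open>
  The matrix entry from vertex u to vertex v of the action of f on the module x.  On a single
  path it is the product of the numbers attached to the arrows of the path.
\<close>

definition path_action :: "((nat, arrow) path \<Rightarrow> complex) \<Rightarrow> rep \<Rightarrow> nat \<Rightarrow> nat \<Rightarrow> complex" where
  "path_action f x u v = (\<Sum>p | f (u, p, v) \<noteq> 0. f (u, p, v) * prod_list (map x p))"

text \<open>
  The fibre of L over the point of x is the module x itself, and the tautological homomorphism
  lets the algebra act fibrewise.  So an arrow a goes to multiplication by the coordinate x a from
  the line bundle at \<open>tail Q a\<close> to the one at \<open>head Q a\<close> (and zero on the other summands), and
  a path goes to the composition of these maps.
\<close>

definition path_tautological ::
    "((nat, arrow) path \<Rightarrow> complex) \<Rightarrow> rep set set \<Rightarrow> bundle_section \<Rightarrow> bundle_section" where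
  "path_tautological f = (\<lambda>U\<in>opens. \<lambda>s\<in>L U. \<lambda>v\<in>{..<N}. \<lambda>x\<in>\<Union>U.
     \<Sum>u<N. path_action f x u v * s u x)"

definition tautological ::
    "((nat, arrow) path \<Rightarrow> complex) set \<Rightarrow> rep set set \<Rightarrow> bundle_section \<Rightarrow> bundle_section" where
  "tautological X = the_elem (path_tautological ` X)"

end

end

theory Submission
  imports
    Defs
    "HOL-Computational_Algebra.Fundamental_Theorem_Algebra"
    "HOL-Computational_Algebra.Polynomial_Factorial"
    "HOL-Computational_Algebra.Field_as_Ring"
begin

text \<open>
  The algebra has two central elements, sums of one cycle at each vertex, and the relations rewrite
  each path into a direct path, which winds around the quiver in one direction only, preceded by
  powers of these cycles.  Hence a path is determined modulo the relations by its ends and its value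
  on generic modules, which is a Laurent monomial in three parameters.  Injectivity follows from
  the linear independence of such monomials.

  For surjectivity, semistable modules are those generated at the vertex 0, so locally the bundles
  are trivialized by paths, and an endomorphism is a matrix of regular functions on the semistable
  locus which transform by characters of the torus.  On each chart, an affine 3-space, such a
  function is a polynomial.  Comparing the expansions in the two extremal charts, whose triangles
  contain the corners of the trapezoid, leaves only the Laurent monomials of paths.
\<close>

section \<open>Locally rational functions on affine space\<close>

text \<open>On the line that covers the cyclic quiver, a direct path from u to v has signed length s
  = v - u + N k, where k is its winding number. A multidegree (k, l, m) is attained by a walk from u
  to v as soon as l and m reach the heights of this direct path. These heights depend on the sign of
  s: they are 0 for s >= 0 and differences of values of \<open>count\<close> for s < 0. The
  exponents of a polynomial in the chart N - 1 obey the first bound, those of a polynomial in the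
  chart 0 the second. So whatever the sign of s, one of the two charts supplies the bound that is
  needed. The obstacle on the geometric side is that regular functions are given only as local
  quotients of polynomials. Before any exponents can be compared, such a function on an affine
  3-space must be shown to be a polynomial. In one variable a fraction in lowest terms and the
  fundamental theorem of algebra do this; in several variables, interpolation in the last coordinate
  reduces the dimension, and factorization of polynomials in several variables is avoided.\<close>

lemma poly_eqI_off_roots:
  fixes P Q R :: "complex poly"
  assumes "R \<noteq> 0" and "\<And>y. poly R y \<noteq> 0 \<Longrightarrow> poly P y = poly Q y"
  shows "P = Q"
proof -
  have "poly ((P - Q) * R) y = 0" for y
    using assms(2)[of y] by auto
  then have "(P - Q) * R = 0" using poly_all_0_iff_0 by blast
  with \<open>R \<noteq> 0\<close> show ?thesis by simp
qed

text \<open>Put one local quotient in lowest terms p' / q'. Comparison with the quotient valid at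
  another point z shows that q' divides its denominator, so q' does not vanish at z. Hence q' has no
  root at all and is constant.\<close>

lemma locally_rational_line_imp_poly:
  fixes f :: "complex \<Rightarrow> complex"
  assumes loc: "\<And>z. \<exists>p q. poly q z \<noteq> 0 \<and> (\<forall>y. poly q y \<noteq> 0 \<longrightarrow> f y = poly p y / poly q y)"
  shows "\<exists>P. \<forall>y. f y = poly P y"
proof -
  obtain p q where q0: "poly q 0 \<noteq> 0" and pq: "\<And>y. poly q y \<noteq> 0 \<Longrightarrow> f y = poly p y / poly q y"
    using loc[of 0] by blast
  have "q \<noteq> 0" using q0 by auto
  define g where "g = gcd p q"
  have "g \<noteq> 0" using \<open>q \<noteq> 0\<close> by (simp add: g_def)
  obtain p' q' where p': "p = p' * g" and q': "q = q' * g" and cop: "coprime p' q'"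
    using gcd_coprime_exists[of p q] \<open>g \<noteq> 0\<close> unfolding g_def by blast
  have key: "poly q' z \<noteq> 0 \<and> f z = poly p' z / poly q' z" for z
  proof -
    obtain p2 q2 where q2: "poly q2 z \<noteq> 0" and pq2: "\<And>y. poly q2 y \<noteq> 0 \<Longrightarrow> f y = poly p2 y / poly q2 y"
      using loc[of z] by blast
    have "q2 \<noteq> 0" using q2 by auto
    have "p * q2 = p2 * q"
    proof (rule poly_eqI_off_roots)
      show "q * q2 \<noteq> 0" using \<open>q \<noteq> 0\<close> \<open>q2 \<noteq> 0\<close> by simp
      show "poly (p * q2) y = poly (p2 * q) y" if "poly (q * q2) y \<noteq> 0" for y
        using that pq[of y] pq2[of y] by (auto simp: frac_eq_eq)
    qed
    then have "p' * q2 = p2 * q'"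
      using \<open>g \<noteq> 0\<close> unfolding p' q' by (simp add: mult.assoc mult.commute mult.left_commute)
    then have eq: "poly p' z * poly q2 z = poly p2 z * poly q' z"
      by (metis poly_mult)
    have "q' dvd p' * q2" using \<open>p' * q2 = p2 * q'\<close> by simp
    then have "q' dvd q2" using cop by (simp add: coprime_commute coprime_dvd_mult_right_iff)
    then have "poly q' z \<noteq> 0" using q2 by (auto elim!: dvdE)
    with eq q2 pq2[OF q2] show ?thesis by (simp add: frac_eq_eq)
  qed
  have "constant (poly q')"
    using fundamental_theorem_of_algebra[of q'] key by blast
  then have "poly q' y = poly q' 0" for y by (auto simp: constant_def)
  then have "f y = poly (smult (1 / poly q' 0) p') y" for y
    using key[of y] by (metis divide_inverse_commute inverse_eq_divide poly_smult)
  then show ?thesis by blast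
qed

text \<open>Polynomials are treated as functions, in the style of \<open>poly_fun\<close>, so that
  restriction to hyperplanes and curves is plain substitution. A point is an infinite sequence of
  which only the first n entries matter.\<close>

inductive mpoly_fun :: "nat \<Rightarrow> ((nat \<Rightarrow> complex) \<Rightarrow> complex) \<Rightarrow> bool" for n where
  const: "mpoly_fun n (\<lambda>z. c)"
| coord: "i < n \<Longrightarrow> mpoly_fun n (\<lambda>z. z i)"
| add: "mpoly_fun n p \<Longrightarrow> mpoly_fun n q \<Longrightarrow> mpoly_fun n (\<lambda>z. p z + q z)"
| mult: "mpoly_fun n p \<Longrightarrow> mpoly_fun n q \<Longrightarrow> mpoly_fun n (\<lambda>z. p z * q z)"

lemma mpoly_fun_mono:
  assumes "mpoly_fun m p" and "m \<le> n"
  shows "mpoly_fun n p"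
  using assms(1) by induction (auto intro: mpoly_fun.intros less_le_trans[OF _ assms(2)])

lemma mpoly_fun_sum:
  assumes "\<And>i. i \<in> I \<Longrightarrow> mpoly_fun n (\<lambda>z. p i z)"
  shows "mpoly_fun n (\<lambda>z. \<Sum>i\<in>I. p i z)"
  using assms by (induction I rule: infinite_finite_induct) (auto intro: mpoly_fun.intros)

lemma mpoly_fun_poly:
  assumes "mpoly_fun n p"
  shows "mpoly_fun n (\<lambda>z. poly P (p z))"
  using assms by (induction P) (auto intro: mpoly_fun.intros)

lemma mpoly_fun_slice:
  assumes "mpoly_fun (Suc n) p"
  shows "mpoly_fun n (\<lambda>z. p (z(n := c)))"
  using assms
proof induction
  case (coord i)
  then show ?case by (cases "i = n") (auto intro: mpoly_fun.intros)
qed (auto intro: mpoly_fun.intros)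

lemma mpoly_fun_curve:
  assumes "mpoly_fun n p" and "\<And>i. i < n \<Longrightarrow> \<exists>P. \<forall>s. \<gamma> s i = poly P s"
  shows "\<exists>P. \<forall>s. p (\<gamma> s) = poly P s"
  using assms(1)
proof induction
  case (const c)
  then show ?case by (intro exI[of _ "[:c:]"]) simp
next
  case (add p q)
  then show ?case by (metis poly_add)
next
  case (mult p q)
  then show ?case by (metis poly_mult)
qed (use assms(2) in blast)

text \<open>The point is that D does not depend on z: a fixed number of nodes then serves for the
  interpolation on all lines in the last direction.\<close>

lemma mpoly_fun_degree_bound:
  assumes "mpoly_fun (Suc n) p"
  shows "\<exists>D. \<forall>z. \<exists>P. degree P \<le> D \<and> (\<forall>s. p (z(n := s)) = poly P s)"
  using assms
proof induction
  case (const c)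
  have "\<forall>z. \<exists>P. degree P \<le> 0 \<and> (\<forall>s. c = poly P s)"
    by (intro allI exI[of _ "[:c:]"]) simp
  then show ?case by blast
next
  case (coord i)
  have "\<exists>P. degree P \<le> 1 \<and> (\<forall>s. (z(n := s)) i = poly P s)" for z :: "nat \<Rightarrow> complex"
  proof (cases "i = n")
    case True
    then show ?thesis by (intro exI[of _ "[:0,1:]"]) simp
  next
    case False
    then show ?thesis by (intro exI[of _ "[:z i:]"]) simp
  qed
  then show ?case by blast
next
  case (add p q)
  then obtain D1 D2 where
    "\<forall>z. \<exists>P. degree P \<le> D1 \<and> (\<forall>s. p (z(n := s)) = poly P s)"
    "\<forall>z. \<exists>P. degree P \<le> D2 \<and> (\<forall>s. q (z(n := s)) = poly P s)" by blast
  then have "\<forall>z. \<exists>P. degree P \<le> max D1 D2 \<and> (\<forall>s. p (z(n := s)) + q (z(n := s)) = poly P s)"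
    by (metis degree_add_le max.coboundedI1 max.coboundedI2 poly_add)
  then show ?case by blast
next
  case (mult p q)
  then obtain D1 D2 where
    "\<forall>z. \<exists>P. degree P \<le> D1 \<and> (\<forall>s. p (z(n := s)) = poly P s)"
    "\<forall>z. \<exists>P. degree P \<le> D2 \<and> (\<forall>s. q (z(n := s)) = poly P s)" by blast
  then have "\<forall>z. \<exists>P. degree P \<le> D1 + D2 \<and> (\<forall>s. p (z(n := s)) * q (z(n := s)) = poly P s)"
    by (metis (no_types, opaque_lifting) add_mono degree_mult_le order_trans poly_mult)
  then show ?case by blast
qed

text \<open>The basis l depends on D only and not on P, so that values at the nodes may later be
  replaced by functions of the remaining coordinates.\<close>

lemma lagrange_interpolation:
  fixes D :: nat
  shows "\<exists>l :: nat \<Rightarrow> complex poly. \<forall>P. degree P \<le> D \<longrightarrow>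
           (\<forall>s. poly P s = (\<Sum>i\<le>D. poly P (of_nat i) * poly (l i) s))"
proof -
  define l :: "nat \<Rightarrow> complex poly" where
    "l i = (\<Prod>j\<in>{..D} - {i}. smult (1 / (of_nat i - of_nat j)) [:- of_nat j, 1:])" for i
  have deg: "degree (l i) \<le> D" if "i \<le> D" for i
  proof -
    have "degree (l i) \<le> (\<Sum>j\<in>{..D} - {i}. 1)"
      unfolding l_def
      by (rule order_trans[OF degree_prod_sum_le])
         (auto intro!: sum_mono simp: degree_smult_eq simp del: smult_pCons)
    also have "\<dots> = D" using that by simp
    finally show ?thesis .
  qed
  have val: "poly (l i) (of_nat k) = (if k = i then 1 else 0)" if "i \<le> D" "k \<le> D" for i k
  proof (cases "k = i")
    case True
    then show ?thesis
      by (auto simp: l_def poly_prod diff_divide_distrib[symmetric] intro!: prod.neutral)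
  next
    case False
    then show ?thesis using that
      by (auto simp: l_def poly_prod intro!: bexI[of _ k])
  qed
  show ?thesis
  proof (intro exI[of _ l] allI impI)
    fix P :: "complex poly" and s
    assume P: "degree P \<le> D"
    define R where "R = (\<Sum>i\<le>D. smult (poly P (of_nat i)) (l i))"
    have "degree R \<le> D" unfolding R_def
      by (rule degree_sum_le) (auto intro: order_trans[OF degree_smult_le] deg)
    have "P = R"
    proof (rule poly_eqI_degree)
      show "poly P x = poly R x" if "x \<in> of_nat ` {..D}" for x
        using that by (auto simp: R_def poly_sum val if_distrib cong: if_cong)
      show "card (of_nat ` {..D} :: complex set) > degree P" "card (of_nat ` {..D} :: complex set) > degree R"
        using P \<open>degree R \<le> D\<close> by (simp_all add: card_image inj_on_def)
    qed
    then show "poly P s = (\<Sum>i\<le>D. poly P (of_nat i) * poly (l i) s)"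
      by (metis (no_types, lifting) R_def poly_smult poly_sum sum.cong)
  qed
qed

definition locally_rational :: "nat \<Rightarrow> ((nat \<Rightarrow> complex) \<Rightarrow> complex) \<Rightarrow> bool" where
  "locally_rational n F \<longleftrightarrow> (\<forall>z. \<exists>p q. mpoly_fun n p \<and> mpoly_fun n q \<and> q z \<noteq> 0 \<and>
     (\<forall>y. q y \<noteq> 0 \<longrightarrow> F y = p y / q y))"

lemma locally_rational_slice:
  assumes "locally_rational (Suc n) F"
  shows "locally_rational n (\<lambda>z. F (z(n := c)))"
  unfolding locally_rational_def
proof
  fix z
  obtain p q where "mpoly_fun (Suc n) p" "mpoly_fun (Suc n) q" "q (z(n := c)) \<noteq> 0"
    "\<forall>y. q y \<noteq> 0 \<longrightarrow> F y = p y / q y"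
    using assms unfolding locally_rational_def by blast
  then show "\<exists>p q. mpoly_fun n p \<and> mpoly_fun n q \<and> q z \<noteq> 0 \<and>
     (\<forall>y. q y \<noteq> 0 \<longrightarrow> F (y(n := c)) = p y / q y)"
    by (intro exI[of _ "\<lambda>z. p (z(n := c))"] exI[of _ "\<lambda>z. q (z(n := c))"])
       (auto intro: mpoly_fun_slice)
qed

lemma locally_rational_curve:
  assumes "locally_rational n F" and \<gamma>: "\<And>i. i < n \<Longrightarrow> \<exists>P. \<forall>s. \<gamma> s i = poly P s"
  shows "\<exists>P. \<forall>s. F (\<gamma> s) = poly P s"
proof (rule locally_rational_line_imp_poly)
  fix z
  obtain p q where pq: "mpoly_fun n p" "mpoly_fun n q" "q (\<gamma> z) \<noteq> 0"
    "\<forall>y. q y \<noteq> 0 \<longrightarrow> F y = p y / q y"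
    using assms unfolding locally_rational_def by blast
  obtain P where "\<forall>s. p (\<gamma> s) = poly P s"
    using mpoly_fun_curve[OF pq(1), of \<gamma>] \<gamma> by blast
  moreover obtain R where "\<forall>s. q (\<gamma> s) = poly R s"
    using mpoly_fun_curve[OF pq(2), of \<gamma>] \<gamma> by blast
  ultimately show "\<exists>p q. poly q z \<noteq> 0 \<and> (\<forall>y. poly q y \<noteq> 0 \<longrightarrow> F (\<gamma> y) = poly p y / poly q y)"
    using pq(3,4) by (intro exI[of _ P] exI[of _ R]) auto
qed

text \<open>
  On a generic line in the direction of the last coordinate, F is a polynomial whose degree is
  bounded by that of a numerator of F, so F is determined there by interpolation from finitely many
  hyperplanes.  Lines through a generic point extend the resulting formula to all points.
\<close>
theorem locally_rational_imp_mpoly_fun: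
  assumes "locally_rational n F"
  shows "mpoly_fun n F"
  using assms
proof (induction n arbitrary: F)
  case 0
  have const: "p y = p (\<lambda>_. 0)" if "mpoly_fun 0 p" for p y
    using that by induction auto
  obtain p q where pq: "mpoly_fun 0 p" "mpoly_fun 0 q" "q (\<lambda>_. 0) \<noteq> 0"
    "\<forall>y. q y \<noteq> 0 \<longrightarrow> F y = p y / q y"
    using 0 unfolding locally_rational_def by blast
  then have "F y = p (\<lambda>_. 0) / q (\<lambda>_. 0)" for y
    using const by metis
  then have "F = (\<lambda>_. p (\<lambda>_. 0) / q (\<lambda>_. 0))" by blast
  then show ?case by (metis mpoly_fun.const)
next
  case (Suc n)
  obtain p q where p: "mpoly_fun (Suc n) p" and q: "mpoly_fun (Suc n) q"
    and q0: "q (\<lambda>_. 0) \<noteq> 0" and pq: "\<And>y. q y \<noteq> 0 \<Longrightarrow> F y = p y / q y"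
    using Suc.prems unfolding locally_rational_def by blast
  obtain D where D: "\<And>z. \<exists>P. degree P \<le> D \<and> (\<forall>s. p (z(n := s)) = poly P s)"
    using mpoly_fun_degree_bound[OF p] by blast
  obtain l :: "nat \<Rightarrow> complex poly" where l: "\<And>P s. degree P \<le> D \<Longrightarrow>
      poly P s = (\<Sum>i\<le>D. poly P (of_nat i) * poly (l i) s)"
    using lagrange_interpolation by metis
  \<comment> \<open>The interpolation formula for F along the last coordinate. Its coefficients are
    restrictions of F to hyperplanes, hence polynomials by the induction hypothesis.\<close>
  define G where "G = (\<lambda>z. \<Sum>i\<le>D. F (z(n := of_nat i)) * poly (l i) (z n))"
  have G: "mpoly_fun (Suc n) G"
    unfolding G_def
    by (intro mpoly_fun_sum mpoly_fun.mult mpoly_fun_poly mpoly_fun.coord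
          mpoly_fun_mono[OF Suc.IH[OF locally_rational_slice[OF Suc.prems]]]) auto
  have coords: "\<exists>P. \<forall>s. (z(n := s)) i = poly P s" for z :: "nat \<Rightarrow> complex" and i
  proof (cases "i = n")
    case True
    then show ?thesis by (intro exI[of _ "[:0,1:]"]) simp
  next
    case False
    then show ?thesis by (intro exI[of _ "[:z i:]"]) simp
  qed
  have FG: "F z = G z" if qz: "q z \<noteq> 0" for z
  proof -
    obtain P where P: "\<And>s. F (z(n := s)) = poly P s"
      using locally_rational_curve[OF Suc.prems, of "\<lambda>s. z(n := s)"] coords by blast
    obtain R where R: "\<And>s. q (z(n := s)) = poly R s"
      using mpoly_fun_curve[OF q, of "\<lambda>s. z(n := s)"] coords by blast
    obtain S where S: "degree S \<le> D" "\<And>s. p (z(n := s)) = poly S s"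
      using D by blast
    have "poly R (z n) \<noteq> 0" using qz R[of "z n"] by simp
    then have "R \<noteq> 0" by auto
    \<comment> \<open>P divides the numerator on this line, so it inherits the degree bound
      D.\<close>
    have "P * R = S"
    proof (rule poly_eqI_off_roots[OF \<open>R \<noteq> 0\<close>])
      show "poly (P * R) y = poly S y" if "poly R y \<noteq> 0" for y
        using that pq[of "z(n := y)"] P R S(2) by simp
    qed
    then have "degree P \<le> D"
      using S(1) \<open>R \<noteq> 0\<close> by (cases "P = 0") (auto simp: degree_mult_eq)
    from l[OF this, of "z n"] show ?thesis
      by (simp add: G_def P[symmetric])
  qed
  have "F z = G z" for z
  proof -
    \<comment> \<open>The line from z, at s = 0, to the origin, at s = 1; q was chosen nonzero at
      the origin, so q vanishes at only finitely many points of this line.\<close>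
    define \<gamma> where "\<gamma> = (\<lambda>s i. (1 - s) * z i)"
    have \<gamma>: "\<exists>P. \<forall>s. \<gamma> s i = poly P s" for i
      by (intro exI[of _ "[:z i, - z i:]"]) (simp add: \<gamma>_def algebra_simps)
    obtain P where P: "\<And>s. F (\<gamma> s) = poly P s"
      using locally_rational_curve[OF Suc.prems, of \<gamma>] \<gamma> by blast
    obtain R where R: "\<And>s. q (\<gamma> s) = poly R s"
      using mpoly_fun_curve[OF q, of \<gamma>] \<gamma> by blast
    obtain S where S: "\<And>s. G (\<gamma> s) = poly S s"
      using mpoly_fun_curve[OF G, of \<gamma>] \<gamma> by blast
    have "\<gamma> 1 = (\<lambda>_. 0)" by (simp add: \<gamma>_def)
    then have "R \<noteq> 0" using q0 R[of 1] by auto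
    have "P = S"
    proof (rule poly_eqI_off_roots[OF \<open>R \<noteq> 0\<close>])
      show "poly P y = poly S y" if "poly R y \<noteq> 0" for y
        using that FG P R S by metis
    qed
    moreover have "\<gamma> 0 = z" by (simp add: \<gamma>_def)
    ultimately show ?thesis using P S by metis
  qed
  then have "F = G" by blast
  with G show ?case by simp
qed

section \<open>Expansion into monomials in three variables\<close>

definition monomial3 :: "nat \<times> nat \<times> nat \<Rightarrow> (nat \<Rightarrow> complex) \<Rightarrow> complex" where
  "monomial3 = (\<lambda>(i, j, k) z. z 0 ^ i * z 1 ^ j * z 2 ^ k)"

text \<open>Three is the dimension of the charts. Uniqueness of coefficients is not claimed here; it
  is obtained for Laurent monomials by \<open>laurent_independent\<close>.\<close>

lemma mpoly_fun_3_expansion: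
  assumes "mpoly_fun 3 F"
  shows "\<exists>E \<alpha>. finite E \<and> (\<forall>z. F z = (\<Sum>e\<in>E. \<alpha> e * monomial3 e z))"
  using assms
proof induction
  case (const c)
  show ?case
    by (intro exI[of _ "{(0, 0, 0)}"] exI[of _ "\<lambda>_. c"]) (simp add: monomial3_def)
next
  case (coord i)
  then have "i = 0 \<or> i = 1 \<or> i = 2" by auto
  then have "\<exists>e. \<forall>z. z i = monomial3 e z"
    by (elim disjE) (rule exI[of _ "(1, 0, 0)"] exI[of _ "(0, 1, 0)"] exI[of _ "(0, 0, 1)"],
        simp add: monomial3_def)+
  then obtain e where "\<And>z. z i = monomial3 e z" by blast
  then show ?case
    by (intro exI[of _ "{e}"] exI[of _ "\<lambda>_. 1"]) simp
next
  case (add p q)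
  then obtain E \<alpha> E' \<beta> where E: "finite E" "\<And>z. p z = (\<Sum>e\<in>E. \<alpha> e * monomial3 e z)"
    and E': "finite E'" "\<And>z. q z = (\<Sum>e\<in>E'. \<beta> e * monomial3 e z)" by blast
  define \<gamma> where "\<gamma> e = (if e \<in> E then \<alpha> e else 0) + (if e \<in> E' then \<beta> e else 0)" for e
  have "p z + q z = (\<Sum>e\<in>E \<union> E'. \<gamma> e * monomial3 e z)" for z
  proof -
    have "p z = (\<Sum>e\<in>E \<union> E'. (if e \<in> E then \<alpha> e else 0) * monomial3 e z)"
      unfolding E by (rule sum.mono_neutral_cong_left) (use E E' in auto)
    moreover have "q z = (\<Sum>e\<in>E \<union> E'. (if e \<in> E' then \<beta> e else 0) * monomial3 e z)"
      unfolding E' by (rule sum.mono_neutral_cong_left) (use E E' in auto)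
    ultimately show ?thesis
      by (simp add: \<gamma>_def sum.distrib distrib_right)
  qed
  with E E' show ?case by (intro exI[of _ "E \<union> E'"] exI[of _ \<gamma>]) auto
next
  case (mult p q)
  then obtain E \<alpha> E' \<beta> where E: "finite E" "\<And>z. p z = (\<Sum>e\<in>E. \<alpha> e * monomial3 e z)"
    and E': "finite E'" "\<And>z. q z = (\<Sum>e\<in>E'. \<beta> e * monomial3 e z)" by blast
  define pls where "pls = (\<lambda>((i, j, k), (i', j', k')). (i + i' :: nat, j + j' :: nat, k + k' :: nat))"
  define \<gamma> where "\<gamma> e = (\<Sum>d | d \<in> E \<times> E' \<and> pls d = e. \<alpha> (fst d) * \<beta> (snd d))" for e
  have m: "monomial3 (pls d) z = monomial3 (fst d) z * monomial3 (snd d) z" for d z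
    by (simp add: monomial3_def pls_def split: prod.split) (simp add: power_add)
  have "p z * q z = (\<Sum>e\<in>pls ` (E \<times> E'). \<gamma> e * monomial3 e z)" for z
  proof -
    have "p z * q z = (\<Sum>d\<in>E \<times> E'. \<alpha> (fst d) * \<beta> (snd d) * monomial3 (pls d) z)"
      unfolding E E' sum_product sum.cartesian_product m
      by (auto intro!: sum.cong simp: mult_ac)
    also have "\<dots> = (\<Sum>e\<in>pls ` (E \<times> E'). \<Sum>d | d \<in> E \<times> E' \<and> pls d = e.
                       \<alpha> (fst d) * \<beta> (snd d) * monomial3 (pls d) z)"
      by (rule sum.image_gen) (use E E' in auto)
    also have "\<dots> = (\<Sum>e\<in>pls ` (E \<times> E'). \<gamma> e * monomial3 e z)"
      by (auto simp: \<gamma>_def sum_distrib_right intro!: sum.cong)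
    finally show ?thesis .
  qed
  with E E' show ?case by (intro exI[of _ "pls ` (E \<times> E')"] exI[of _ \<gamma>]) auto
qed

section \<open>Laurent monomials\<close>

text \<open>Dedekind's argument. Evaluate the relation at \<open>m t s\<close> and subtract
  \<open>\<chi> a t\<close> times the relation at s: the term of a disappears, and the coefficient
  of e is multiplied by \<open>\<chi> e t - \<chi> a t\<close>, which is nonzero for a suitable
  t.\<close>

lemma characters_independent:
  fixes \<chi> :: "'i \<Rightarrow> 'g \<Rightarrow> complex"
  assumes "finite E"
    and closed: "\<And>s t. s \<in> S \<Longrightarrow> t \<in> S \<Longrightarrow> m s t \<in> S"
    and mult: "\<And>e s t. e \<in> E \<Longrightarrow> s \<in> S \<Longrightarrow> t \<in> S \<Longrightarrow> \<chi> e (m s t) = \<chi> e s * \<chi> e t"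
    and nz: "\<And>e. e \<in> E \<Longrightarrow> \<exists>s\<in>S. \<chi> e s \<noteq> 0"
    and dist: "\<And>e e'. e \<in> E \<Longrightarrow> e' \<in> E \<Longrightarrow> e \<noteq> e' \<Longrightarrow> \<exists>s\<in>S. \<chi> e s \<noteq> \<chi> e' s"
    and zero: "\<And>s. s \<in> S \<Longrightarrow> (\<Sum>e\<in>E. \<alpha> e * \<chi> e s) = 0"
    and "e \<in> E"
  shows "\<alpha> e = 0"
proof -
  have "\<forall>e\<in>E. \<alpha> e = 0"
    using \<open>finite E\<close> mult nz dist zero
  proof (induction E arbitrary: \<alpha> rule: finite_induct)
    case empty
    then show ?case by simp
  next
    case (insert a E)
    have E0: "\<alpha> e = 0" if e: "e \<in> E" for e
    proof -
      have "e \<noteq> a" using e insert.hyps by auto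
      then obtain t where t: "t \<in> S" "\<chi> e t \<noteq> \<chi> a t"
        using insert.prems(3)[of e a] e by auto
      have "\<forall>e\<in>E. \<alpha> e * (\<chi> e t - \<chi> a t) = 0"
      proof (rule insert.IH)
        fix s assume s: "s \<in> S"
        have "0 = (\<Sum>e\<in>insert a E. \<alpha> e * \<chi> e (m t s)) - \<chi> a t * (\<Sum>e\<in>insert a E. \<alpha> e * \<chi> e s)"
          using insert.prems(4)[OF s] insert.prems(4)[OF closed[OF t(1) s]] by simp
        also have "\<dots> = (\<Sum>e\<in>insert a E. \<alpha> e * (\<chi> e t - \<chi> a t) * \<chi> e s)"
          unfolding sum_distrib_left sum_subtractf[symmetric]
          by (rule sum.cong) (auto simp: insert.prems(1) s t algebra_simps)
        also have "\<dots> = (\<Sum>e\<in>E. \<alpha> e * (\<chi> e t - \<chi> a t) * \<chi> e s)"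
          using insert.hyps by simp
        finally show "(\<Sum>e\<in>E. \<alpha> e * (\<chi> e t - \<chi> a t) * \<chi> e s) = 0" by simp
      qed (use insert.prems in auto)
      with e t show ?thesis by auto
    qed
    obtain s where "s \<in> S" "\<chi> a s \<noteq> 0" using insert.prems(2) by blast
    moreover have "\<alpha> a * \<chi> a s = 0"
      using insert.prems(4)[OF \<open>s \<in> S\<close>] insert.hyps E0 by simp
    ultimately show ?case using E0 by simp
  qed
  with \<open>e \<in> E\<close> show ?thesis by blast
qed

definition laurent :: "int \<times> int \<times> int \<Rightarrow> complex \<times> complex \<times> complex \<Rightarrow> complex" where
  "laurent = (\<lambda>(k, l, m) (X, A, B). X powi k * A powi l * B powi m)"

lemma laurent_nonzero: "X \<noteq> 0 \<Longrightarrow> A \<noteq> 0 \<Longrightarrow> B \<noteq> 0 \<Longrightarrow> laurent e (X, A, B) \<noteq> 0"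
  by (simp add: laurent_def split: prod.split)

lemma powi_2_inject: "(2 :: complex) powi k = 2 powi l \<longleftrightarrow> k = l"
proof
  assume "(2 :: complex) powi k = 2 powi l"
  then have "norm ((2 :: complex) powi k) = norm ((2 :: complex) powi l)" by simp
  then have "(2 :: real) powi k = 2 powi l" by (simp add: norm_power_int)
  then show "k = l"
    using power_int_strict_increasing[of k l "2 :: real"] power_int_strict_increasing[of l k "2 :: real"]
    by (cases k l rule: linorder_cases) auto
qed simp

lemma laurent_independent:
  assumes "finite E"
    and zero: "\<And>X A B. X \<noteq> 0 \<Longrightarrow> A \<noteq> 0 \<Longrightarrow> B \<noteq> 0 \<Longrightarrow> (\<Sum>e\<in>E. \<alpha> e * laurent e (X, A, B)) = 0"
    and "e \<in> E"
  shows "\<alpha> e = 0"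
proof (rule characters_independent[where S = "(- {0}) \<times> (- {0}) \<times> (- {0})" and \<chi> = laurent
      and m = "\<lambda>(X, A, B) (X', A', B'). (X * X', A * A', B * B')"])
  show "\<exists>s\<in>(- {0}) \<times> (- {0}) \<times> (- {0}). laurent e s \<noteq> 0" for e
    by (rule bexI[of _ "(1, 1, 1)"]) (auto simp: laurent_nonzero)
  show "\<exists>s\<in>(- {0}) \<times> (- {0}) \<times> (- {0}). laurent e s \<noteq> laurent e' s" if "e \<noteq> e'" for e e'
  proof -
    obtain k l m k' l' m' where e: "e = (k, l, m)" "e' = (k', l', m')" by (metis prod.collapse)
    \<comment> \<open>Setting one variable to 2 and the others to 1 isolates one exponent.\<close>
    have "laurent e (2, 1, 1) \<noteq> laurent e' (2, 1, 1) \<or> laurent e (1, 2, 1) \<noteq> laurent e' (1, 2, 1) \<or>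
          laurent e (1, 1, 2) \<noteq> laurent e' (1, 1, 2)"
      using that unfolding e laurent_def by (auto simp: powi_2_inject)
    then show ?thesis by (elim disjE) (erule bexI, simp)+
  qed
qed (use assms in \<open>auto simp: laurent_def power_int_mult_distrib\<close>)

section \<open>The path algebra\<close>

lemma path_algebra_carrier:
  "f \<in> carrier (path_algebra Q) \<longleftrightarrow> finite {w. f w \<noteq> 0} \<and> {w. f w \<noteq> 0} \<subseteq> paths Q"
  by (simp add: path_algebra_def)

lemma path_algebra_mult:
  "(f \<otimes>\<^bsub>path_algebra Q\<^esub> g) (u, p, v) =
     (\<Sum>n\<le>length p. \<Sum>m\<in>verts Q. f (m, drop n p, v) * g (u, take n p, m))"
  by (simp add: path_algebra_def)

lemma path_algebra_add: "f \<oplus>\<^bsub>path_algebra Q\<^esub> g = (\<lambda>w. f w + g w)"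
  by (simp add: path_algebra_def)

lemma path_algebra_zero: "\<zero>\<^bsub>path_algebra Q\<^esub> = (\<lambda>w. 0)"
  by (simp add: path_algebra_def)

lemma path_algebra_one:
  "\<one>\<^bsub>path_algebra Q\<^esub> (u, p, v) = (if u \<in> verts Q \<and> p = [] \<and> v = u then 1 else 0)"
  by (simp add: path_algebra_def)

lemmas path_algebra_simps =
  path_algebra_carrier path_algebra_mult path_algebra_add path_algebra_zero path_algebra_one

lemma (in pre_digraph) cas_append:
  "cas u (p @ q) v \<longleftrightarrow> (\<exists>m. cas u p m \<and> cas m q v)"
  by (induction p arbitrary: u) auto

lemma paths_append:
  assumes "(u, p, m) \<in> paths Q" "(m, q, v) \<in> paths Q"
  shows "(u, p @ q, v) \<in> paths Q"
  using assms by (auto simp: paths_def pre_digraph.awalk_def pre_digraph.cas_append)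

lemma path_algebra_mult_closed:
  assumes f: "f \<in> carrier (path_algebra Q)" and g: "g \<in> carrier (path_algebra Q)"
  shows "f \<otimes>\<^bsub>path_algebra Q\<^esub> g \<in> carrier (path_algebra Q)"
proof -
  let ?S = "\<lambda>f. {w. f w \<noteq> (0 :: complex)}"
  let ?c = "\<lambda>((m, q, v), (u, p, m')). (u, p @ q, v)"
  have *: "\<exists>p1 p2 m. p = p1 @ p2 \<and> f (m, p2, v) \<noteq> 0 \<and> g (u, p1, m) \<noteq> 0"
    if "(f \<otimes>\<^bsub>path_algebra Q\<^esub> g) (u, p, v) \<noteq> 0" for u p v
  proof -
    from that obtain n where "(\<Sum>m\<in>verts Q. f (m, drop n p, v) * g (u, take n p, m)) \<noteq> 0"
      unfolding path_algebra_mult by (meson sum.neutral)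
    then obtain m where "f (m, drop n p, v) * g (u, take n p, m) \<noteq> 0"
      by (meson sum.neutral)
    then show ?thesis
      by (intro exI[of _ "take n p"] exI[of _ "drop n p"] exI[of _ m]) auto
  qed
  have "?S (f \<otimes>\<^bsub>path_algebra Q\<^esub> g) \<subseteq> ?c ` (?S f \<times> ?S g)"
  proof
    fix w assume w: "w \<in> ?S (f \<otimes>\<^bsub>path_algebra Q\<^esub> g)"
    obtain u p v where [simp]: "w = (u, p, v)" by (cases w)
    from *[of u p v] w obtain p1 p2 m where
      "p = p1 @ p2" "f (m, p2, v) \<noteq> 0" "g (u, p1, m) \<noteq> 0" by auto
    then show "w \<in> ?c ` (?S f \<times> ?S g)"
      by (intro image_eqI[of _ _ "((m, p2, v), (u, p1, m))"]) auto
  qed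
  moreover have "finite (?c ` (?S f \<times> ?S g))"
    using f g by (auto simp: path_algebra_carrier)
  moreover have "?S (f \<otimes>\<^bsub>path_algebra Q\<^esub> g) \<subseteq> paths Q"
  proof
    fix w assume w: "w \<in> ?S (f \<otimes>\<^bsub>path_algebra Q\<^esub> g)"
    obtain u p v where [simp]: "w = (u, p, v)" by (cases w)
    from *[of u p v] w obtain p1 p2 m where
      "p = p1 @ p2" "f (m, p2, v) \<noteq> 0" "g (u, p1, m) \<noteq> 0" by auto
    with f g show "w \<in> paths Q"
      by (auto simp: path_algebra_carrier intro!: paths_append)
  qed
  ultimately show ?thesis
    by (simp add: path_algebra_carrier finite_subset)
qed

text \<open>Both sides run over the ways to cut a path twice; \<open>F i r\<close> collects the cuts
  whose first piece has length i and whose middle piece has length r.\<close>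

lemma path_algebra_assoc:
  fixes Q :: "('a, 'b) pre_digraph"
  shows "(f \<otimes>\<^bsub>path_algebra Q\<^esub> g) \<otimes>\<^bsub>path_algebra Q\<^esub> h = f \<otimes>\<^bsub>path_algebra Q\<^esub> (g \<otimes>\<^bsub>path_algebra Q\<^esub> h)"
proof
  fix w :: "'a \<times> 'b list \<times> 'a"
  obtain u p v where w: "w = (u, p, v)" by (cases w)
  define F where "F i r = (\<Sum>m\<in>verts Q. \<Sum>m'\<in>verts Q.
      f (m, drop (i + r) p, v) * g (m', take r (drop i p), m) * h (u, take i p, m'))" for i r
  have "((f \<otimes>\<^bsub>path_algebra Q\<^esub> g) \<otimes>\<^bsub>path_algebra Q\<^esub> h) w = (\<Sum>i\<le>length p. \<Sum>r\<le>length p - i. F i r)"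
  proof -
    have "((f \<otimes>\<^bsub>path_algebra Q\<^esub> g) \<otimes>\<^bsub>path_algebra Q\<^esub> h) w =
       (\<Sum>i\<le>length p. \<Sum>m'\<in>verts Q. \<Sum>r\<le>length p - i. \<Sum>m\<in>verts Q.
          f (m, drop (i + r) p, v) * g (m', take r (drop i p), m) * h (u, take i p, m'))"
      by (simp add: w path_algebra_mult sum_distrib_right add.commute)
    also have "\<dots> = (\<Sum>i\<le>length p. \<Sum>r\<le>length p - i. \<Sum>m'\<in>verts Q. \<Sum>m\<in>verts Q.
          f (m, drop (i + r) p, v) * g (m', take r (drop i p), m) * h (u, take i p, m'))"
      by (rule sum.cong[OF refl]) (rule sum.swap)
    also have "\<dots> = (\<Sum>i\<le>length p. \<Sum>r\<le>length p - i. F i r)"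
            unfolding F_def by (rule sum.cong[OF refl], rule sum.cong[OF refl], rule sum.swap)
    finally show ?thesis .
  qed
  also have "\<dots> = (\<Sum>(i, r)\<in>{(i, r). i + r \<le> length p}. F i r)"
    by (subst sum.Sigma) (auto intro!: sum.cong)
  also have "\<dots> = (\<Sum>n\<le>length p. \<Sum>i\<le>n. F i (n - i))"
    by (rule sum.triangle_reindex_eq)
  also have "\<dots> = (f \<otimes>\<^bsub>path_algebra Q\<^esub> (g \<otimes>\<^bsub>path_algebra Q\<^esub> h)) w"
  proof -
    have "(f \<otimes>\<^bsub>path_algebra Q\<^esub> (g \<otimes>\<^bsub>path_algebra Q\<^esub> h)) w =
       (\<Sum>n\<le>length p. \<Sum>m\<in>verts Q. \<Sum>i\<le>n. \<Sum>m'\<in>verts Q.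
          f (m, drop n p, v) * g (m', take (n - i) (drop i p), m) * h (u, take i p, m'))"
      by (auto simp: w path_algebra_mult sum_distrib_left drop_take min_def mult.assoc intro!: sum.cong)
    also have "\<dots> = (\<Sum>n\<le>length p. \<Sum>i\<le>n. \<Sum>m\<in>verts Q. \<Sum>m'\<in>verts Q.
          f (m, drop n p, v) * g (m', take (n - i) (drop i p), m) * h (u, take i p, m'))"
      by (rule sum.cong[OF refl]) (rule sum.swap)
    also have "\<dots> = (\<Sum>n\<le>length p. \<Sum>i\<le>n. F i (n - i))"
      by (simp add: F_def)
    finally show ?thesis by simp
  qed
  finally show "((f \<otimes>\<^bsub>path_algebra Q\<^esub> g) \<otimes>\<^bsub>path_algebra Q\<^esub> h) w =
      (f \<otimes>\<^bsub>path_algebra Q\<^esub> (g \<otimes>\<^bsub>path_algebra Q\<^esub> h)) w" .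
qed

lemma (in pre_digraph) cas_in_verts:
  "cas u p v \<Longrightarrow> u \<in> verts G \<Longrightarrow> \<forall>a\<in>set p. head G a \<in> verts G \<Longrightarrow> v \<in> verts G"
  by (induction p arbitrary: u) auto

lemma path_algebra_ring:
  assumes fin: "finite (verts Q)" and wf: "\<And>a. a \<in> arcs Q \<Longrightarrow> head Q a \<in> verts Q"
  shows "ring (path_algebra Q)"
proof (rule ringI)
  show "abelian_group (path_algebra Q)"
  proof (rule abelian_groupI)
    fix f g assume "f \<in> carrier (path_algebra Q)" "g \<in> carrier (path_algebra Q)"
    moreover have "{w. f w + g w \<noteq> 0} \<subseteq> {w. f w \<noteq> 0} \<union> {w. g w \<noteq> 0}" by auto
    ultimately show "f \<oplus>\<^bsub>path_algebra Q\<^esub> g \<in> carrier (path_algebra Q)"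
      by (auto simp: path_algebra_carrier path_algebra_add intro: finite_subset)
  next
    fix f assume f: "f \<in> carrier (path_algebra Q)"
    show "\<exists>g\<in>carrier (path_algebra Q). g \<oplus>\<^bsub>path_algebra Q\<^esub> f = \<zero>\<^bsub>path_algebra Q\<^esub>"
      by (rule bexI[of _ "\<lambda>w. - f w"]) (use f in \<open>auto simp: path_algebra_simps\<close>)
  qed (auto simp: path_algebra_simps algebra_simps)
  show "monoid (path_algebra Q)"
  proof (rule monoidI)
    show one: "\<one>\<^bsub>path_algebra Q\<^esub> \<in> carrier (path_algebra Q)"
    proof -
      have "{w. \<one>\<^bsub>path_algebra Q\<^esub> w \<noteq> 0} \<subseteq> (\<lambda>u. (u, [], u)) ` verts Q"
        by (auto simp: path_algebra_one split: if_splits)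
      moreover have "(\<lambda>u. (u, [], u)) ` verts Q \<subseteq> paths Q"
        by (auto simp: paths_def pre_digraph.awalk_def pre_digraph.cas.simps)
      ultimately show ?thesis
        using fin by (auto simp: path_algebra_carrier intro: finite_subset)
    qed
    fix f assume f: "f \<in> carrier (path_algebra Q)"
    \<comment> \<open>Walks start and end in \<open>verts Q\<close>, so the sums over
      \<open>verts Q\<close> in the product miss no term when the other factor is the unit.\<close>
    have supp: "f (u, p, v) = 0" if "u \<notin> verts Q \<or> v \<notin> verts Q" for u p v
    proof (rule ccontr)
      assume "f (u, p, v) \<noteq> 0"
      then have "(u, p, v) \<in> paths Q" using f by (auto simp: path_algebra_carrier)
      then show False using that wf pre_digraph.cas_in_verts[of Q u p v]
        by (auto simp: paths_def pre_digraph.awalk_def)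
    qed
    show "\<one>\<^bsub>path_algebra Q\<^esub> \<otimes>\<^bsub>path_algebra Q\<^esub> f = f"
    proof
      fix w :: "'a \<times> 'b list \<times> 'a"
      obtain u p v where w: "w = (u, p, v)" by (cases w)
      have "(\<one>\<^bsub>path_algebra Q\<^esub> \<otimes>\<^bsub>path_algebra Q\<^esub> f) w =
          (\<Sum>n\<le>length p. if n = length p then f (u, p, v) else 0)"
        unfolding w path_algebra_mult path_algebra_one
      proof (rule sum.cong)
        fix n assume "n \<in> {..length p}"
        show "(\<Sum>m\<in>verts Q. (if m \<in> verts Q \<and> drop n p = [] \<and> v = m then 1 else 0) * f (u, take n p, m))
            = (if n = length p then f (u, p, v) else 0)"
        proof (cases "n = length p \<and> v \<in> verts Q")
          case True
          then have "(\<Sum>m\<in>verts Q. (if m \<in> verts Q \<and> drop n p = [] \<and> v = m then 1 else 0) * f (u, take n p, m))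
              = (\<Sum>m\<in>verts Q. if v = m then f (u, p, v) else 0)"
            by (intro sum.cong) auto
          with True fin show ?thesis by simp
        next
          case False
          with supp[of u v p] \<open>n \<in> {..length p}\<close> show ?thesis
            by (auto intro!: sum.neutral)
        qed
      qed simp
      then show "(\<one>\<^bsub>path_algebra Q\<^esub> \<otimes>\<^bsub>path_algebra Q\<^esub> f) w = f w" by (simp add: w)
    qed
    show "f \<otimes>\<^bsub>path_algebra Q\<^esub> \<one>\<^bsub>path_algebra Q\<^esub> = f"
    proof
      fix w :: "'a \<times> 'b list \<times> 'a"
      obtain u p v where w: "w = (u, p, v)" by (cases w)
      have "(f \<otimes>\<^bsub>path_algebra Q\<^esub> \<one>\<^bsub>path_algebra Q\<^esub>) w =
          (\<Sum>n\<le>length p. if n = 0 then f (u, p, v) else 0)"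
        unfolding w path_algebra_mult path_algebra_one
      proof (rule sum.cong)
        fix n assume "n \<in> {..length p}"
        show "(\<Sum>m\<in>verts Q. f (m, drop n p, v) * (if u \<in> verts Q \<and> take n p = [] \<and> m = u then 1 else 0))
            = (if n = 0 then f (u, p, v) else 0)"
        proof (cases "n = 0 \<and> u \<in> verts Q")
          case True
          then have "(\<Sum>m\<in>verts Q. f (m, drop n p, v) * (if u \<in> verts Q \<and> take n p = [] \<and> m = u then 1 else 0))
              = (\<Sum>m\<in>verts Q. if u = m then f (u, p, v) else 0)"
            by (intro sum.cong) auto
          with True fin show ?thesis by simp
        next
          case False
          with supp[of u v p] \<open>n \<in> {..length p}\<close> show ?thesis
            by (auto intro!: sum.neutral)
        qed
      qed simp
      then show "(f \<otimes>\<^bsub>path_algebra Q\<^esub> \<one>\<^bsub>path_algebra Q\<^esub>) w = f w" by (simp add: w)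
    qed
  qed (auto intro: path_algebra_mult_closed path_algebra_assoc)
  show "(f \<oplus>\<^bsub>path_algebra Q\<^esub> g) \<otimes>\<^bsub>path_algebra Q\<^esub> h =
      f \<otimes>\<^bsub>path_algebra Q\<^esub> h \<oplus>\<^bsub>path_algebra Q\<^esub> g \<otimes>\<^bsub>path_algebra Q\<^esub> h" for f g h
    by (rule ext) (auto simp: path_algebra_mult path_algebra_add distrib_right sum.distrib)
  show "h \<otimes>\<^bsub>path_algebra Q\<^esub> (f \<oplus>\<^bsub>path_algebra Q\<^esub> g) =
      h \<otimes>\<^bsub>path_algebra Q\<^esub> f \<oplus>\<^bsub>path_algebra Q\<^esub> h \<otimes>\<^bsub>path_algebra Q\<^esub> g" for f g h
    by (rule ext) (auto simp: path_algebra_mult path_algebra_add distrib_left sum.distrib)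
qed

lemma path_algebra_minus:
  assumes "ring (path_algebra Q)" and f: "f \<in> carrier (path_algebra Q)" and g: "g \<in> carrier (path_algebra Q)"
  shows "f \<ominus>\<^bsub>path_algebra Q\<^esub> g = (\<lambda>w. f w - g w)"
proof -
  interpret ring "path_algebra Q" by fact
  have "(\<lambda>w. - g w) \<in> carrier (path_algebra Q)" using g by (simp add: path_algebra_carrier)
  moreover have "(\<lambda>w. - g w) \<oplus>\<^bsub>path_algebra Q\<^esub> g = \<zero>\<^bsub>path_algebra Q\<^esub>"
    by (simp add: path_algebra_add path_algebra_zero)
  ultimately have "\<ominus>\<^bsub>path_algebra Q\<^esub> g = (\<lambda>w. - g w)"
    using g minus_equality by blast
  then show ?thesis by (simp add: a_minus_def path_algebra_add)
qed

section \<open>The basis of paths\<close>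

definition single :: "('v, 'e) path \<Rightarrow> ('v, 'e) path \<Rightarrow> complex" where
  "single w = (\<lambda>w'. if w' = w then 1 else 0)"

lemma single_carrier: "w \<in> paths Q \<Longrightarrow> single w \<in> carrier (path_algebra Q)"
  by (auto simp: path_algebra_carrier single_def)

lemma single_mult:
  assumes "finite (verts Q)" and "m \<in> verts Q"
  shows "single (m, q, v) \<otimes>\<^bsub>path_algebra Q\<^esub> single (u, p, m) = single (u, p @ q, v)"
proof
  fix w :: "'a \<times> 'b list \<times> 'a"
  obtain u' r v' where w: "w = (u', r, v')" by (cases w)
  have split: "drop n r = q \<and> take n r = p \<longleftrightarrow> n = length p \<and> r = p @ q" if "n \<le> length r" for n
    using that append_take_drop_id[of n r] by auto
  have "(single (m, q, v) \<otimes>\<^bsub>path_algebra Q\<^esub> single (u, p, m)) w =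
      (\<Sum>n\<le>length r. \<Sum>m'\<in>verts Q. if m' = m then
         (if (drop n r = q \<and> take n r = p) \<and> v' = v \<and> u' = u then 1 else 0) else 0)"
    unfolding w path_algebra_mult single_def
    by (intro sum.cong refl) simp
  also have "\<dots> = (\<Sum>n\<le>length r. if n = length p then (if w = (u, p @ q, v) then 1 else 0) else 0)"
  proof (rule sum.cong)
    fix n assume "n \<in> {..length r}"
    then have n: "n \<le> length r" by simp
    show "(\<Sum>m'\<in>verts Q. if m' = m then
         (if (drop n r = q \<and> take n r = p) \<and> v' = v \<and> u' = u then 1 else 0) else 0) =
         (if n = length p then (if w = (u, p @ q, v) then 1 else 0) else (0 :: complex))"
      unfolding split[OF n] using assms by (simp add: w)
  qed simp
  also have "\<dots> = single (u, p @ q, v) w"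
    by (simp add: single_def w)
  finally show "(single (m, q, v) \<otimes>\<^bsub>path_algebra Q\<^esub> single (u, p, m)) w = single (u, p @ q, v) w" .
qed

lemma word_eq_single: "word Q as = single (tail Q (last as), rev as, head Q (hd as))"
  by (simp add: word_def single_def)

text \<open>Two-sided ideals are complex subspaces, since scaling is multiplication by a multiple of 1.\<close>
lemma path_algebra_scale_one:
  assumes "ring (path_algebra Q)" and f: "f \<in> carrier (path_algebra Q)"
  shows "(\<lambda>w. c * \<one>\<^bsub>path_algebra Q\<^esub> w) \<otimes>\<^bsub>path_algebra Q\<^esub> f = (\<lambda>w. c * f w)"
    and "(\<lambda>w. c * \<one>\<^bsub>path_algebra Q\<^esub> w) \<in> carrier (path_algebra Q)"
proof -
  interpret ring "path_algebra Q" by fact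
  have "(\<lambda>w. c * \<one>\<^bsub>path_algebra Q\<^esub> w) \<otimes>\<^bsub>path_algebra Q\<^esub> f =
      (\<lambda>w. c * (\<one>\<^bsub>path_algebra Q\<^esub> \<otimes>\<^bsub>path_algebra Q\<^esub> f) w)"
    by (rule ext) (auto simp: path_algebra_mult sum_distrib_left mult.assoc)
  then show "(\<lambda>w. c * \<one>\<^bsub>path_algebra Q\<^esub> w) \<otimes>\<^bsub>path_algebra Q\<^esub> f = (\<lambda>w. c * f w)"
    using f by simp
  show "(\<lambda>w. c * \<one>\<^bsub>path_algebra Q\<^esub> w) \<in> carrier (path_algebra Q)"
    using one_closed by (auto simp: path_algebra_carrier intro: rev_finite_subset)
qed

lemma path_algebra_ideal_scale:
  assumes "ideal I (path_algebra Q)" and "f \<in> I"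
  shows "(\<lambda>w. c * f w) \<in> I"
proof -
  interpret ideal I "path_algebra Q" by fact
  show ?thesis
    using path_algebra_scale_one[OF ring_axioms Icarr[OF \<open>f \<in> I\<close>], of c] I_l_closed[OF \<open>f \<in> I\<close>]
    by metis
qed

section \<open>Walks in the quiver modulo the relations\<close>

text \<open>The conditions on \<theta> enter through \<open>semistable_iff\<close> only.\<close>

locale chamber = quiver_data N sy \<theta> for N :: nat and sy :: "nat \<Rightarrow> nat" and \<theta> :: "nat \<Rightarrow> real" +
  assumes N_pos: "0 < N"
    and sy01: "\<And>j. j < N \<Longrightarrow> sy j = 0 \<or> sy j = 1"
    and theta_sum: "(\<Sum>k<N. \<theta> k) = 0"
    and theta_neg: "\<And>k. 0 < k \<Longrightarrow> k < N \<Longrightarrow> \<theta> k < 0"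
begin

lemma nxt_less [simp]: "nxt j < N" and prv_less [simp]: "prv j < N"
  using N_pos by (simp_all add: nxt_def prv_def)

lemma nxt_eq: "j < N \<Longrightarrow> nxt j = (if j = N - 1 then 0 else j + 1)"
  using N_pos by (auto simp: nxt_def)

lemma prv_eq: "j < N \<Longrightarrow> prv j = (if j = 0 then N - 1 else j - 1)"
  using N_pos by (auto simp: prv_def le_mod_geq)

lemma prv_nxt [simp]: "j < N \<Longrightarrow> prv (nxt j) = j"
  using nxt_eq[of j] prv_eq[of "nxt j"] by (auto split: if_splits)

lemma nxt_prv [simp]: "j < N \<Longrightarrow> nxt (prv j) = j"
  using prv_eq[of j] nxt_eq[of "prv j"] by (auto split: if_splits)

lemma I_r_less: "k \<in> I_r \<Longrightarrow> k < N"
  by (simp add: I_r_def)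

lemma verts_Q [simp]: "verts Q = {..<N}" by (simp add: Q_def)

lemma arcs_Q [simp]: "HP j \<in> arcs Q \<longleftrightarrow> j < N" "HM j \<in> arcs Q \<longleftrightarrow> j < N" "RL k \<in> arcs Q \<longleftrightarrow> k \<in> I_r"
  by (auto simp: Q_def)

lemma ends_Q [simp]: "tail Q = arrow_tail" "head Q = arrow_head"
  by (simp_all add: Q_def)

lemma arc_ends: "a \<in> arcs Q \<Longrightarrow> arrow_tail a < N \<and> arrow_head a < N"
  by (cases a) (auto simp: I_r_less)

lemma path_ring: "ring (path_algebra Q)"
  by (rule path_algebra_ring) (auto dest: arc_ends)

sublocale path: ring "path_algebra Q"
  by (rule path_ring)

abbreviation walk :: "nat \<Rightarrow> arrow list \<Rightarrow> nat \<Rightarrow> bool" where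
  "walk \<equiv> pre_digraph.awalk Q"

lemma walk_Nil [simp]: "walk u [] v \<longleftrightarrow> u < N \<and> v = u"
  by (auto simp: pre_digraph.awalk_def pre_digraph.cas.simps)

lemma walk_Cons [simp]: "walk u (a # p) v \<longleftrightarrow> a \<in> arcs Q \<and> arrow_tail a = u \<and> walk (arrow_head a) p v"
  by (auto simp: pre_digraph.awalk_def pre_digraph.cas.simps dest: arc_ends)

lemma walk_ends: "walk u p v \<Longrightarrow> u < N \<and> v < N"
  by (induction p arbitrary: u) (auto dest: arc_ends)

lemma walk_append: "walk u (p @ q) v \<longleftrightarrow> (\<exists>m. walk u p m \<and> walk m q v)"
  by (induction p arbitrary: u) (auto dest: walk_ends)

lemma walk_unique: "walk u p v \<Longrightarrow> walk u p v' \<Longrightarrow> v = v'"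
  by (induction p arbitrary: u) auto

lemma paths_Q: "(u, p, v) \<in> paths Q \<longleftrightarrow> walk u p v"
  by (simp add: paths_def)

subsection \<open>The grading\<close>

text \<open>This and the two heights are the exponents of X, W, Z in the value of an arrow on the
  module \<open>generic (X, W, Z)\<close>, see \<open>generic_value\<close>. Below, the type of the
  edge j, formed by \<open>HP j\<close> and \<open>HM j\<close>, means \<open>sy j\<close>.\<close>

fun winding :: "arrow \<Rightarrow> int" where
  "winding (HP j) = (if j = N - 1 then 1 else 0)"
| "winding (HM j) = (if j = N - 1 then - 1 else 0)"
| "winding (RL k) = 0"

fun height :: "nat \<Rightarrow> arrow \<Rightarrow> int" where
  "height e (HP j) = 0"
| "height e (HM j) = (if sy j = e then 1 else 0)"
| "height e (RL k) = (if sy k = e then 0 else 1)"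

abbreviation winding_number :: "arrow list \<Rightarrow> int" where
  "winding_number p \<equiv> sum_list (map winding p)"

definition multidegree :: "arrow list \<Rightarrow> int \<times> int \<times> int" where
  "multidegree p = (winding_number p, sum_list (map (height 0) p), sum_list (map (height 1) p))"

lemma multidegree_append:
  "multidegree p = multidegree p' \<Longrightarrow> multidegree q = multidegree q' \<Longrightarrow> multidegree (p @ q) = multidegree (p' @ q')"
  by (simp add: multidegree_def)

fun increment :: "(nat \<Rightarrow> int) \<Rightarrow> arrow \<Rightarrow> int" where
  "increment c (HP j) = c (Suc j) - c j"
| "increment c (HM j) = c j - c (Suc j)"
| "increment c (RL k) = 0"

text \<open>Lift the walk to the line covering the cyclic quiver and continue c by c (x + N) = c x +
  (c N - c 0); the sum telescopes there. With c = \<open>int\<close> it measures signed length, with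
  c = \<open>count e\<close> the heights of backward paths.\<close>

lemma sum_increment:
  "walk u p v \<Longrightarrow> sum_list (map (increment c) p) = c v - c u + (c N - c 0) * winding_number p"
proof (induction p arbitrary: u)
  case (Cons a p)
  show ?case
  proof (cases a)
    case (HP j)
    then have j: "j < N" "u = j" "walk (nxt j) p v" using Cons.prems by auto
    with HP Cons.IH[OF j(3)] N_pos nxt_eq[of j] show ?thesis
      by (auto simp: algebra_simps split: if_splits)
  next
    case (HM j)
    then have j: "j < N" "u = nxt j" "walk j p v" using Cons.prems by auto
    with HM Cons.IH[OF j(3)] N_pos nxt_eq[of j] show ?thesis
      by (auto simp: algebra_simps split: if_splits)
  qed (use Cons in auto)
qed auto

lemma relations_walk:
  assumes "(as, bs) \<in> relations"
  shows "\<exists>u v. walk u (rev as) v \<and> walk u (rev bs) v \<and>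
           word Q as = single (u, rev as, v) \<and> word Q bs = single (u, rev bs, v)"
  using assms by cases (auto simp: word_eq_single I_r_less)

text \<open>In the relations attached to an edge j, both words consist of the same arrow of this
  edge and a cycle of the type that is not \<open>sy j\<close>. In \<open>loop\<close> the two words
  are cycles over edges of equal type.\<close>

lemma relations_degree:
  assumes "(as, bs) \<in> relations"
  shows "multidegree (rev as) = multidegree (rev bs)"
  using assms
proof cases
  case (rr_plus j)
  then show ?thesis
    using sy01[of j] sy01[OF nxt_less, of j] sy01[OF prv_less, of j]
    by (auto simp: multidegree_def I_r_def)
next
  case (rr_minus j)
  then show ?thesis
    using sy01[of j] sy01[OF nxt_less, of j] sy01[OF prv_less, of j]
    by (auto simp: multidegree_def I_r_def)
next
  case (rn_plus j)
  then show ?thesis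
    using sy01[of j] sy01[OF nxt_less, of j] sy01[OF prv_less, of j]
    by (auto simp: multidegree_def I_r_def)
next
  case (rn_minus j)
  then show ?thesis
    using sy01[of j] sy01[OF nxt_less, of j] sy01[OF prv_less, of j]
    by (auto simp: multidegree_def I_r_def)
next
  case (nr_plus j)
  then show ?thesis
    using sy01[of j] sy01[OF nxt_less, of j] sy01[OF prv_less, of j]
    by (auto simp: multidegree_def I_r_def)
next
  case (nr_minus j)
  then show ?thesis
    using sy01[of j] sy01[OF nxt_less, of j] sy01[OF prv_less, of j]
    by (auto simp: multidegree_def I_r_def)
next
  case (nn_plus j)
  then show ?thesis
    using sy01[of j] sy01[OF nxt_less, of j] sy01[OF prv_less, of j]
    by (auto simp: multidegree_def I_r_def)
next
  case (nn_minus j)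
  then show ?thesis
    using sy01[of j] sy01[OF nxt_less, of j] sy01[OF prv_less, of j]
    by (auto simp: multidegree_def I_r_def)
next
  case (loop k)
  then show ?thesis by (auto simp: multidegree_def I_r_def)
qed

lemma relations_subset:
  "{word Q as \<ominus>\<^bsub>path_algebra Q\<^esub> word Q bs | as bs. (as, bs) \<in> relations} \<subseteq> carrier (path_algebra Q)"
proof -
  have "word Q as \<ominus>\<^bsub>path_algebra Q\<^esub> word Q bs \<in> carrier (path_algebra Q)"
    if rel: "(as, bs) \<in> relations" for as bs
    using relations_walk[OF that] by (auto intro!: path.minus_closed single_carrier simp: paths_Q)
  then show ?thesis by blast
qed

sublocale rel: ideal rel_ideal "path_algebra Q"
  unfolding rel_ideal_def by (rule path.genideal_ideal[OF relations_subset])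

section \<open>Congruence of walks modulo the relations\<close>

text \<open>Equality of multidegrees is carried along so that normal forms obtained by rewriting can
  be compared by their degrees.\<close>

definition equivalent :: "nat \<Rightarrow> arrow list \<Rightarrow> arrow list \<Rightarrow> nat \<Rightarrow> bool" where
  "equivalent u p q v \<longleftrightarrow> walk u p v \<and> walk u q v \<and> multidegree p = multidegree q \<and>
     single (u, p, v) \<ominus>\<^bsub>path_algebra Q\<^esub> single (u, q, v) \<in> rel_ideal"

lemma single_walk: "walk u p v \<Longrightarrow> single (u, p, v) \<in> carrier (path_algebra Q)"
  by (simp add: single_carrier paths_Q)

lemma equivalent_refl: "walk u p v \<Longrightarrow> equivalent u p p v"
  using rel.zero_closed by (simp add: equivalent_def single_walk path_algebra_minus[OF path_ring] path_algebra_zero)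

lemma equivalent_sym: "equivalent u p q v \<Longrightarrow> equivalent u q p v"
proof -
  assume pq: "equivalent u p q v"
  then have "single (u, q, v) \<ominus>\<^bsub>path_algebra Q\<^esub> single (u, p, v) =
      \<ominus>\<^bsub>path_algebra Q\<^esub> (single (u, p, v) \<ominus>\<^bsub>path_algebra Q\<^esub> single (u, q, v))"
    by (auto simp: equivalent_def single_walk path.minus_add a_minus_def path.a_comm)
  with pq show ?thesis by (simp add: equivalent_def)
qed

lemma equivalent_trans [trans]:
  "equivalent u p q v \<Longrightarrow> equivalent u q r v \<Longrightarrow> equivalent u p r v"
proof -
  assume pq: "equivalent u p q v" and qr: "equivalent u q r v"
  have "single (u, p, v) \<ominus>\<^bsub>path_algebra Q\<^esub> single (u, r, v) =
      (single (u, p, v) \<ominus>\<^bsub>path_algebra Q\<^esub> single (u, q, v)) \<oplus>\<^bsub>path_algebra Q\<^esub>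
      (single (u, q, v) \<ominus>\<^bsub>path_algebra Q\<^esub> single (u, r, v))"
    using pq qr by (simp add: equivalent_def single_walk path_algebra_minus[OF path_ring] path_algebra_add)
  with pq qr show ?thesis by (auto simp: equivalent_def)
qed

text \<open>A prefix of the list is traversed first, so it is a right factor in the algebra.\<close>

lemma equivalent_left:
  assumes "walk u r m" and "equivalent m p q v"
  shows "equivalent u (r @ p) (r @ q) v"
proof -
  have m: "m \<in> verts Q" using assms(1) by (auto dest: walk_ends)
  have "single (u, r @ p, v) \<ominus>\<^bsub>path_algebra Q\<^esub> single (u, r @ q, v) =
     (single (m, p, v) \<ominus>\<^bsub>path_algebra Q\<^esub> single (m, q, v)) \<otimes>\<^bsub>path_algebra Q\<^esub> single (u, r, m)"
    using assms m single_mult[of Q m p v u r] single_mult[of Q m q v u r]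
    by (simp add: equivalent_def single_walk a_minus_def path.l_distr path.l_minus)
  then show ?thesis using assms
    by (auto simp: equivalent_def walk_append single_walk intro!: multidegree_append rel.I_r_closed)
qed

lemma equivalent_right:
  assumes "equivalent u p q m" and "walk m r v"
  shows "equivalent u (p @ r) (q @ r) v"
proof -
  have m: "m \<in> verts Q" using assms(2) by (auto dest: walk_ends)
  have "single (u, p @ r, v) \<ominus>\<^bsub>path_algebra Q\<^esub> single (u, q @ r, v) =
     single (m, r, v) \<otimes>\<^bsub>path_algebra Q\<^esub> (single (u, p, m) \<ominus>\<^bsub>path_algebra Q\<^esub> single (u, q, m))"
    using assms m single_mult[of Q m r v u p] single_mult[of Q m r v u q]
    by (simp add: equivalent_def single_walk a_minus_def path.r_distr path.r_minus)
  then show ?thesis using assms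
    by (auto simp: equivalent_def walk_append single_walk intro!: multidegree_append rel.I_l_closed)
qed

lemma equivalent_relation:
  assumes "(as, bs) \<in> relations" and "p = rev as" "q = rev bs" and "walk u p v"
  shows "equivalent u p q v"
proof -
  obtain u' v' where rel: "walk u' p v'" "walk u' q v'"
    "word Q as = single (u', p, v')" "word Q bs = single (u', q, v')"
    using relations_walk[OF assms(1)] assms(2,3) by auto
  \<comment> \<open>No relation has an empty side, so the first arrow fixes the start of the walk,
    and the walk fixes its end.\<close>
  have "u' = u \<and> v' = v"
  proof (cases p)
    case Nil
    with assms show ?thesis by (auto elim: relations.cases)
  next
    case (Cons a r)
    with rel(1) assms(4) have "u' = u" by auto
    with rel(1) assms(4) show ?thesis by (auto dest: walk_unique)
  qed
  moreover have "word Q as \<ominus>\<^bsub>path_algebra Q\<^esub> word Q bs \<in> rel_ideal"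
    unfolding rel_ideal_def using path.genideal_self[OF relations_subset] assms(1) by blast
  ultimately show ?thesis
    using rel relations_degree[OF assms(1)] assms(2,3) by (auto simp: equivalent_def)
qed

subsection \<open>Central cycles and normal forms\<close>

text \<open>The cycles at k whose sum over all k is the central element W (e = 0) or Z (e = 1).\<close>
definition cycle :: "nat \<Rightarrow> nat \<Rightarrow> arrow list" where
  "cycle e k = (if sy k = e then [HP k, HM k] else if k \<in> I_r then [RL k] else [HM (prv k), HP (prv k)])"

lemma walk_cycle: "k < N \<Longrightarrow> walk k (cycle e k) k"
  by (auto simp: cycle_def)

text \<open>At \<open>nxt j\<close> the convention in \<open>cycle\<close> prefers the next edge if
  it has the type of j; the relation \<open>loop\<close> then exchanges the two edges. Otherwise the
  word on the left is already the chosen cycle.\<close>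

lemma cycle_back: "j < N \<Longrightarrow> equivalent (nxt j) [HM j, HP j] (cycle (sy j) (nxt j)) (nxt j)"
proof (cases "nxt j \<in> I_r")
  case True
  assume "j < N"
  with True have "sy (nxt j) = sy j" by (simp add: I_r_def)
  with \<open>j < N\<close> relations.loop[OF True] show ?thesis
    by (auto simp: cycle_def intro!: equivalent_relation)
next
  case False
  assume "j < N"
  with False have "sy (nxt j) \<noteq> sy j" by (auto simp: I_r_def)
  with \<open>j < N\<close> False show ?thesis
    by (auto simp: cycle_def intro!: equivalent_refl)
qed

text \<open>For the type that edge j does not have, the cycles at its two ends are exactly the words
  which the relations move past \<open>HP j\<close> and \<open>HM j\<close>.\<close>

lemma cycle_off:
  assumes "j < N" and "e < 2" and "e \<noteq> sy j"
  shows "cycle e j = (if j \<in> I_r then [RL j] else [HM (prv j), HP (prv j)])"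
    and "cycle e (nxt j) = (if nxt j \<in> I_r then [RL (nxt j)] else [HP (nxt j), HM (nxt j)])"
proof -
  show "cycle e j = (if j \<in> I_r then [RL j] else [HM (prv j), HP (prv j)])"
    using assms by (simp add: cycle_def)
  have "nxt j \<in> I_r \<longleftrightarrow> sy (nxt j) \<noteq> e"
    using assms sy01[of j] sy01[of "nxt j"] by (auto simp: I_r_def)
  then show "cycle e (nxt j) = (if nxt j \<in> I_r then [RL (nxt j)] else [HP (nxt j), HM (nxt j)])"
    by (simp add: cycle_def)
qed

text \<open>If the cycle runs over the edge j itself, regroup \<open>HP j\<close>,
  \<open>HM j\<close>, \<open>HP j\<close> and use \<open>cycle_back\<close>. In the other case the
  claim is one of the defining relations.\<close>

lemma cycle_HP:
  assumes "j < N" and "e < 2"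
  shows "equivalent j (cycle e j @ [HP j]) (HP j # cycle e (nxt j)) (nxt j)"
proof (cases "e = sy j")
  case True
  have "equivalent j ([HP j] @ [HM j, HP j]) ([HP j] @ cycle (sy j) (nxt j)) (nxt j)"
    by (rule equivalent_left[of _ _ "nxt j"]) (use assms in \<open>auto intro: cycle_back\<close>)
  with True show ?thesis by (simp add: cycle_def)
next
  case False
  show ?thesis unfolding cycle_off[OF assms False]
    using relations.rr_plus[of j] relations.rn_plus[of j] relations.nr_plus[of j] relations.nn_plus[of j] assms
    by (cases "j \<in> I_r"; cases "nxt j \<in> I_r") (auto intro: equivalent_relation)
qed

lemma cycle_HM:
  assumes "j < N" and "e < 2"
  shows "equivalent (nxt j) (cycle e (nxt j) @ [HM j]) (HM j # cycle e j) j"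
proof (cases "e = sy j")
  case True
  have "equivalent (nxt j) (cycle (sy j) (nxt j) @ [HM j]) ([HM j, HP j] @ [HM j]) j"
    by (rule equivalent_right[of _ _ _ "nxt j"]) (use assms in \<open>auto intro: cycle_back equivalent_sym\<close>)
  with True show ?thesis by (simp add: cycle_def)
next
  case False
  have "equivalent (nxt j) (HM j # cycle e j) (cycle e (nxt j) @ [HM j]) j"
    unfolding cycle_off[OF assms False]
    using relations.rr_minus[of j] relations.rn_minus[of j] relations.nr_minus[of j] relations.nn_minus[of j] assms
    by (cases "j \<in> I_r"; cases "nxt j \<in> I_r") (auto intro: equivalent_relation)
  then show ?thesis by (rule equivalent_sym)
qed

text \<open>A loop is itself the cycle of the type other than \<open>sy k\<close>. So it commutes
  with \<open>HP k\<close>, \<open>HM k\<close> by the rules for these two arrows, and with itself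
  trivially.\<close>

lemma cycle_RL:
  assumes "k \<in> I_r" and "e < 2"
  shows "equivalent k (cycle e k @ [RL k]) (RL k # cycle e k) k"
proof (cases "e = sy k")
  case False
  with assms show ?thesis by (auto simp: cycle_def I_r_less intro!: equivalent_refl)
next
  case True
  have k: "k < N" using assms by (simp add: I_r_less)
  define e' where "e' = 1 - e"
  have e': "e' < 2" "e' \<noteq> sy k" using True assms sy01[OF k] by (auto simp: e'_def)
  then have c: "cycle e' k = [RL k]" using assms by (simp add: cycle_def)
  have "equivalent k ([HP k] @ (HM k # cycle e' k)) ([HP k] @ (cycle e' (nxt k) @ [HM k])) k"
    by (rule equivalent_left[of _ _ "nxt k"]) (use k e' in \<open>auto intro: cycle_HM equivalent_sym\<close>)
  also have "equivalent k ([HP k] @ (cycle e' (nxt k) @ [HM k])) ((cycle e' k @ [HP k]) @ [HM k]) k"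
    using equivalent_right[OF equivalent_sym[OF cycle_HP[OF k e'(1)]], of "[HM k]" k] k by simp
  finally show ?thesis using True c by (simp add: cycle_def)
qed

lemma cycle_commute:
  assumes "walk u p v" and "e < 2"
  shows "equivalent u (cycle e u @ p) (p @ cycle e v) v"
  using assms(1)
proof (induction p arbitrary: u)
  case Nil
  then show ?case by (auto intro!: equivalent_refl walk_cycle)
next
  case (Cons a p)
  then have a: "a \<in> arcs Q" "arrow_tail a = u" and p: "walk (arrow_head a) p v" by auto
  have "equivalent u (cycle e u @ [a]) (a # cycle e (arrow_head a)) (arrow_head a)"
    using a assms(2) by (cases a) (auto intro: cycle_HP cycle_HM cycle_RL)
  then have "equivalent u ((cycle e u @ [a]) @ p) ((a # cycle e (arrow_head a)) @ p) v"
    using p by (rule equivalent_right)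
  also have "equivalent u ([a] @ (cycle e (arrow_head a) @ p)) ([a] @ (p @ cycle e v)) v"
    by (rule equivalent_left[of _ _ "arrow_head a"]) (use a p Cons.IH arc_ends in auto)
  then have "equivalent u ((a # cycle e (arrow_head a)) @ p) ((a # p) @ cycle e v) v" by simp
  finally show ?case by simp
qed

primrec forward :: "nat \<Rightarrow> nat \<Rightarrow> arrow list" where
  "forward 0 u = []"
| "forward (Suc n) u = HP u # forward n (nxt u)"

primrec backward :: "nat \<Rightarrow> nat \<Rightarrow> arrow list" where
  "backward 0 u = []"
| "backward (Suc n) u = HM (prv u) # backward n (prv u)"

definition direct :: "int \<Rightarrow> nat \<Rightarrow> arrow list" where
  "direct s u = (if s \<ge> 0 then forward (nat s) u else backward (nat (- s)) u)"

definition normal_form :: "nat \<Rightarrow> nat \<Rightarrow> int \<Rightarrow> nat \<Rightarrow> arrow list" where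
  "normal_form a b s u = concat (replicate a (cycle 0 u)) @ concat (replicate b (cycle 1 u)) @ direct s u"

lemma walk_cycles: "k < N \<Longrightarrow> walk k (concat (replicate a (cycle e k))) k"
  by (induction a) (auto simp: walk_append intro!: walk_cycle exI[of _ k])

lemma cycle_normal_form:
  assumes "walk u (normal_form a b s u) v" and "e < 2"
  shows "\<exists>a' b'. equivalent u (cycle e u @ normal_form a b s u) (normal_form a' b' s u) v"
proof (cases "e = 0")
  case True
  have "equivalent u (cycle e u @ normal_form a b s u) (normal_form (Suc a) b s u) v"
    using assms(1) equivalent_refl[of u "cycle e u @ normal_form a b s u" v]
      walk_cycle[of u e] walk_ends[OF assms(1)] True
    unfolding walk_append by (auto simp: normal_form_def)
  then show ?thesis by blast
next
  case False
  then have e: "e = 1" using assms by simp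
  have u: "u < N" using walk_ends[OF assms(1)] by simp
  have "walk u (concat (replicate b (cycle 1 u)) @ direct s u) v"
    using assms(1) unfolding normal_form_def walk_append
    using walk_cycles[OF u, of a 0] 
    by (metis walk_unique)
  from equivalent_right[OF cycle_commute[OF walk_cycles[OF u, of a 0] assms(2)] this]
  have "equivalent u (cycle e u @ normal_form a b s u) (normal_form a (Suc b) s u) v"
    by (simp add: e normal_form_def)
  then show ?thesis by blast
qed

text \<open>Move the first arrow past the cycles in the normal form of the rest. In front of the
  direct path it then either lengthens this path, or forms a cycle with its first arrow, or is a
  loop and thus a cycle; cycles go to the front by centrality.\<close>

lemma normal_form_exists:
  "walk u p v \<Longrightarrow> \<exists>a b s. equivalent u p (normal_form a b s u) v"
proof (induction p arbitrary: u)
  case Nil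
  then have "equivalent u [] (normal_form 0 0 0 u) v"
    by (auto simp: normal_form_def direct_def intro!: equivalent_refl)
  then show ?case by blast
next
  case (Cons c p)
  let ?h = "arrow_head c"
  have c: "c \<in> arcs Q" "arrow_tail c = u" and p: "walk ?h p v" using Cons.prems by auto
  have u: "u < N" and h: "?h < N" using c arc_ends by auto
  obtain a b s where nf: "equivalent ?h p (normal_form a b s ?h) v"
    using Cons.IH[OF p] by blast
  have wc: "walk u [c] ?h" using c h by simp
  let ?A = "\<lambda>u. concat (replicate a (cycle 0 u))" and ?B = "\<lambda>u. concat (replicate b (cycle 1 u))"
  have comm: "equivalent u ([c] @ concat (replicate n (cycle e ?h))) (concat (replicate n (cycle e u)) @ [c]) ?h"
    if e: "e < 2" for n e
  proof (induction n)
    case 0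
    then show ?case using wc by (auto intro!: equivalent_refl)
  next
    case (Suc n)
    have "equivalent u (([c] @ cycle e ?h) @ concat (replicate n (cycle e ?h)))
        ((cycle e u @ [c]) @ concat (replicate n (cycle e ?h))) ?h"
      by (rule equivalent_right[OF equivalent_sym[OF cycle_commute[OF wc e]] walk_cycles[OF h]])
    also have "equivalent u (cycle e u @ ([c] @ concat (replicate n (cycle e ?h))))
       (cycle e u @ (concat (replicate n (cycle e u)) @ [c])) ?h"
      by (rule equivalent_left[OF walk_cycle[OF u] Suc.IH])
    then have "equivalent u ((cycle e u @ [c]) @ concat (replicate n (cycle e ?h)))
       (concat (replicate (Suc n) (cycle e u)) @ [c]) ?h" by simp
    finally show ?case by simp
  qed
  have d: "walk ?h (direct s ?h) v"
    using nf walk_cycles[OF h, of a 0] walk_cycles[OF h, of b 1]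
    unfolding equivalent_def normal_form_def walk_append
    by (metis walk_unique)
  have "equivalent u ([c] @ p) ([c] @ normal_form a b s ?h) v"
    by (rule equivalent_left[OF wc nf])
  also have "equivalent u (([c] @ ?A ?h) @ ?B ?h @ direct s ?h) ((?A u @ [c]) @ ?B ?h @ direct s ?h) v"
    using comm[of 0 a] walk_cycles[OF h, of b 1] d
    by (intro equivalent_right[of _ _ _ ?h]) (auto simp: walk_append)
  then have "equivalent u ([c] @ normal_form a b s ?h) ((?A u @ [c]) @ ?B ?h @ direct s ?h) v"
    by (simp add: normal_form_def)
  also have "equivalent u (?A u @ (([c] @ ?B ?h) @ direct s ?h)) (?A u @ ((?B u @ [c]) @ direct s ?h)) v"
    by (rule equivalent_left[OF walk_cycles[OF u] equivalent_right[OF comm d]]) simp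
  then have "equivalent u ((?A u @ [c]) @ ?B ?h @ direct s ?h) (?A u @ ?B u @ c # direct s ?h) v" by simp
  finally have 1: "equivalent u (c # p) (?A u @ ?B u @ c # direct s ?h) v" by simp
  \<comment> \<open>The case in which the new arrow, alone or with the next one, makes up a cycle of
    type e.\<close>
  have absorb: "\<exists>a' b' s'. equivalent u (?A u @ ?B u @ q) (normal_form a' b' s' u) v"
    if q: "equivalent u q (cycle e u @ direct s' u) v" and e: "e < 2" for q e s'
  proof -
    have w: "walk u (direct s' u) v"
      using q walk_cycle[OF u, of e] unfolding equivalent_def walk_append
      by (metis walk_unique)
    have AB: "walk u (?A u @ ?B u) u" using walk_cycles[OF u] by (auto simp: walk_append)
    have "equivalent u ((?A u @ ?B u) @ q) ((?A u @ ?B u) @ (cycle e u @ direct s' u)) v"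
      by (rule equivalent_left[OF AB q])
    also have "equivalent u (((?A u @ ?B u) @ cycle e u) @ direct s' u) ((cycle e u @ (?A u @ ?B u)) @ direct s' u) v"
      by (rule equivalent_right[OF equivalent_sym[OF cycle_commute[OF AB e]] w])
    then have "equivalent u ((?A u @ ?B u) @ (cycle e u @ direct s' u)) (cycle e u @ normal_form a b s' u) v"
      by (simp add: normal_form_def)
    finally have *: "equivalent u (?A u @ ?B u @ q) (cycle e u @ normal_form a b s' u) v" by simp
    have "walk u (normal_form a b s' u) v"
      using AB w by (auto simp: normal_form_def walk_append)
    from cycle_normal_form[OF this e] * equivalent_trans show ?thesis by blast
  qed
  have extend: "\<exists>a' b' s'. equivalent u (?A u @ ?B u @ c # direct s ?h) (normal_form a' b' s' u) v"
    if "c # direct s ?h = direct s' u" for s'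
    using 1 that unfolding normal_form_def by (metis equivalent_def equivalent_refl)
  have "\<exists>a' b' s'. equivalent u (?A u @ ?B u @ c # direct s ?h) (normal_form a' b' s' u) v"
  proof (cases c)
    case (RL k)
    then have "k \<in> I_r" "k = u" using c by auto
    define e where "e = 1 - sy u"
    have e: "e < 2" "e \<noteq> sy u" using sy01[OF u] by (auto simp: e_def)
    then have "cycle e u = [RL u]" using \<open>k \<in> I_r\<close> \<open>k = u\<close> by (simp add: cycle_def)
    then have "c # direct s ?h = cycle e u @ direct s u" using RL \<open>k = u\<close> by simp
    moreover have "walk u (c # direct s ?h) v" using c d by simp
    ultimately show ?thesis
      using absorb[of "c # direct s ?h" e s] e(1) by (simp add: equivalent_refl)
  next
    case (HP j)
    then have j: "j = u" using c by auto
    show ?thesis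
    proof (cases "s \<ge> 0")
      case True
      then have "c # direct s ?h = direct (s + 1) u"
        using HP j by (simp add: direct_def nat_add_distrib)
      then show ?thesis by (rule extend)
    next
      case False
      \<comment> \<open>A direct path with s < 0 starts here with \<open>HM u\<close>. Together with
        \<open>HP u\<close> it is the cycle of type \<open>sy u\<close>, and n backward arrows
        remain.\<close>
      define n where "n = nat (- s) - 1"
      have n: "nat (- s) = Suc n" "s = - int (Suc n)" using False by (auto simp: n_def)
      have "c # direct s ?h = cycle (sy u) u @ direct (- int n) u"
        using HP j u n(1) by (simp add: n(2) direct_def cycle_def)
      moreover have "walk u (c # direct s ?h) v" using c d by simp
      ultimately show ?thesis
        using absorb[of "c # direct s ?h" "sy u" "- int n"] sy01[OF u]
        by (metis One_nat_def equivalent_refl less_2_cases_iff)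
    qed
  next
    case (HM j)
    then have j: "u = nxt j" "j < N" using c by auto
    show ?thesis
    proof (cases "s > 0")
      case False
      then have "nat (- (s - 1)) = Suc (nat (- s))" by simp
      then have "c # direct s ?h = direct (s - 1) u"
        using HM j False by (cases "s = 0") (auto simp: direct_def)
      then show ?thesis by (rule extend)
    next
      case True
      define n where "n = nat s - 1"
      have n: "nat s = Suc n" "s = int (Suc n)" using True by (auto simp: n_def)
      have eq: "c # direct s ?h = [HM j, HP j] @ direct (int n) u"
        using HM j n by (auto simp: direct_def)
      with c d have "walk u (direct (int n) u) v"
        using HM j by auto
      from equivalent_right[OF cycle_back[OF j(2)], of "direct (int n) u" v, folded j(1), OF this]
      show ?thesis
        using absorb[of "c # direct s ?h" "sy j" "int n"] sy01[OF j(2)] by (auto simp: eq)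
    qed
  qed
  with 1 show ?case by (meson equivalent_trans)
qed

lemma increment_direct: "sum_list (map (increment int) (direct s u)) = s"
proof -
  have "sum_list (map (increment int) (forward n u)) = int n" for n u
    by (induction n arbitrary: u) auto
  moreover have "sum_list (map (increment int) (backward n u)) = - int n" for n u
    by (induction n arbitrary: u) auto
  ultimately show ?thesis by (simp add: direct_def)
qed

lemma increment_cycle: "k < N \<Longrightarrow> sum_list (map (increment c) (cycle e k)) = 0"
  by (auto simp: cycle_def)

lemma multidegree_cycle:
  assumes "k < N" and "e < 2"
  shows "multidegree (cycle e k) = (0, if e = 0 then 1 else 0, if e = 1 then 1 else 0)"
proof -
  have e: "e = 0 \<or> e = 1" using assms by auto
  consider "sy k = e" | "sy k \<noteq> e" "k \<in> I_r" | "sy k \<noteq> e" "k \<notin> I_r" by blast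
  then show ?thesis
  proof cases
    case 3
    then have "sy (prv k) = e"
      using assms e sy01[of k] sy01[OF prv_less, of k] by (auto simp: I_r_def)
    with 3 e show ?thesis by (auto simp: multidegree_def cycle_def)
  qed (use e sy01[OF assms(1)] in \<open>auto simp: multidegree_def cycle_def\<close>)
qed

lemma multidegree_normal_form:
  assumes "u < N"
  shows "multidegree (normal_form a b s u) =
    (winding_number (direct s u), int a + sum_list (map (height 0) (direct s u)),
     int b + sum_list (map (height 1) (direct s u)))"
proof -
  have "multidegree (concat (replicate n (cycle e u))) = (0, if e = 0 then int n else 0, if e = 1 then int n else 0)"
    if "e < 2" for n e
    using multidegree_cycle[OF assms that] by (induction n) (auto simp: multidegree_def)
  from this[of 0 a] this[of 1 b] show ?thesis
    by (simp add: multidegree_def normal_form_def)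
qed

text \<open>The potential \<open>int\<close> does not change along cycles, so it sees the direct
  part only.\<close>

lemma normal_form_length:
  assumes "walk u (normal_form a b s u) v"
  shows "s = int v - int u + int N * winding_number (direct s u)"
proof -
  have u: "u < N" using walk_ends[OF assms] by simp
  then have "sum_list (map (increment int) (concat (replicate n (cycle e u)))) = 0" for n e
    by (induction n) (auto simp: increment_cycle)
  then have "sum_list (map (increment int) (normal_form a b s u)) = s"
    by (simp add: normal_form_def increment_direct)
  moreover have "winding_number (normal_form a b s u) = winding_number (direct s u)"
    using multidegree_normal_form[OF u, of a b s] by (simp add: multidegree_def)
  ultimately show ?thesis
    using sum_increment[OF assms, of int] by simp
qed

text \<open>Ends and winding number determine s by \<open>normal_form_length\<close>, and then the
  two heights determine a and b. So both walks have the same normal form.\<close>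

theorem equivalent_if_degree_eq:
  assumes p: "walk u p v" and q: "walk u q v" and d: "multidegree p = multidegree q"
  shows "equivalent u p q v"
proof -
  have u: "u < N" using walk_ends[OF p] by simp
  obtain a b s where nf: "equivalent u p (normal_form a b s u) v" using normal_form_exists[OF p] by blast
  obtain a' b' s' where nf': "equivalent u q (normal_form a' b' s' u) v" using normal_form_exists[OF q] by blast
  have eq: "multidegree (normal_form a b s u) = multidegree (normal_form a' b' s' u)"
    using nf nf' d by (simp add: equivalent_def)
  then have "s = s'"
    using normal_form_length[of u a b s v] normal_form_length[of u a' b' s' v] nf nf'
    by (simp add: multidegree_normal_form[OF u] equivalent_def)
  with eq have "a = a' \<and> b = b'" by (simp add: multidegree_normal_form[OF u])
  with \<open>s = s'\<close> nf nf' show ?thesis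
    by (meson equivalent_sym equivalent_trans)
qed

section \<open>Multidegrees of walks between two given vertices\<close>

text \<open>Used as a potential: the height of a backward path is minus its total increment of
  \<open>count e\<close>.\<close>

definition count :: "nat \<Rightarrow> nat \<Rightarrow> int" where
  "count e k = (\<Sum>j<k. if sy j = e then 1 else 0)"

lemma int_nxt: "j < N \<Longrightarrow> int (nxt j) = (int j + 1) mod int N"
  by (simp add: nxt_def zmod_int add.commute)

lemma int_prv: "j < N \<Longrightarrow> int (prv j) = (int j - 1) mod int N"
proof -
  assume "j < N"
  then have "int (prv j) = (int j + int N - 1) mod int N"
    by (simp add: prv_def zmod_int of_nat_diff)
  also have "\<dots> = (int j - 1 + int N) mod int N" by (simp add: algebra_simps)
  finally show ?thesis by (simp only: mod_add_self2)
qed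

lemma walk_forward: "u < N \<Longrightarrow> \<exists>v. walk u (forward n u) v \<and> int v = (int u + int n) mod int N"
proof (induction n arbitrary: u)
  case (Suc n)
  obtain v where v: "walk (nxt u) (forward n (nxt u)) v" "int v = (int (nxt u) + int n) mod int N"
    using Suc.IH[OF nxt_less] by blast
  have "int v = (int u + 1 + int n) mod int N"
    unfolding v(2) int_nxt[OF Suc.prems] by (rule mod_add_left_eq)
  with v(1) Suc.prems show ?case by (auto intro!: exI[of _ v] simp: add.assoc)
qed auto

lemma walk_backward: "u < N \<Longrightarrow> \<exists>v. walk u (backward n u) v \<and> int v = (int u - int n) mod int N"
proof (induction n arbitrary: u)
  case (Suc n)
  obtain v where v: "walk (prv u) (backward n (prv u)) v" "int v = (int (prv u) - int n) mod int N"
    using Suc.IH[OF prv_less] by blast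
  have "int v = (int u - 1 - int n) mod int N"
    unfolding v(2) int_prv[OF Suc.prems] by (rule mod_diff_left_eq)
  with v(1) Suc.prems show ?case by (auto intro!: exI[of _ v] simp: diff_diff_eq)
qed auto

lemma walk_direct:
  assumes "u < N" and "v < N"
  shows "walk u (direct (int v - int u + int N * k) u) v"
proof -
  define s where "s = int v - int u + int N * k"
  have "(int u + s) mod int N = int v" using assms by (simp add: s_def)
  moreover have "\<exists>v'. walk u (direct s u) v' \<and> int v' = (int u + s) mod int N"
  proof (cases "s \<ge> 0")
    case True
    with walk_forward[OF assms(1), of "nat s"] show ?thesis by (simp add: direct_def)
  next
    case False
    with walk_backward[OF assms(1), of "nat (- s)"] show ?thesis by (simp add: direct_def)
  qed
  ultimately show ?thesis by (auto simp: s_def)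
qed

text \<open>The hypotheses say that (l, m) is at least the pair of heights of the direct path with
  winding number k. The difference is made up by a and b central cycles, which leave the winding
  number unchanged.\<close>

theorem walk_of_degree:
  assumes uv: "u < N" "v < N"
    and fw: "0 \<le> int v - int u + int N * k \<Longrightarrow> 0 \<le> l \<and> 0 \<le> m"
    and bw: "int v - int u + int N * k < 0 \<Longrightarrow>
       count 0 u - count 0 v - k * count 0 N \<le> l \<and> count 1 u - count 1 v - k * count 1 N \<le> m"
  shows "\<exists>p. walk u p v \<and> multidegree p = (k, l, m)"
proof -
  define s where "s = int v - int u + int N * k"
  have w: "walk u (direct s u) v" using walk_direct[OF uv] by (simp add: s_def)
  have winding: "winding_number (direct s u) = k"
    using sum_increment[OF w, of int] N_pos by (simp add: increment_direct s_def)
  have height: "sum_list (map (height e) (direct s u)) \<le> (if e = 0 then l else m)" if "e < 2" for e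
  proof (cases "s \<ge> 0")
    case True
    have "sum_list (map (height e) (forward n u)) = 0" for n u
      by (induction n arbitrary: u) auto
    with True fw that show ?thesis by (simp add: direct_def s_def)
  next
    case False
    have "sum_list (map (height e) (backward n u)) = - sum_list (map (increment (count e)) (backward n u))" for n u
      by (induction n arbitrary: u) (auto simp: count_def)
    then have "sum_list (map (height e) (direct s u)) = - sum_list (map (increment (count e)) (direct s u))"
      using False by (simp add: direct_def)
    also have "\<dots> = count e u - count e v - k * count e N"
      using sum_increment[OF w, of "count e"] winding by (simp add: count_def)
    finally show ?thesis using bw False that by (auto simp: s_def less_2_cases_iff)
  qed
  define a where "a = nat (l - sum_list (map (height 0) (direct s u)))"
  define b where "b = nat (m - sum_list (map (height 1) (direct s u)))"
  have "multidegree (normal_form a b s u) = (k, l, m)"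
    using multidegree_normal_form[OF uv(1), of a b s] winding height[of 0] height[of 1]
    by (simp add: a_def b_def)
  moreover have "walk u (normal_form a b s u) v"
    using w walk_cycles[OF uv(1)] by (auto simp: normal_form_def walk_append)
  ultimately show ?thesis by blast
qed

end

lemma prod_list_map_rev: "prod_list (map f (rev p)) = (prod_list (map f p) :: 'a :: comm_monoid_mult)"
  by (induction p) (simp_all add: mult.commute)

context chamber begin

section \<open>The action of paths on representations\<close>

abbreviation path_value :: "rep \<Rightarrow> arrow list \<Rightarrow> complex" where
  "path_value x p \<equiv> prod_list (map x p)"

text \<open>Lets elements with different supports share one index set.\<close>

lemma path_action_superset:
  assumes "finite B" and "{p. f (u, p, v) \<noteq> 0} \<subseteq> B"
  shows "path_action f x u v = (\<Sum>p\<in>B. f (u, p, v) * path_value x p)"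
  unfolding path_action_def by (rule sum.mono_neutral_left) (use assms in auto)

lemma finite_support:
  assumes "f \<in> carrier (path_algebra Q)"
  shows "finite {p. f (u, p, v) \<noteq> 0}" and "finite {p. \<exists>v. f (u, p, v) \<noteq> 0}" and "finite {p. \<exists>u. f (u, p, v) \<noteq> 0}"
proof -
  have "finite ((\<lambda>(u, p, v). p) ` {w. f w \<noteq> 0})"
    using assms by (simp add: path_algebra_carrier)
  then have fin: "finite {p. \<exists>u v. f (u, p, v) \<noteq> 0}"
    by (rule rev_finite_subset) (auto intro: rev_image_eqI)
  show "finite {p. f (u, p, v) \<noteq> 0}" "finite {p. \<exists>v. f (u, p, v) \<noteq> 0}" "finite {p. \<exists>u. f (u, p, v) \<noteq> 0}"
    by (rule finite_subset[OF _ fin]; blast)+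
qed

lemma path_algebra_walk: "f \<in> carrier (path_algebra Q) \<Longrightarrow> f (u, p, v) \<noteq> 0 \<Longrightarrow> walk u p v"
  by (auto simp: path_algebra_carrier paths_Q)

lemma path_action_add:
  assumes "f \<in> carrier (path_algebra Q)" and "g \<in> carrier (path_algebra Q)"
  shows "path_action (\<lambda>w. f w + g w) x u v = path_action f x u v + path_action g x u v"
proof -
  let ?B = "{p. f (u, p, v) \<noteq> 0} \<union> {p. g (u, p, v) \<noteq> 0}"
  have fin: "finite ?B" using assms finite_support(1) by blast
  show ?thesis
    by (subst (1 2 3) path_action_superset[OF fin])
       (auto simp: sum.distrib distrib_right)
qed

lemma path_action_scale: "path_action (\<lambda>w. c * f w) x u v = c * path_action f x u v"
  by (cases "c = 0") (simp_all add: path_action_def sum_distrib_left mult.assoc)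

lemma path_action_diff:
  assumes "f \<in> carrier (path_algebra Q)" and "g \<in> carrier (path_algebra Q)"
  shows "path_action (\<lambda>w. f w - g w) x u v = path_action f x u v - path_action g x u v"
proof -
  have "(\<lambda>w. (- 1) * g w) \<in> carrier (path_algebra Q)" using assms(2) by (simp add: path_algebra_carrier)
  from path_action_add[OF assms(1) this] path_action_scale[of "- 1" g] show ?thesis
    by simp
qed

lemma path_action_single:
  "path_action (single (u, p, v)) x u' v' = (if u' = u \<and> v' = v then path_value x p else 0)"
  by (subst path_action_superset[of "{p}"]) (auto simp: single_def)

text \<open>A path together with a cut is the same as a pair of composable pieces; \<open>B1\<close>
  and \<open>B2\<close> contain all pieces with a nonzero contribution, which makes the reindexing
  finite.\<close>

lemma path_action_mult:
  assumes f: "f \<in> carrier (path_algebra Q)" and g: "g \<in> carrier (path_algebra Q)"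
  shows "path_action (f \<otimes>\<^bsub>path_algebra Q\<^esub> g) x u v = (\<Sum>m<N. path_action f x m v * path_action g x u m)"
proof -
  define B1 where "B1 = {p. \<exists>m. g (u, p, m) \<noteq> 0}"
  define B2 where "B2 = {q. \<exists>m. f (m, q, v) \<noteq> 0}"
  define h where "h p q = (\<Sum>m<N. f (m, q, v) * g (u, p, m)) * (path_value x p * path_value x q)" for p q
  define B where "B = (\<lambda>(p, q). p @ q) ` (B1 \<times> B2)"
  have fin: "finite B1" "finite B2" unfolding B1_def B2_def using finite_support f g by auto
  have h0: "p \<in> B1 \<and> q \<in> B2" if "h p q \<noteq> 0" for p q
  proof -
    from that have "(\<Sum>m<N. f (m, q, v) * g (u, p, m)) \<noteq> 0" by (simp add: h_def)
    then obtain m where "f (m, q, v) * g (u, p, m) \<noteq> 0"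
      by (rule sum.not_neutral_contains_not_neutral)
    then show ?thesis by (auto simp: B1_def B2_def)
  qed
  have mult: "(f \<otimes>\<^bsub>path_algebra Q\<^esub> g) (u, r, v) * path_value x r = (\<Sum>n\<le>length r. h (take n r) (drop n r))" for r
  proof -
    have "path_value x r = path_value x (take n r) * path_value x (drop n r)" for n
      by (metis append_take_drop_id map_append prod_list.append)
    then show ?thesis by (simp add: path_algebra_mult h_def sum_distrib_right)
  qed
  have "path_action (f \<otimes>\<^bsub>path_algebra Q\<^esub> g) x u v = (\<Sum>r\<in>B. (f \<otimes>\<^bsub>path_algebra Q\<^esub> g) (u, r, v) * path_value x r)"
  proof (rule path_action_superset)
    show "{r. (f \<otimes>\<^bsub>path_algebra Q\<^esub> g) (u, r, v) \<noteq> 0} \<subseteq> B"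
    proof
      fix r assume "r \<in> {r. (f \<otimes>\<^bsub>path_algebra Q\<^esub> g) (u, r, v) \<noteq> 0}"
      then have "(\<Sum>n\<le>length r. \<Sum>m\<in>verts Q. f (m, drop n r, v) * g (u, take n r, m)) \<noteq> 0"
        by (simp add: path_algebra_mult)
      then obtain n where "(\<Sum>m\<in>verts Q. f (m, drop n r, v) * g (u, take n r, m)) \<noteq> 0"
        by (rule sum.not_neutral_contains_not_neutral)
      then obtain m where "f (m, drop n r, v) * g (u, take n r, m) \<noteq> 0"
        by (rule sum.not_neutral_contains_not_neutral)
      then show "r \<in> B"
        unfolding B_def B1_def B2_def by (intro image_eqI[of _ _ "(take n r, drop n r)"]) auto
    qed
  qed (use fin in \<open>simp add: B_def\<close>)
  also have "\<dots> = (\<Sum>(r, n)\<in>Sigma B (\<lambda>r. {..length r}). h (take n r) (drop n r))"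
    unfolding mult using fin by (subst sum.Sigma) (auto simp: B_def)
  also have "\<dots> = (\<Sum>(r, n)\<in>(\<lambda>(p, q). (p @ q, length p)) ` (B1 \<times> B2). h (take n r) (drop n r))"
  proof (rule sum.mono_neutral_right)
    show "\<forall>i\<in>Sigma B (\<lambda>r. {..length r}) - (\<lambda>(p, q). (p @ q, length p)) ` (B1 \<times> B2).
        (case i of (r, n) \<Rightarrow> h (take n r) (drop n r)) = 0"
    proof clarify
      fix r n assume n: "n \<le> length r" and notin: "(r, n) \<notin> (\<lambda>(p, q). (p @ q, length p)) ` (B1 \<times> B2)"
      show "h (take n r) (drop n r) = 0"
      proof (rule ccontr)
        assume "h (take n r) (drop n r) \<noteq> 0"
        from h0[OF this] have "(r, n) \<in> (\<lambda>(p, q). (p @ q, length p)) ` (B1 \<times> B2)"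
          using n by (intro image_eqI[of _ _ "(take n r, drop n r)"]) auto
        with notin show False by simp
      qed
    qed
  qed (use fin in \<open>auto simp: B_def\<close>)
  also have "\<dots> = (\<Sum>(p, q)\<in>B1 \<times> B2. h p q)"
    by (subst sum.reindex) (auto simp: inj_on_def intro!: sum.cong)
  also have "\<dots> = (\<Sum>p\<in>B1. \<Sum>q\<in>B2. \<Sum>m<N. (f (m, q, v) * path_value x q) * (g (u, p, m) * path_value x p))"
    by (simp add: sum.cartesian_product[symmetric] h_def sum_distrib_left sum_distrib_right mult_ac)
  also have "\<dots> = (\<Sum>m<N. \<Sum>p\<in>B1. \<Sum>q\<in>B2. (f (m, q, v) * path_value x q) * (g (u, p, m) * path_value x p))"
    by (simp only: sum.swap[of _ "{..<N}"])
  also have "\<dots> = (\<Sum>m<N. (\<Sum>q\<in>B2. f (m, q, v) * path_value x q) * (\<Sum>p\<in>B1. g (u, p, m) * path_value x p))"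
    by (simp only: sum_product sum.swap[of _ B1])
  also have "\<dots> = (\<Sum>m<N. path_action f x m v * path_action g x u m)"
  proof (rule sum.cong[OF refl])
    fix m
    have "path_action f x m v = (\<Sum>q\<in>B2. f (m, q, v) * path_value x q)"
      by (rule path_action_superset) (use fin in \<open>auto simp: B2_def\<close>)
    moreover have "path_action g x u m = (\<Sum>p\<in>B1. g (u, p, m) * path_value x p)"
      by (rule path_action_superset) (use fin in \<open>auto simp: B1_def\<close>)
    ultimately show "(\<Sum>q\<in>B2. f (m, q, v) * path_value x q) * (\<Sum>p\<in>B1. g (u, p, m) * path_value x p) =
        path_action f x m v * path_action g x u m" by simp
  qed
  finally show ?thesis .
qed

section \<open>The relations act as zero\<close>

lemma path_algebra_uminus:
  assumes "f \<in> carrier (path_algebra Q)"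
  shows "\<ominus>\<^bsub>path_algebra Q\<^esub> f = (\<lambda>w. - f w)"
proof (rule path.minus_equality)
  show "(\<lambda>w. - f w) \<in> carrier (path_algebra Q)" using assms by (simp add: path_algebra_carrier)
qed (use assms in \<open>simp_all add: path_algebra_add path_algebra_zero\<close>)

text \<open>The elements that act as zero on every module in \<open>Rep\<close> form a two-sided
  ideal, and this ideal contains the generators.\<close>

lemma rel_ideal_action:
  assumes "f \<in> rel_ideal" and "x \<in> Rep"
  shows "path_action f x u v = 0"
proof -
  define J where "J = {f \<in> carrier (path_algebra Q). \<forall>x\<in>Rep. \<forall>u v. path_action f x u v = 0}"
  have "ideal J (path_algebra Q)"
  proof (rule idealI[OF path_ring])
    show "subgroup J (add_monoid (path_algebra Q))"
    proof (rule subgroup.intro)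
      show "inv\<^bsub>add_monoid (path_algebra Q)\<^esub> f \<in> J" if "f \<in> J" for f
      proof -
        have f: "f \<in> carrier (path_algebra Q)" using that by (simp add: J_def)
        have "\<ominus>\<^bsub>path_algebra Q\<^esub> f \<in> J"
          using that path.a_inv_closed[OF f] path_action_scale[of "- 1" f]
          by (simp add: J_def path_algebra_uminus)
        then show ?thesis by (simp add: a_inv_def)
      qed
    next
      fix f g assume "f \<in> J" "g \<in> J"
      then show "f \<otimes>\<^bsub>add_monoid (path_algebra Q)\<^esub> g \<in> J"
        using path.a_closed[of f g] by (auto simp: J_def path_algebra_add path_action_add)
    next
      show "\<one>\<^bsub>add_monoid (path_algebra Q)\<^esub> \<in> J"
        using path.zero_closed by (simp add: J_def path_algebra_zero path_action_def)
    qed (auto simp: J_def)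
  qed (auto simp: J_def path_action_mult)
  moreover have "{word Q as \<ominus>\<^bsub>path_algebra Q\<^esub> word Q bs | as bs. (as, bs) \<in> relations} \<subseteq> J"
  proof clarify
    fix as bs assume rel: "(as, bs) \<in> relations"
    then obtain u v where w: "walk u (rev as) v" "walk u (rev bs) v"
      "word Q as = single (u, rev as, v)" "word Q bs = single (u, rev bs, v)"
      using relations_walk by blast
    have "path_value y (rev as) = path_value y (rev bs)" if "y \<in> Rep" for y
      using that rel by (auto simp: Rep_def prod_list_map_rev)
    then show "word Q as \<ominus>\<^bsub>path_algebra Q\<^esub> word Q bs \<in> J"
      using w path.minus_closed[OF single_walk single_walk, of u "rev as" v u "rev bs" v]
      by (auto simp: J_def path_algebra_minus[OF path_ring] single_walk path_action_diff path_action_single)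
  qed
  ultimately have "rel_ideal \<subseteq> J"
    unfolding rel_ideal_def by (rule path.genideal_minimal)
  with assms show ?thesis by (auto simp: J_def)
qed

lemma equivalent_value:
  assumes "equivalent u p q v" and "x \<in> Rep"
  shows "path_value x p = path_value x q"
  using rel_ideal_action[of "single (u, p, v) \<ominus>\<^bsub>path_algebra Q\<^esub> single (u, q, v)" x u v] assms
  by (auto simp: equivalent_def path_algebra_minus[OF path_ring] single_walk path_action_diff path_action_single)

text \<open>Relations only compare cycles of equal type, so it suffices that the value of a cycle
  depends on its type alone. \<open>C 0\<close> and \<open>C 1\<close> are the scalars by which the
  two central elements act; a loop at k has type \<open>1 - sy k\<close>.\<close>

lemma RepI:
  assumes "x \<in> extensional (arcs Q)"
    and "\<And>j. j < N \<Longrightarrow> x (HP j) * x (HM j) = C (sy j)" and "\<And>k. k \<in> I_r \<Longrightarrow> x (RL k) = C (1 - sy k)"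
  shows "x \<in> Rep"
proof -
  have off: "1 - sy j = sy k" if "j < N" "k < N" "sy j \<noteq> sy k" for j k
    using sy01[OF that(1)] sy01[OF that(2)] that(3) by auto
  have "prod_list (map x as) = prod_list (map x bs)" if "(as, bs) \<in> relations" for as bs
    using that
  proof cases
    case (rr_plus j)
    then show ?thesis using assms(3)[of j] assms(3)[of "nxt j"] by (simp add: I_r_def)
  next
    case (rr_minus j)
    then show ?thesis using assms(3)[of j] assms(3)[of "nxt j"] by (simp add: I_r_def)
  next
    case (rn_plus j)
    then show ?thesis using assms(3)[of j] assms(2)[of "nxt j"] off[of j "nxt j"] by (auto simp: I_r_def mult_ac)
  next
    case (rn_minus j)
    then show ?thesis using assms(3)[of j] assms(2)[of "nxt j"] off[of j "nxt j"] by (auto simp: I_r_def mult_ac)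
  next
    case (nr_plus j)
    then show ?thesis using assms(3)[of "nxt j"] assms(2)[of "prv j"] off[of "nxt j" "prv j"] by (auto simp: I_r_def mult_ac)
  next
    case (nr_minus j)
    then show ?thesis using assms(3)[of "nxt j"] assms(2)[of "prv j"] off[of "nxt j" "prv j"] by (auto simp: I_r_def mult_ac)
  next
    case (nn_plus j)
    then have "sy (prv j) = sy (nxt j)" using sy01[of j] sy01[of "prv j"] sy01[of "nxt j"] by (auto simp: I_r_def)
    then show ?thesis using nn_plus assms(2)[of "prv j"] assms(2)[of "nxt j"] by (auto simp: mult_ac)
  next
    case (nn_minus j)
    then have "sy (prv j) = sy (nxt j)" using sy01[of j] sy01[of "prv j"] sy01[of "nxt j"] by (auto simp: I_r_def)
    then show ?thesis using nn_minus assms(2)[of "prv j"] assms(2)[of "nxt j"] by (auto simp: mult_ac)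
  next
    case (loop k)
    then show ?thesis using assms(2)[of k] assms(2)[of "prv k"] by (simp add: I_r_def mult.commute)
  qed
  with assms(1) show ?thesis by (auto simp: Rep_def PiE_def)
qed

subsection \<open>Generic representations detect the relations\<close>

text \<open>For nonzero X, W, Z these represent, up to the torus, the modules without zero arrows.
  The torus is used up by making every \<open>HP j\<close> but the last act by 1. Then X is the
  value of one full forward turn, and W, Z are the values of the central elements.\<close>

definition generic :: "complex \<times> complex \<times> complex \<Rightarrow> rep" where
  "generic = (\<lambda>(X, W, Z). \<lambda>a\<in>arcs Q. case a of
      HP j \<Rightarrow> if j = N - 1 then X else 1
    | HM j \<Rightarrow> (if sy j = 0 then W else Z) / (if j = N - 1 then X else 1)
    | RL k \<Rightarrow> if sy k = 0 then Z else W)"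

lemma generic_Rep:
  assumes "X \<noteq> 0"
  shows "generic (X, W, Z) \<in> Rep"
proof (rule RepI[where C = "\<lambda>e. if e = 0 then W else Z"])
  show "generic (X, W, Z) (RL k) = (if 1 - sy k = 0 then W else Z)" if "k \<in> I_r" for k
    using that sy01[OF I_r_less[OF that]] by (auto simp: generic_def)
qed (use assms in \<open>auto simp: generic_def\<close>)

lemma laurent_add: "X \<noteq> 0 \<Longrightarrow> W \<noteq> 0 \<Longrightarrow> Z \<noteq> 0 \<Longrightarrow>
    laurent (k + k', l + l', m + m') (X, W, Z) = laurent (k, l, m) (X, W, Z) * laurent (k', l', m') (X, W, Z)"
  by (simp add: laurent_def power_int_add)

lemma generic_value:
  assumes nz: "X \<noteq> 0" "W \<noteq> 0" "Z \<noteq> 0" and "set p \<subseteq> arcs Q"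
  shows "path_value (generic (X, W, Z)) p = laurent (multidegree p) (X, W, Z)"
  using assms(4)
proof (induction p)
  case Nil
  then show ?case by (simp add: multidegree_def laurent_def)
next
  case (Cons a p)
  have "generic (X, W, Z) a = laurent (winding a, height 0 a, height 1 a) (X, W, Z)"
  proof (cases a)
    case (HP j)
    with Cons.prems show ?thesis by (simp add: generic_def laurent_def)
  next
    case (HM j)
    with Cons.prems sy01[of j] show ?thesis
      by (auto simp: generic_def laurent_def power_int_minus divide_inverse)
  next
    case (RL k)
    with Cons.prems have "sy k = 0 \<or> sy k = 1" using sy01 by (auto simp: I_r_less)
    with RL Cons.prems show ?thesis by (auto simp: generic_def laurent_def)
  qed
  with Cons nz show ?case by (simp add: multidegree_def laurent_add)
qed

text \<open>Induction on the size of the support: subtracting a multiple of the difference of two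
  paths with equal ends and multidegree transfers the coefficient of one to the other, modulo the
  ideal and without changing the sums.\<close>

lemma rel_ideal_if_class_sums:
  assumes "f \<in> carrier (path_algebra Q)"
    and "\<And>u v d. (\<Sum>p | f (u, p, v) \<noteq> 0 \<and> multidegree p = d. f (u, p, v)) = 0"
  shows "f \<in> rel_ideal"
  using assms
proof (induction "card {w. f w \<noteq> 0}" arbitrary: f rule: less_induct)
  case less
  note f = less.prems(1)
  show ?case
  proof (cases "\<exists>w. f w \<noteq> 0")
    case False
    then have "f = \<zero>\<^bsub>path_algebra Q\<^esub>" by (auto simp: path_algebra_zero)
    then show ?thesis by simp
  next
    case True
    then obtain u p v where p: "f (u, p, v) \<noteq> 0" by (metis prod_cases3)
    let ?S = "{q. f (u, q, v) \<noteq> 0 \<and> multidegree q = multidegree p}"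
    \<comment> \<open>A single nonzero coefficient cannot have sum zero.\<close>
    have "\<exists>q\<in>?S. q \<noteq> p"
    proof (rule ccontr)
      assume "\<not> (\<exists>q\<in>?S. q \<noteq> p)"
      then have "?S = {p}" using p by auto
      with less.prems(2)[of u v "multidegree p"] p show False by simp
    qed
    then obtain q where q: "f (u, q, v) \<noteq> 0" "multidegree q = multidegree p" "q \<noteq> p" by blast
    define D where "D = single (u, p, v) \<ominus>\<^bsub>path_algebra Q\<^esub> single (u, q, v)"
    have wp: "walk u p v" and wq: "walk u q v" using path_algebra_walk[OF f] p q by auto
    have D: "D \<in> rel_ideal"
      using equivalent_if_degree_eq[OF wp wq] q(2) by (simp add: equivalent_def D_def)
    have D_eq: "D = (\<lambda>w. single (u, p, v) w - single (u, q, v) w)"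
      unfolding D_def by (rule path_algebra_minus[OF path_ring single_walk[OF wp] single_walk[OF wq]])
    define g where "g = (\<lambda>w. f w - f (u, p, v) * D w)"
    \<comment> \<open>Since q lies in the support of f already, no new path appears while p
      disappears.\<close>
    have supp: "{w. g w \<noteq> 0} \<subseteq> {w. f w \<noteq> 0} - {(u, p, v)}"
      using q(1,3) by (auto simp: g_def D_eq single_def split: if_splits)
    have finf: "finite {w. f w \<noteq> 0}" "{w. f w \<noteq> 0} \<subseteq> paths Q"
      using f by (auto simp: path_algebra_carrier)
    have g: "g \<in> carrier (path_algebra Q)"
      using supp finf by (auto simp: path_algebra_carrier intro: finite_subset)
    have "g \<in> rel_ideal"
    proof (rule less.hyps)
      show "card {w. g w \<noteq> 0} < card {w. f w \<noteq> 0}"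
        by (rule psubset_card_mono[OF finf(1)]) (use supp p in blast)
      fix u' v' d
      let ?T = "{p'. f (u', p', v') \<noteq> 0 \<and> multidegree p' = d}"
      have fin: "finite ?T" using finite_support(1)[OF f, of u' v'] by (rule rev_finite_subset) auto
      have single_sum: "(\<Sum>p'\<in>?T. single (u, r, v) (u', p', v')) = (if u' = u \<and> v' = v \<and> r \<in> ?T then 1 else 0)" for r
      proof -
        have "(\<Sum>p'\<in>?T. single (u, r, v) (u', p', v')) = (\<Sum>p'\<in>?T. if p' = r then (if u' = u \<and> v' = v then 1 else 0) else 0)"
          by (rule sum.cong) (auto simp: single_def)
        also have "\<dots> = (if u' = u \<and> v' = v \<and> r \<in> ?T then 1 else 0)"
          unfolding sum.delta[OF fin] by simp
        finally show ?thesis .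
      qed
      have "(\<Sum>p' | g (u', p', v') \<noteq> 0 \<and> multidegree p' = d. g (u', p', v')) = (\<Sum>p'\<in>?T. g (u', p', v'))"
        by (rule sum.mono_neutral_left) (use fin supp in auto)
      also have "\<dots> = (\<Sum>p'\<in>?T. f (u', p', v')) -
          f (u, p, v) * ((\<Sum>p'\<in>?T. single (u, p, v) (u', p', v')) - (\<Sum>p'\<in>?T. single (u, q, v) (u', p', v')))"
        by (simp add: g_def D_eq sum_subtractf sum_distrib_left right_diff_distrib)
      also have "(\<Sum>p'\<in>?T. single (u, p, v) (u', p', v')) = (if u' = u \<and> v' = v \<and> multidegree p = d then 1 else 0)"
        unfolding single_sum using p by auto
      also have "(\<Sum>p'\<in>?T. single (u, q, v) (u', p', v')) = (if u' = u \<and> v' = v \<and> multidegree p = d then 1 else 0)"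
        unfolding single_sum using q by auto
      finally show "(\<Sum>p' | g (u', p', v') \<noteq> 0 \<and> multidegree p' = d. g (u', p', v')) = 0"
        using less.prems(2) by simp
    qed (fact g)
    then have "g \<oplus>\<^bsub>path_algebra Q\<^esub> (\<lambda>w. f (u, p, v) * D w) \<in> rel_ideal"
      using path_algebra_ideal_scale[OF rel.is_ideal D] by (rule rel.a_closed)
    then show ?thesis by (simp add: path_algebra_add g_def)
  qed
qed

text \<open>On generic modules a matrix entry is a Laurent polynomial in X, W, Z whose coefficients
  are the sums over paths of equal multidegree.\<close>

theorem rel_ideal_if_generic_action_zero:
  assumes f: "f \<in> carrier (path_algebra Q)"
    and zero: "\<And>X W Z u v. X \<noteq> 0 \<Longrightarrow> W \<noteq> 0 \<Longrightarrow> Z \<noteq> 0 \<Longrightarrow> u < N \<Longrightarrow> v < N \<Longrightarrow>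
      path_action f (generic (X, W, Z)) u v = 0"
  shows "f \<in> rel_ideal"
proof (rule rel_ideal_if_class_sums[OF f])
  fix u v d
  let ?P = "{p. f (u, p, v) \<noteq> 0}"
  define \<alpha> where "\<alpha> d = (\<Sum>p | p \<in> ?P \<and> multidegree p = d. f (u, p, v))" for d
  have fin: "finite ?P" by (rule finite_support[OF f])
  have "\<alpha> d = 0"
  proof (cases "d \<in> multidegree ` ?P")
    case False
    then have "{p. p \<in> ?P \<and> multidegree p = d} = {}" by auto
    then show ?thesis unfolding \<alpha>_def by (simp only: sum.empty)
  next
    case True
    then obtain p0 where "f (u, p0, v) \<noteq> 0" by auto
    then have uv: "u < N" "v < N" using path_algebra_walk[OF f] walk_ends by blast+
    show ?thesis
    proof (rule laurent_independent[OF _ _ True])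
      fix X W Z :: complex assume nz: "X \<noteq> 0" "W \<noteq> 0" "Z \<noteq> 0"
      have "0 = (\<Sum>p\<in>?P. f (u, p, v) * path_value (generic (X, W, Z)) p)"
        using zero[OF nz uv] by (simp add: path_action_def)
      also have "\<dots> = (\<Sum>p\<in>?P. f (u, p, v) * laurent (multidegree p) (X, W, Z))"
        by (rule sum.cong[OF refl], subst generic_value[OF nz])
           (use path_algebra_walk[OF f] in \<open>auto simp: pre_digraph.awalk_def\<close>)
      also have "\<dots> = (\<Sum>d\<in>multidegree ` ?P. \<Sum>p | p \<in> ?P \<and> multidegree p = d. f (u, p, v) * laurent (multidegree p) (X, W, Z))"
        by (rule sum.image_gen[OF fin])
      also have "\<dots> = (\<Sum>d\<in>multidegree ` ?P. \<alpha> d * laurent d (X, W, Z))"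
        by (auto simp: \<alpha>_def sum_distrib_right intro!: sum.cong)
      finally show "(\<Sum>d\<in>multidegree ` ?P. \<alpha> d * laurent d (X, W, Z)) = 0" by simp
    qed (use fin in simp)
  qed
  then show "(\<Sum>p | f (u, p, v) \<noteq> 0 \<and> multidegree p = d. f (u, p, v)) = 0"
    by (simp add: \<alpha>_def)
qed

end

section \<open>Semistable representations\<close>

lemma vector_space_complex: "vector_space ((*) :: complex \<Rightarrow> complex \<Rightarrow> complex)"
  by unfold_locales (simp_all add: algebra_simps)

lemma subspace_complex:
  "module.subspace ((*) :: complex \<Rightarrow> complex \<Rightarrow> complex) S \<longleftrightarrow> S = {0} \<or> S = UNIV"
proof -
  interpret vector_space "(*) :: complex \<Rightarrow> complex \<Rightarrow> complex"
    by (rule vector_space_complex)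
  show ?thesis
  proof
    assume S: "subspace S"
    show "S = {0} \<or> S = UNIV"
    proof (cases "S = {0}")
      case False
      then obtain a where "a \<in> S" "a \<noteq> 0" using subspace_0[OF S] by auto
      then have "c \<in> S" for c using subspace_scale[OF S, of a "c / a"] by simp
      then show ?thesis by auto
    qed simp
  qed (auto intro: subspace_single_0 subspace_UNIV)
qed

lemma dim_complex:
  "vector_space.dim ((*) :: complex \<Rightarrow> complex \<Rightarrow> complex) UNIV = 1"
  "vector_space.dim ((*) :: complex \<Rightarrow> complex \<Rightarrow> complex) {0} = 0"
proof -
  interpret vector_space "(*) :: complex \<Rightarrow> complex \<Rightarrow> complex"
    by (rule vector_space_complex)
  have "span {1} = UNIV" by (auto simp: span_singleton)
  then show "dim UNIV = 1"
    using dim_eq_card[of "{1}" UNIV] by (simp add: dependent_single)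
  show "dim {0} = 0"
    using dim_eq_card[of "{}" "{0}"] by (simp add: independent_empty)
qed

context chamber begin

definition reachable :: "rep \<Rightarrow> nat \<Rightarrow> bool" where
  "reachable x k \<longleftrightarrow> (\<exists>p. walk 0 p k \<and> path_value x p \<noteq> 0)"

lemma reachable_0: "reachable x 0"
  using N_pos by (auto simp: reachable_def intro!: exI[of _ "[]"])

lemma reachable_step:
  assumes "reachable x (arrow_tail a)" and "a \<in> arcs Q" and "x a \<noteq> 0"
  shows "reachable x (arrow_head a)"
proof -
  obtain p where "walk 0 p (arrow_tail a)" "path_value x p \<noteq> 0" using assms(1) by (auto simp: reachable_def)
  with assms show ?thesis
    by (auto simp: reachable_def walk_append arc_ends intro!: exI[of _ "p @ [a]"])
qed

text \<open>Reachability of all vertices says that the module is generated at the vertex 0.\<close>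
lemma semistable_iff: "\<theta>_semistable x \<longleftrightarrow> (\<forall>k<N. reachable x k)"
proof
  assume ss: "\<theta>_semistable x"
  show "\<forall>k<N. reachable x k"
  proof (rule ccontr)
    assume "\<not> (\<forall>k<N. reachable x k)"
    then obtain k0 where k0: "k0 < N" "\<not> reachable x k0" by blast
    \<comment> \<open>The submodule generated by the line at 0. The vertices which it misses have
      negative \<theta>, and \<theta> has total 0, so its weight is positive.\<close>
    define S :: "nat \<Rightarrow> complex set" where "S k = (if reachable x k then UNIV else {0})" for k
    have sub: "submodule x S"
      unfolding submodule_def
    proof (intro conjI allI impI ballI)
      show "module.subspace ((*) :: complex \<Rightarrow> complex \<Rightarrow> complex) (S k)" for k
        by (simp add: subspace_complex S_def)
      fix a z assume a: "a \<in> arcs Q" and z: "z \<in> S (tail Q a)"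
      show "x a * z \<in> S (head Q a)"
        using reachable_step[OF _ a] z by (auto simp: S_def split: if_splits)
    qed
    have "S 0 \<noteq> {0}" using reachable_0[of x] by (simp add: S_def) (metis UNIV_I singletonD zero_neq_one)
    moreover have "S k0 \<noteq> UNIV" using k0 by (simp add: S_def) (metis UNIV_I singletonD zero_neq_one)
    ultimately have le: "(\<Sum>k<N. \<theta> k * real (vector_space.dim ((*) :: complex \<Rightarrow> complex \<Rightarrow> complex) (S k))) \<le> 0"
      using ss sub N_pos k0(1) unfolding \<theta>_semistable_def by blast
    have "(\<Sum>k<N. \<theta> k) < (\<Sum>k<N. \<theta> k * real (vector_space.dim ((*) :: complex \<Rightarrow> complex \<Rightarrow> complex) (S k)))"
    proof (rule sum_strict_mono_ex1)
      have nonpos: "\<theta> k < 0" if "k < N" "\<not> reachable x k" for k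
        using theta_neg[of k] that reachable_0[of x] by (cases "k = 0") auto
      show "\<forall>k\<in>{..<N}. \<theta> k \<le> \<theta> k * real (vector_space.dim ((*) :: complex \<Rightarrow> complex \<Rightarrow> complex) (S k))"
        using nonpos by (auto simp: S_def dim_complex less_imp_le)
      show "\<exists>k\<in>{..<N}. \<theta> k < \<theta> k * real (vector_space.dim ((*) :: complex \<Rightarrow> complex \<Rightarrow> complex) (S k))"
        using nonpos[of k0] k0 by (auto simp: S_def dim_complex)
    qed simp
    with le theta_sum show False by simp
  qed
next
  assume reach: "\<forall>k<N. reachable x k"
  show "\<theta>_semistable x"
    unfolding \<theta>_semistable_def
  proof (intro allI impI, elim conjE exE)
    fix S k0 assume sub: "submodule x S" and k0: "k0 < N" "S k0 \<noteq> UNIV"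
    have S: "S k = {0} \<or> S k = UNIV" if "k < N" for k
      using sub that by (simp add: submodule_def subspace_complex)
    \<comment> \<open>A submodule containing the line at 0 is everything; so a proper one meets only
      vertices where \<theta> is negative.\<close>
    have S0: "S 0 = {0}"
    proof (rule ccontr)
      assume "S 0 \<noteq> {0}"
      then have "S 0 = UNIV" using S[OF N_pos] by simp
      obtain p where p: "walk 0 p k0" "path_value x p \<noteq> 0" using reach k0(1) by (auto simp: reachable_def)
      have "S k0 = UNIV" if "walk u p k0" "path_value x p \<noteq> 0" "S u = UNIV" for u
        using that
      proof (induction p arbitrary: u)
        case (Cons a p)
        then have a: "a \<in> arcs Q" "arrow_tail a = u" "x a \<noteq> 0" by auto
        have "x a * z \<in> S (arrow_head a)" for z
          using sub a Cons.prems(3) by (auto simp: submodule_def)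
        from this[of 1] have "S (arrow_head a) = UNIV" using S[of "arrow_head a"] arc_ends[OF a(1)] a(3) by auto
        with Cons show ?case by auto
      qed simp
      with p \<open>S 0 = UNIV\<close> k0(2) show False by blast
    qed
    show "(\<Sum>k<N. \<theta> k * real (vector_space.dim ((*) :: complex \<Rightarrow> complex \<Rightarrow> complex) (S k))) \<le> 0"
    proof (rule sum_nonpos)
      fix k assume "k \<in> {..<N}"
      then show "\<theta> k * real (vector_space.dim ((*) :: complex \<Rightarrow> complex \<Rightarrow> complex) (S k)) \<le> 0"
        using S0 theta_neg[of k] by (cases "k = 0") (auto simp: dim_complex mult_nonpos_nonneg)
    qed
  qed
qed

lemma Rep_ss_iff: "x \<in> Rep_ss \<longleftrightarrow> x \<in> Rep \<and> (\<forall>k<N. reachable x k)"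
  by (simp add: Rep_ss_def semistable_iff)

lemma Rep_ss_walk:
  assumes "x \<in> Rep_ss" and "k < N"
  obtains p where "walk 0 p k" "path_value x p \<noteq> 0"
  using assms by (auto simp: Rep_ss_iff reachable_def)

subsection \<open>The torus action\<close>

lemma act_value:
  assumes "walk u p v" and "g \<in> torus"
  shows "path_value (act g x) p = g v / g u * path_value x p"
  using assms(1)
proof (induction p arbitrary: u)
  case Nil
  with assms(2) show ?case by (simp add: torus_def)
next
  case (Cons a p)
  then have a: "a \<in> arcs Q" "arrow_tail a = u" and p: "walk (arrow_head a) p v" by auto
  have "g (arrow_head a) \<noteq> 0" using arc_ends[OF a(1)] assms(2) by (simp add: torus_def)
  with Cons.IH[OF p] a show ?case by (simp add: act_def)
qed

lemma act_Rep:
  assumes x: "x \<in> Rep" and g: "g \<in> torus"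
  shows "act g x \<in> Rep"
proof -
  have "prod_list (map (act g x) as) = prod_list (map (act g x) bs)" if rel: "(as, bs) \<in> relations" for as bs
  proof -
    obtain u v where w: "walk u (rev as) v" "walk u (rev bs) v" using relations_walk[OF rel] by blast
    have "path_value x (rev as) = path_value x (rev bs)"
      using x rel by (auto simp: Rep_def prod_list_map_rev)
    then have "path_value (act g x) (rev as) = path_value (act g x) (rev bs)"
      by (simp add: act_value[OF w(1) g] act_value[OF w(2) g])
    then show ?thesis by (simp add: prod_list_map_rev)
  qed
  then show ?thesis by (auto simp: Rep_def act_def)
qed

lemma torus_nonzero: "g \<in> torus \<Longrightarrow> k < N \<Longrightarrow> g k \<noteq> 0"
  by (simp add: torus_def)

lemma act_Rep_ss:
  assumes "x \<in> Rep_ss" and g: "g \<in> torus"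
  shows "act g x \<in> Rep_ss"
proof -
  have "reachable (act g x) k" if k: "k < N" for k
  proof -
    obtain p where "walk 0 p k" "path_value x p \<noteq> 0"
      using Rep_ss_walk[OF assms(1) k] by blast
    then show ?thesis
      using g k N_pos by (auto simp: reachable_def act_value torus_nonzero intro!: exI[of _ p])
  qed
  with assms show ?thesis by (simp add: Rep_ss_iff act_Rep)
qed

lemma one_torus: "(\<lambda>_. 1) \<in> torus"
  by (simp add: torus_def)

lemma Rep_ss_extensional: "x \<in> Rep_ss \<Longrightarrow> x \<in> extensional (arcs Q)"
  by (auto simp: Rep_ss_def Rep_def PiE_def)

lemma act_one: "x \<in> Rep_ss \<Longrightarrow> act (\<lambda>_. 1) x = x"
  using Rep_ss_extensional[of x] by (auto simp: act_def fun_eq_iff extensional_def)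

lemma act_mult: "act g (act h x) = act (\<lambda>k. g k * h k) x"
  by (auto simp: act_def fun_eq_iff mult_ac)

lemma orbit_self: "x \<in> Rep_ss \<Longrightarrow> x \<in> orbit x"
  using act_one[of x] one_torus by (auto simp: orbit_def image_iff intro: bexI[of _ "\<lambda>_. 1"])

lemma orbit_act:
  assumes "g \<in> torus" and "x \<in> Rep_ss"
  shows "orbit (act g x) = orbit x"
proof
  show "orbit (act g x) \<subseteq> orbit x"
  proof
    fix y assume "y \<in> orbit (act g x)"
    then obtain h where h: "h \<in> torus" "y = act h (act g x)" by (auto simp: orbit_def)
    then show "y \<in> orbit x"
      using act_mult[of h g x] assms(1)
      by (auto simp: orbit_def torus_def intro!: image_eqI[of _ _ "\<lambda>k. h k * g k"])
  qed
  show "orbit x \<subseteq> orbit (act g x)"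
  proof
    fix y assume "y \<in> orbit x"
    then obtain h where h: "h \<in> torus" "y = act h x" by (auto simp: orbit_def)
    define h' where "h' = (\<lambda>k. h k / g k)"
    have h': "h' \<in> torus" using h assms(1) by (auto simp: torus_def h'_def)
    have "act h' (act g x) = act h x"
      unfolding act_mult act_def
      by (rule restrict_ext) (use assms(1) arc_ends in \<open>auto simp: h'_def torus_nonzero\<close>)
    with h have "y = act h' (act g x)" by simp
    with h' show "y \<in> orbit (act g x)" by (auto simp: orbit_def)
  qed
qed

lemma mem_union_orbits:
  assumes "U \<subseteq> Y"
  shows "x \<in> \<Union>U \<longleftrightarrow> x \<in> Rep_ss \<and> orbit x \<in> U"
proof
  assume "x \<in> \<Union>U"
  then obtain y where y: "y \<in> Rep_ss" "orbit y \<in> U" "x \<in> orbit y" using assms by (auto simp: Y_def)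
  then obtain g where "g \<in> torus" "x = act g y" by (auto simp: orbit_def)
  with y show "x \<in> Rep_ss \<and> orbit x \<in> U" by (simp add: act_Rep_ss orbit_act)
qed (use orbit_self in blast)

lemma act_union_orbits:
  assumes "U \<subseteq> Y" and "x \<in> \<Union>U" and "g \<in> torus"
  shows "act g x \<in> \<Union>U"
  using assms by (simp add: mem_union_orbits act_Rep_ss orbit_act del: Union_iff)

subsection \<open>Charts\<close>

text \<open>\<open>up\<close> and \<open>down\<close> say that the direct path from 0 to k within
  one turn, forward over 0, ..., k - 1 or backward over N - 1, ..., k, has nonzero value.\<close>

definition up :: "rep \<Rightarrow> nat \<Rightarrow> bool" where
  "up x k \<longleftrightarrow> (\<forall>j<k. x (HP j) \<noteq> 0)"

definition down :: "rep \<Rightarrow> nat \<Rightarrow> bool" where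
  "down x k \<longleftrightarrow> (\<forall>j. k \<le> j \<and> j < N \<longrightarrow> x (HM j) \<noteq> 0)"

text \<open>An arrow with nonzero value either lengthens the direct path that reaches its tail or
  runs against it, and then a shorter path reaches its head. At the vertex 0 the empty path starts
  anew.\<close>

lemma up_or_down_walk:
  assumes "walk u p v" "path_value x p \<noteq> 0" "up x u \<or> down x u"
  shows "up x v \<or> down x v"
  using assms
proof (induction p arbitrary: u)
  case (Cons a p)
  then have a: "a \<in> arcs Q" "arrow_tail a = u" "x a \<noteq> 0" and p: "walk (arrow_head a) p v" "path_value x p \<noteq> 0"
    by auto
  have "up x (arrow_head a) \<or> down x (arrow_head a)"
  proof (cases a)
    case (HP j)
    with a Cons.prems(3) nxt_eq[of j] show ?thesis
      by (auto simp: up_def down_def less_Suc_eq)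
  next
    case (HM j)
    then have j: "j < N" "u = nxt j" "x (HM j) \<noteq> 0" using a by auto
    have "up x j \<or> down x j"
    proof (cases "j = N - 1")
      case True
      then have "down x j" using j by (auto simp: down_def) (metis One_nat_def Suc_pred le_antisym less_Suc_eq_le N_pos)
      then show ?thesis ..
    next
      case False
      then have u: "u = Suc j" using j nxt_eq[of j] by simp
      have "down x j" if "down x u"
        using that j(3) u by (auto simp: down_def) (metis Suc_leI le_neq_implies_less)
      moreover have "up x j" if "up x u" using that u by (auto simp: up_def)
      ultimately show ?thesis using Cons.prems(3) by blast
    qed
    with HM show ?thesis by simp
  next
    case (RL k)
    with a Cons.prems(3) show ?thesis by simp
  qed
  from Cons.IH[OF p this] show ?case .
qed simp

lemma reachable_iff:
  assumes "k < N"
  shows "reachable x k \<longleftrightarrow> up x k \<or> down x k"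
proof
  assume "reachable x k"
  then obtain p where p: "walk 0 p k" "path_value x p \<noteq> 0" by (auto simp: reachable_def)
  have "up x 0" by (simp add: up_def)
  with up_or_down_walk[OF p] show "up x k \<or> down x k" by blast
next
  have "reachable x k" if "up x k"
    using assms that
  proof (induction k)
    case 0
    then show ?case by (simp add: reachable_0)
  next
    case (Suc k)
    have "reachable x k" using Suc by (auto simp: up_def)
    then have "reachable x (nxt k)"
      using reachable_step[of x "HP k"] Suc.prems by (simp add: up_def)
    moreover have "nxt k = Suc k" using nxt_eq[of k] Suc.prems by auto
    ultimately show ?case by simp
  qed
  moreover have "reachable x k" if "down x k"
  proof -
    have "k \<le> N - 1" using assms by simp
    then show ?thesis using that
    proof (induction k rule: inc_induct)
      case base
      have "reachable x (nxt (N - 1))" using nxt_eq[of "N - 1"] N_pos by (simp add: reachable_0)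
      then show ?case using reachable_step[of x "HM (N - 1)"] N_pos base by (simp add: down_def)
    next
      case (step k)
      have "reachable x (Suc k)" using step by (auto simp: down_def)
      moreover have "nxt k = Suc k" using nxt_eq[of k] step.hyps by auto
      ultimately have "reachable x (nxt k)" by simp
      then show ?case using reachable_step[of x "HM k"] step by (simp add: down_def)
    qed
  qed
  ultimately show "up x k \<or> down x k \<Longrightarrow> reachable x k" by blast
qed

text \<open>Take the last vertex t that is reached upwards; the next one can be reached only
  downwards. For t = N - 1 the condition on \<open>Suc t\<close> is vacuous.\<close>

lemma Rep_ss_chart:
  assumes "x \<in> Rep_ss"
  obtains t where "t < N" "up x t" "down x (Suc t)"
proof -
  define t where "t = (GREATEST t. t < N \<and> up x t)"
  have 0: "0 < N \<and> up x 0" using N_pos by (simp add: up_def)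
  have t: "t < N \<and> up x t"
    unfolding t_def by (rule GreatestI_nat[of _ 0 N]) (use 0 in auto)
  have max: "s \<le> t" if "s < N \<and> up x s" for s
    unfolding t_def by (rule Greatest_le_nat[of _ _ N]) (use that in auto)
  have "down x (Suc t)"
  proof (cases "Suc t < N")
    case True
    with max[of "Suc t"] have "\<not> up x (Suc t)" by auto
    with True assms show ?thesis using reachable_iff by (auto simp: Rep_ss_iff)
  next
    case False
    then show ?thesis by (auto simp: down_def)
  qed
  with t that show thesis by blast
qed

text \<open>Commuting a cycle past a path from 0 to k with nonzero value shows that it acts at k by
  the same scalar as at 0.\<close>

lemma Rep_ss_central:
  assumes x: "x \<in> Rep_ss"
  obtains C where "\<And>j. j < N \<Longrightarrow> x (HP j) * x (HM j) = C (sy j)" and "\<And>k. k \<in> I_r \<Longrightarrow> x (RL k) = C (1 - sy k)"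
proof -
  define C where "C e = path_value x (cycle e 0)" for e
  have xR: "x \<in> Rep" using x by (simp add: Rep_ss_iff)
  have C: "path_value x (cycle e k) = C e" if k: "k < N" and e: "e < 2" for e k
  proof -
    obtain p where p: "walk 0 p k" "path_value x p \<noteq> 0"
      using Rep_ss_walk[OF x k] by blast
    from equivalent_value[OF cycle_commute[OF p(1) e] xR] p(2) show ?thesis
      by (simp add: C_def)
  qed
  have "x (HP j) * x (HM j) = C (sy j)" if "j < N" for j
    using C[OF that, of "sy j"] sy01[OF that] by (auto simp: cycle_def)
  moreover have "x (RL k) = C (1 - sy k)" if "k \<in> I_r" for k
    using C[of k "1 - sy k"] sy01[OF I_r_less[OF that]] that by (auto simp: cycle_def I_r_less)
  ultimately show thesis by (rule that)
qed

text \<open>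
  The chart with index t consists of the modules generated by the arrows \<open>HP j\<close>, j < t, and
  \<open>HM j\<close>, j > t.  Up to the torus action these arrows, whose values are \<open>\<xi> j\<close>, act by 1; then
  the values z 0, z 1 of \<open>HP t\<close>, \<open>HM t\<close> and the value z 2 of the central element not
  passing through the edge t are coordinates.
\<close>
definition central :: "nat \<Rightarrow> (nat \<Rightarrow> complex) \<Rightarrow> nat \<Rightarrow> complex" where
  "central t z e = (if e = sy t then z 0 * z 1 else z 2)"

definition chart :: "nat \<Rightarrow> (nat \<Rightarrow> complex) \<Rightarrow> (nat \<Rightarrow> complex) \<Rightarrow> rep" where
  "chart t \<xi> z = (\<lambda>a\<in>arcs Q. case a of
      HP j \<Rightarrow> if j < t then \<xi> j else if j = t then z 0 else central t z (sy j) / \<xi> j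
    | HM j \<Rightarrow> if j < t then central t z (sy j) / \<xi> j else if j = t then z 1 else \<xi> j
    | RL k \<Rightarrow> central t z (1 - sy k))"

lemma chart_Rep_ss:
  assumes "\<And>j. \<xi> j \<noteq> 0" and "t < N"
  shows "chart t \<xi> z \<in> Rep_ss"
proof -
  have "chart t \<xi> z \<in> Rep"
    by (rule RepI[where C = "central t z"]) (use assms in \<open>auto simp: chart_def central_def I_r_less\<close>)
  moreover have "reachable (chart t \<xi> z) k" if "k < N" for k
  proof (cases "k \<le> t")
    case True
    then have "up (chart t \<xi> z) k" using assms that by (auto simp: up_def chart_def)
    then show ?thesis using reachable_iff[OF that] by simp
  next
    case False
    then have "down (chart t \<xi> z) k" using assms that by (auto simp: down_def chart_def)
    then show ?thesis using reachable_iff[OF that] by simp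
  qed
  ultimately show ?thesis by (simp add: Rep_ss_iff)
qed

lemma Rep_ss_eq_chart:
  assumes x: "x \<in> Rep_ss"
  obtains t \<xi> z where "t < N" "\<And>j. \<xi> j \<noteq> 0" "x = chart t \<xi> z"
proof -
  obtain t where t: "t < N" "up x t" "down x (Suc t)" using Rep_ss_chart[OF x] .
  obtain C where C: "\<And>j. j < N \<Longrightarrow> x (HP j) * x (HM j) = C (sy j)"
    "\<And>k. k \<in> I_r \<Longrightarrow> x (RL k) = C (1 - sy k)" using Rep_ss_central[OF x] by metis
  \<comment> \<open>The default 1, for j = t and for j >= N, keeps every \<open>\<xi> j\<close>
    nonzero.\<close>
  define \<xi> where "\<xi> j = (if j < t then x (HP j) else if t < j \<and> j < N then x (HM j) else 1)" for j
  define z where "z = (\<lambda>_ :: nat. 0 :: complex)(0 := x (HP t), 1 := x (HM t), 2 := C (1 - sy t))"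
  have \<xi>: "\<xi> j \<noteq> 0" for j using t by (auto simp: \<xi>_def up_def down_def)
  have central: "central t z (sy j) = C (sy j)" if "j < N" for j
    using C(1)[OF t(1)] sy01[OF that] sy01[OF t(1)] by (auto simp: central_def z_def)
  have central': "central t z (1 - sy j) = C (1 - sy j)" if "j < N" for j
    using C(1)[OF t(1)] sy01[OF that] sy01[OF t(1)] by (auto simp: central_def z_def)
  have "chart t \<xi> z a = x a" if a: "a \<in> arcs Q" for a
  proof (cases a)
    case (HP j)
    then have j: "j < N" using a by simp
    then show ?thesis using HP \<xi>[of j] C(1)[OF j] central[OF j]
      by (auto simp: chart_def \<xi>_def z_def field_simps)
  next
    case (HM j)
    then have j: "j < N" using a by simp
    then show ?thesis using HM \<xi>[of j] C(1)[OF j] central[OF j]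
      by (auto simp: chart_def \<xi>_def z_def field_simps)
  next
    case (RL k)
    then show ?thesis using C(2) central' a by (simp add: chart_def I_r_less)
  qed
  then have "x = chart t \<xi> z"
    using Rep_ss_extensional[OF x] by (intro extensionalityI[of _ "arcs Q"]) (auto simp: chart_def)
  with t(1) \<xi> that show thesis by blast
qed

text \<open>g k is the value of the forward path from 0 to k, hence g turns forward arrows with
  value 1 into those of x. The last forward arrow is then correct by the choice of X, and each
  backward arrow is determined by the central values.\<close>

lemma act_generic:
  assumes x: "x \<in> Rep_ss" and nz: "\<And>a. a \<in> arcs Q \<Longrightarrow> x a \<noteq> 0"
    and C: "\<And>j. j < N \<Longrightarrow> x (HP j) * x (HM j) = C (sy j)" "\<And>k. k \<in> I_r \<Longrightarrow> x (RL k) = C (1 - sy k)"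
    and g: "g = (\<lambda>k. \<Prod>j<k. x (HP j))"
  shows "g \<in> torus" and "act g (generic (\<Prod>j<N. x (HP j), C 0, C 1)) = x"
proof -
  show gt: "g \<in> torus" using nz by (auto simp: g torus_def)
  have "act g (generic (\<Prod>j<N. x (HP j), C 0, C 1)) a = x a" if a: "a \<in> arcs Q" for a
  proof -
    have gN: "(\<Prod>j<N. x (HP j)) = g (N - 1) * x (HP (N - 1))"
      using N_pos prod.lessThan_Suc[of "\<lambda>j. x (HP j)" "N - 1"] by (simp add: g)
    have HP: "act g (generic (\<Prod>j<N. x (HP j), C 0, C 1)) (HP j) = x (HP j)" if j: "j < N" for j
    proof (cases "j = N - 1")
      case True
      have "g 0 = 1" by (simp add: g)
      with True j nxt_eq[OF j] torus_nonzero[OF gt j] show ?thesis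
        by (simp add: act_def generic_def gN)
    next
      case False
      then have "g (nxt j) = g j * x (HP j)" using nxt_eq[OF j] by (simp add: g)
      with False j torus_nonzero[OF gt j] show ?thesis
        by (simp add: act_def generic_def)
    qed
    show ?thesis
    proof (cases a)
      case (HM j)
      then have j: "j < N" using a by simp
      have "g (nxt j) \<noteq> 0" "g j \<noteq> 0" using j torus_nonzero[OF gt] by auto
      moreover have X: "(\<Prod>j<N. x (HP j)) \<noteq> 0" using nz by simp
      ultimately have "act g (generic (\<Prod>j<N. x (HP j), C 0, C 1)) (HP j) * act g (generic (\<Prod>j<N. x (HP j), C 0, C 1)) (HM j) = C (sy j)"
        using j sy01[OF j] by (auto simp: act_def generic_def)
      with HP[OF j] C(1)[OF j] nz[of "HP j"] j HM show ?thesis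
        by (metis arcs_Q(1) mult_left_cancel)
    next
      case (RL k)
      then have "k \<in> I_r" "k < N" using a by (auto simp: I_r_less)
      with RL C(2)[of k] sy01[of k] torus_nonzero[OF gt, of k] show ?thesis
        by (auto simp: act_def generic_def)
    qed (use HP a in simp)
  qed
  then show "act g (generic (\<Prod>j<N. x (HP j), C 0, C 1)) = x"
    using Rep_ss_extensional[OF x] by (intro extensionalityI[of _ "arcs Q"]) (auto simp: act_def)
qed

lemma generic_Rep_ss:
  assumes "X \<noteq> 0"
  shows "generic (X, W, Z) \<in> Rep_ss"
proof -
  have "up (generic (X, W, Z)) k" if "k < N" for k
    using assms that by (auto simp: up_def generic_def)
  then show ?thesis
    using reachable_iff generic_Rep[OF assms] by (auto simp: Rep_ss_iff)
qed

section \<open>Regular semi-invariants\<close>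

lemma poly_fun_compose:
  assumes "poly_fun p" and "\<And>a. a \<in> arcs Q \<Longrightarrow> mpoly_fun n (\<lambda>z. \<gamma> z a)"
  shows "mpoly_fun n (\<lambda>z. p (\<gamma> z))"
  using assms(1) by induction (auto intro: mpoly_fun.intros assms(2))

lemma poly_fun_sum:
  assumes "\<And>i. i \<in> I \<Longrightarrow> poly_fun (p i)"
  shows "poly_fun (\<lambda>x. \<Sum>i\<in>I. p i x)"
  using assms by (induction I rule: infinite_finite_induct) (auto intro: poly_fun.intros)

lemma poly_fun_path_value: "set p \<subseteq> arcs Q \<Longrightarrow> poly_fun (\<lambda>x. path_value x p)"
  by (induction p) (auto intro: poly_fun.intros)

lemma poly_fun_path_action:
  assumes "f \<in> carrier (path_algebra Q)"
  shows "poly_fun (\<lambda>x. path_action f x u v)"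
  unfolding path_action_def
  by (intro poly_fun_sum poly_fun.mult poly_fun.const poly_fun_path_value)
     (use path_algebra_walk[OF assms] in \<open>auto simp: pre_digraph.awalk_def\<close>)

lemma regular_on_poly_fun: "poly_fun p \<Longrightarrow> regular_on W p"
  unfolding regular_on_def
  by (intro ballI exI[of _ p] exI[of _ "\<lambda>x. 1"]) (auto intro: poly_fun.const)

lemma mpoly_fun_chart:
  assumes "t < N" and "a \<in> arcs Q"
  shows "mpoly_fun 3 (\<lambda>z. chart t \<xi> z a)"
proof -
  have coord: "mpoly_fun 3 (\<lambda>z. z 0)" "mpoly_fun 3 (\<lambda>z. z 1)" "mpoly_fun 3 (\<lambda>z. z 2)"
    by (auto intro: mpoly_fun.coord)
  have central: "mpoly_fun 3 (\<lambda>z. central t z e)" for e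
    using coord by (cases "e = sy t") (auto simp: central_def intro: mpoly_fun.mult)
  have divide: "mpoly_fun 3 (\<lambda>z. central t z e / c)" for e c
    using mpoly_fun.mult[OF central[of e] mpoly_fun.const[of 3 "1 / c"]] by simp
  show ?thesis
  proof (cases a)
    case (HP j)
    with assms coord divide show ?thesis
      by (cases j t rule: linorder_cases) (auto simp: chart_def intro: mpoly_fun.const)
  next
    case (HM j)
    with assms coord divide show ?thesis
      by (cases j t rule: linorder_cases) (auto simp: chart_def intro: mpoly_fun.const)
  next
    case (RL k)
    with assms central show ?thesis by (auto simp: chart_def)
  qed
qed

text \<open>A chart sends all of affine 3-space into the semistable locus by polynomials, so the
  pullback of f is locally rational at every point.\<close>

lemma regular_chart:
  assumes f: "regular_on Rep_ss f" and "t < N" and \<xi>: "\<And>j. \<xi> j \<noteq> 0"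
  shows "mpoly_fun 3 (\<lambda>z. f (chart t \<xi> z))"
proof (rule locally_rational_imp_mpoly_fun)
  show "locally_rational 3 (\<lambda>z. f (chart t \<xi> z))"
    unfolding locally_rational_def
  proof
    fix z
    have mem: "chart t \<xi> y \<in> Rep_ss" for y using chart_Rep_ss[OF \<xi> \<open>t < N\<close>] .
    from f mem[of z] obtain p q where pq: "poly_fun p" "poly_fun q" "q (chart t \<xi> z) \<noteq> 0"
      "\<forall>y\<in>Rep_ss. q y \<noteq> 0 \<longrightarrow> f y = p y / q y"
      unfolding regular_on_def by blast
    have "mpoly_fun 3 (\<lambda>z. p (chart t \<xi> z))" "mpoly_fun 3 (\<lambda>z. q (chart t \<xi> z))"
      using pq(1,2) mpoly_fun_chart[OF \<open>t < N\<close>] by (auto intro: poly_fun_compose)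
    with pq(3,4) mem show "\<exists>p q. mpoly_fun 3 p \<and> mpoly_fun 3 q \<and> q z \<noteq> 0 \<and>
        (\<forall>y. q y \<noteq> 0 \<longrightarrow> f (chart t \<xi> y) = p y / q y)"
      by (intro exI[of _ "\<lambda>z. p (chart t \<xi> z)"] exI[of _ "\<lambda>z. q (chart t \<xi> z)"]) auto
  qed
qed

lemma chart_nonzero:
  assumes "\<And>j. \<xi> j \<noteq> 0" "t < N" "z 0 \<noteq> 0" "z 1 \<noteq> 0" "z 2 \<noteq> 0" "a \<in> arcs Q"
  shows "chart t \<xi> z a \<noteq> 0"
  using assms by (cases a) (auto simp: chart_def central_def)

text \<open>Density of the modules without zero arrows, tested on a line inside a chart.\<close>

lemma regular_eqI:
  assumes f: "regular_on Rep_ss f" and h: "regular_on Rep_ss h"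
    and eq: "\<And>x. x \<in> Rep_ss \<Longrightarrow> (\<And>a. a \<in> arcs Q \<Longrightarrow> x a \<noteq> 0) \<Longrightarrow> f x = h x"
    and x: "x \<in> Rep_ss"
  shows "f x = h x"
proof -
  obtain t \<xi> z where t: "t < N" and \<xi>: "\<And>j. \<xi> j \<noteq> 0" and xz: "x = chart t \<xi> z"
    using Rep_ss_eq_chart[OF x] by metis
  \<comment> \<open>The line from z, at s = 0, to the point with all coordinates 1, at s = 1. There
    D, the product of the three coordinates, is nonzero.\<close>
  define \<gamma> where "\<gamma> s i = poly [:z i, 1 - z i:] s" for s and i :: nat
  have \<gamma>: "\<exists>P. \<forall>s. \<gamma> s i = poly P s" for i by (auto simp: \<gamma>_def simp del: poly_pCons)
  have mp: "mpoly_fun 3 (\<lambda>z. f (chart t \<xi> z))" "mpoly_fun 3 (\<lambda>z. h (chart t \<xi> z))"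
    by (rule regular_chart[OF f t], rule \<xi>) (rule regular_chart[OF h t], rule \<xi>)
  obtain P where P: "\<And>s. f (chart t \<xi> (\<gamma> s)) = poly P s"
    using mpoly_fun_curve[OF mp(1), of \<gamma>] \<gamma> by blast
  obtain R where R: "\<And>s. h (chart t \<xi> (\<gamma> s)) = poly R s"
    using mpoly_fun_curve[OF mp(2), of \<gamma>] \<gamma> by blast
  define D where "D = [:z 0, 1 - z 0:] * [:z 1, 1 - z 1:] * [:z 2, 1 - z 2:]"
  have D: "poly D s = \<gamma> s 0 * \<gamma> s 1 * \<gamma> s 2" for s by (simp only: D_def \<gamma>_def poly_mult)
  have "\<gamma> 1 i = 1" for i by (simp add: \<gamma>_def)
  then have "D \<noteq> 0" using D[of 1] by auto
  then have "P = R"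
  proof (rule poly_eqI_off_roots)
    fix s assume "poly D s \<noteq> 0"
    then have "\<gamma> s 0 \<noteq> 0" "\<gamma> s 1 \<noteq> 0" "\<gamma> s 2 \<noteq> 0" by (auto simp: D)
    then have "f (chart t \<xi> (\<gamma> s)) = h (chart t \<xi> (\<gamma> s))"
      using \<xi> t by (intro eq chart_Rep_ss chart_nonzero) auto
    then show "poly P s = poly R s" by (simp add: P R)
  qed
  moreover have "\<gamma> 0 = z" by (simp add: \<gamma>_def fun_eq_iff)
  ultimately show ?thesis using P[of 0] R[of 0] by (simp add: xz)
qed

section \<open>Functions that transform by a character of the torus\<close>

text \<open>The rule for the matrix entry from u to v of an endomorphism of L: sections at u and v
  have the characters \<open>g u / g 0\<close> and \<open>g v / g 0\<close>, and g 0
  cancels.\<close>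

definition semi_invariant :: "nat \<Rightarrow> nat \<Rightarrow> (rep \<Rightarrow> complex) \<Rightarrow> bool" where
  "semi_invariant u v f \<longleftrightarrow> (\<forall>g\<in>torus. \<forall>x\<in>Rep_ss. f (act g x) = g v / g u * f x)"

lemma semi_invariant_path_action:
  assumes f: "f \<in> carrier (path_algebra Q)"
  shows "semi_invariant u v (\<lambda>x. path_action f x u v)"
  unfolding semi_invariant_def
proof (intro ballI)
  fix g x assume g: "g \<in> torus"
  have "path_action f (act g x) u v = (\<Sum>p | f (u, p, v) \<noteq> 0. f (u, p, v) * (g v / g u * path_value x p))"
    unfolding path_action_def
    by (rule sum.cong[OF refl]) (simp add: act_value[OF path_algebra_walk[OF f] g])
  also have "\<dots> = g v / g u * path_action f x u v"
    unfolding path_action_def sum_distrib_left by (rule sum.cong) simp_all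
  finally show "path_action f (act g x) u v = g v / g u * path_action f x u v" .
qed

text \<open>By \<open>act_generic\<close> every semistable module without zero arrows is a torus
  translate of a generic one, and \<open>regular_eqI\<close> extends the equality to the
  rest.\<close>

lemma semi_invariant_eqI:
  assumes f: "regular_on Rep_ss f" "semi_invariant u v f" and h: "regular_on Rep_ss h" "semi_invariant u v h"
    and eq: "\<And>X W Z. X \<noteq> 0 \<Longrightarrow> W \<noteq> 0 \<Longrightarrow> Z \<noteq> 0 \<Longrightarrow> f (generic (X, W, Z)) = h (generic (X, W, Z))"
    and "x \<in> Rep_ss"
  shows "f x = h x"
proof (rule regular_eqI[OF f(1) h(1) _ \<open>x \<in> Rep_ss\<close>])
  fix x assume x: "x \<in> Rep_ss" and nz: "\<And>a. a \<in> arcs Q \<Longrightarrow> x a \<noteq> 0"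
  obtain C0 where C0: "\<And>j. j < N \<Longrightarrow> x (HP j) * x (HM j) = C0 (sy j)"
    "\<And>k. k \<in> I_r \<Longrightarrow> x (RL k) = C0 (1 - sy k)" using Rep_ss_central[OF x] by metis
  \<comment> \<open>This makes C nonzero without an argument that both of its indices occur above.\<close>
  define C where "C e = (if C0 e = 0 then 1 else C0 e)" for e
  have C: "x (HP j) * x (HM j) = C (sy j)" if "j < N" for j
    using C0(1)[OF that] nz[of "HP j"] nz[of "HM j"] that by (auto simp: C_def)
  have C': "x (RL k) = C (1 - sy k)" if "k \<in> I_r" for k
    using C0(2)[OF that] nz[of "RL k"] that by (auto simp: C_def)
  define g where "g = (\<lambda>k. \<Prod>j<k. x (HP j))"
  note act = act_generic[OF x nz C C' g_def]
  have X: "(\<Prod>j<N. x (HP j)) \<noteq> 0" using nz by simp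
  have "C 0 \<noteq> 0" "C 1 \<noteq> 0" by (auto simp: C_def)
  with eq[OF X this] f(2) h(2) act generic_Rep_ss[OF X] show "f x = h x"
    unfolding semi_invariant_def by metis
qed

lemma laurent_divide: "X \<noteq> 0 \<Longrightarrow> W \<noteq> 0 \<Longrightarrow> Z \<noteq> 0 \<Longrightarrow>
    laurent (k, l, m) (X, W, Z) / laurent (k', l', m') (X, W, Z) = laurent (k - k', l - l', m - m') (X, W, Z)"
  by (simp add: laurent_def power_int_diff)

lemma laurent_power:
    "laurent (k, l, m) (X, W, Z) ^ n = laurent (int n * k, int n * l, int n * m) (X, W, Z)"
  by (simp add: laurent_def power_mult_distrib power_int_mult mult.commute[of "int n"])

section \<open>Exponents in the two extremal charts\<close>

definition central_degree :: "nat \<Rightarrow> int \<times> int \<times> int" where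
  "central_degree e = (0, of_bool (e = 0), of_bool (e = 1))"

lemma laurent_central: "e < 2 \<Longrightarrow> laurent (central_degree e) (X, W, Z) = (if e = 0 then W else Z)"
  by (auto simp: laurent_def central_degree_def)

text \<open>
  The Laurent exponents of the coordinate monomials of the charts N - 1 and 0; the latter are
  corrected by the character g u / g v of the torus element g that moves generic modules to the chart.
\<close>

definition last_exponent :: "nat \<times> nat \<times> nat \<Rightarrow> int \<times> int \<times> int" where
  "last_exponent = (\<lambda>(i, j, k). (int i - int j, if sy (N - 1) = 0 then int j else int k,
     if sy (N - 1) = 0 then int k else int j))"

definition first_exponent :: "nat \<Rightarrow> nat \<Rightarrow> nat \<times> nat \<times> nat \<Rightarrow> int \<times> int \<times> int" where
  "first_exponent u v = (\<lambda>(i, j, k). let d = of_bool (0 < u) - of_bool (0 < v) + int i - int j in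
     (d, count 0 u - count 0 v - d * count 0 N + (if sy 0 = 0 then int i else int k),
         count 1 u - count 1 v - d * count 1 N + (if sy 0 = 0 then int k else int i)))"

text \<open>Generic modules already have \<open>HP j\<close> equal to 1 for j < N - 1, so no torus
  element is needed to bring them into this chart.\<close>

lemma generic_eq_last_chart:
  assumes "X \<noteq> 0" "W \<noteq> 0" "Z \<noteq> 0"
  obtains z where "generic (X, W, Z) = chart (N - 1) (\<lambda>_. 1) z"
    and "\<And>e. monomial3 e z = laurent (last_exponent e) (X, W, Z)"
proof -
  define C where "C e = (if e = 0 then W else Z)" for e :: nat
  define t where "t = N - 1"
  have t: "t < N" using N_pos by (simp add: t_def)
  define z where "z = (\<lambda>_ :: nat. 0 :: complex)(0 := X, 1 := C (sy t) / X, 2 := C (1 - sy t))"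
  have central: "central t z e = C e" if "e = 0 \<or> e = 1" for e
    using that sy01[OF t] assms by (auto simp: central_def z_def)
  have "generic (X, W, Z) a = chart t (\<lambda>_. 1) z a" for a
  proof (cases "a \<in> arcs Q")
    case True
    show ?thesis
    proof (cases a)
      case (HP j)
      with True show ?thesis by (auto simp: generic_def chart_def t_def[symmetric] z_def t_def)
    next
      case (HM j)
      with True central[OF sy01] show ?thesis
        by (auto simp: generic_def chart_def z_def C_def t_def)
    next
      case (RL k)
      with True have k: "k < N" by (simp add: I_r_less)
      from RL True central[of "1 - sy k"] sy01[OF k] show ?thesis
        by (auto simp: generic_def chart_def C_def)
    qed
  qed (simp add: generic_def chart_def)
  then have 1: "generic (X, W, Z) = chart (N - 1) (\<lambda>_. 1) z" by (auto simp: t_def)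
  have 2: "monomial3 e z = laurent (last_exponent e) (X, W, Z)" for e
    using sy01[OF t] assms
    by (cases e) (auto simp: monomial3_def laurent_def last_exponent_def z_def C_def t_def
        power_divide power_int_diff)
  from 1 2 that show thesis by blast
qed

text \<open>In the chart 0 the arrows \<open>HM j\<close> with j > 0 act by 1, hence
  \<open>HP j\<close> acts by the central value of type \<open>sy j\<close>. So g k, the value of
  the forward path to k, is z 0 times the product of these central values for 0 < j < k.\<close>

lemma first_chart_act_generic:
  assumes nz: "X \<noteq> 0" "W \<noteq> 0" "Z \<noteq> 0" and uv: "u < N" "v < N"
  obtains z g where "g \<in> torus" "act g (generic (X, W, Z)) = chart 0 (\<lambda>_. 1) z"
    and "\<And>e. g u / g v * monomial3 e z = laurent (first_exponent u v e) (X, W, Z)"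
proof -
  let ?l = "\<lambda>d. laurent d (X, W, Z)"
  define C where "C e = (if e = 0 then W else Z)" for e :: nat
  have C: "C e = ?l (central_degree e)" if "e = 0 \<or> e = 1" for e
    using that laurent_central[of e X W Z] by (auto simp: C_def)
  \<comment> \<open>The exponent of g k. For k > 0 it is fixed by the requirement that the full
    forward turn has value X, that is, that its exponent at k = N is (1, 0, 0); the coordinate z 0
    is then g 1.\<close>
  define G :: "nat \<Rightarrow> int \<times> int \<times> int" where
    "G k = (of_bool (0 < k), count 0 k - of_bool (0 < k) * count 0 N, count 1 k - of_bool (0 < k) * count 1 N)" for k
  define z where "z = (\<lambda>_ :: nat. 0 :: complex)(0 := ?l (G 1), 1 := C (sy 0) / ?l (G 1), 2 := C (1 - sy 0))"
  have G1: "?l (G 1) \<noteq> 0" using nz by (simp add: laurent_nonzero)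
  have Cnz: "C e \<noteq> 0" for e using nz by (simp add: C_def)
  have central: "central 0 z e = C e" if "e = 0 \<or> e = 1" for e
    using that sy01[OF N_pos] G1 by (auto simp: central_def z_def)
  define x where "x = chart 0 (\<lambda>_. 1) z"
  define g where "g = (\<lambda>k. \<Prod>j<k. x (HP j))"
  have znz: "z 0 \<noteq> 0" "z 1 \<noteq> 0" "z 2 \<noteq> 0" using G1 Cnz by (auto simp: z_def)
  have x: "x \<in> Rep_ss" unfolding x_def using N_pos by (intro chart_Rep_ss) auto
  have xnz: "x a \<noteq> 0" if "a \<in> arcs Q" for a
    unfolding x_def using chart_nonzero[of "\<lambda>_. 1" 0 z a] znz N_pos that by simp
  have xC: "x (HP j) * x (HM j) = C (sy j)" if "j < N" for j
    using that central[OF sy01[OF that]] G1 by (auto simp: x_def chart_def z_def)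
  have xC': "x (RL k) = C (1 - sy k)" if "k \<in> I_r" for k
    using that central[of "1 - sy k"] sy01[OF I_r_less[OF that]] by (auto simp: x_def chart_def)
  have gG: "g k = ?l (G k)" if "k \<le> N" for k
    using that
  proof (induction k)
    case 0
    then show ?case by (simp add: g_def G_def count_def laurent_def)
  next
    case (Suc k)
    have "g (Suc k) = ?l (G k) * x (HP k)" using Suc by (simp add: g_def)
    also have "\<dots> = ?l (G (Suc k))"
    proof (cases "k = 0")
      case True
      then show ?thesis using N_pos
        by (simp add: x_def chart_def z_def) (simp add: G_def count_def laurent_def)
    next
      case False
      then have "x (HP k) = ?l (central_degree (sy k))"
        using Suc.prems central[of "sy k"] sy01[of k] C[of "sy k"] by (simp add: x_def chart_def)
      moreover have "G k = (1, count 0 k - count 0 N, count 1 k - count 1 N)"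
        using False by (simp add: G_def)
      moreover have "G (Suc k) = (1, count 0 k - count 0 N + of_bool (sy k = 0),
          count 1 k - count 1 N + of_bool (sy k = 1))"
        by (simp add: G_def count_def)
      ultimately show ?thesis by (simp add: central_degree_def laurent_add[OF nz, symmetric])
    qed
    finally show ?case .
  qed
  note act = act_generic[OF x xnz xC xC' g_def]
  have "(\<Prod>j<N. x (HP j)) = X"
    using gG[of N] N_pos by (simp add: g_def G_def laurent_def)
  with act have 1: "g \<in> torus" "act g (generic (X, W, Z)) = chart 0 (\<lambda>_. 1) z"
    by (auto simp: x_def C_def)
  have c01: "count e (Suc 0) = of_bool (sy 0 = e)" for e by (simp add: count_def)
  have 2: "g u / g v * monomial3 e z = ?l (first_exponent u v e)" for e
  proof -
    obtain i j k where e: "e = (i, j, k)" by (cases e)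
    have "g u / g v * monomial3 e z = ?l (G u) / ?l (G v) *
        (?l (G 1) ^ i * (?l (central_degree (sy 0)) / ?l (G 1)) ^ j * ?l (central_degree (1 - sy 0)) ^ k)"
      using uv gG[of u] gG[of v] C[of "sy 0"] C[of "1 - sy 0"] sy01[OF N_pos]
      by (auto simp: e monomial3_def z_def)
    also have "\<dots> = ?l (first_exponent u v e)"
      unfolding G_def central_degree_def laurent_divide[OF nz] laurent_power laurent_add[OF nz, symmetric]
      using sy01[OF N_pos]
      by (intro arg_cong[of _ _ ?l])
         (auto simp: e first_exponent_def c01 Let_def algebra_simps)
    finally show ?thesis .
  qed
  from 1 2 that show thesis by blast
qed

text \<open>
  The exponents of f are those of a polynomial both in the chart N - 1 and in the chart 0; the
  triangles with these two indices contain all four corners of the trapezoid, so no other chart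
  is needed.
\<close>
theorem semi_invariant_is_path_action:
  assumes f: "regular_on Rep_ss f" "semi_invariant u v f" and uv: "u < N" "v < N"
  shows "\<exists>h\<in>carrier (path_algebra Q). \<forall>x\<in>Rep_ss. path_action h x u v = f x"
proof -
  have "mpoly_fun 3 (\<lambda>z. f (chart (N - 1) (\<lambda>_. 1) z))"
    using N_pos by (intro regular_chart[OF f(1)]) auto
  then obtain E \<alpha> where E: "finite E" "\<And>z. f (chart (N - 1) (\<lambda>_. 1) z) = (\<Sum>e\<in>E. \<alpha> e * monomial3 e z)"
    using mpoly_fun_3_expansion by metis
  have "mpoly_fun 3 (\<lambda>z. f (chart 0 (\<lambda>_. 1) z))"
    using N_pos by (intro regular_chart[OF f(1)]) auto
  then obtain E' \<beta> where E': "finite E'" "\<And>z. f (chart 0 (\<lambda>_. 1) z) = (\<Sum>e\<in>E'. \<beta> e * monomial3 e z)"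
    using mpoly_fun_3_expansion by metis
  \<comment> \<open>A common index set for both expansions, so that their coefficients can be
    compared one by one.\<close>
  define D where "D = last_exponent ` E \<union> first_exponent u v ` E'"
  define a where "a d = (\<Sum>e | e \<in> E \<and> last_exponent e = d. \<alpha> e)" for d
  define b where "b d = (\<Sum>e | e \<in> E' \<and> first_exponent u v e = d. \<beta> e)" for d
  have D: "finite D" using E(1) E'(1) by (simp add: D_def)
  have group: "(\<Sum>e\<in>S. c e * laurent (\<kappa> e) s) = (\<Sum>d\<in>D. (\<Sum>e | e \<in> S \<and> \<kappa> e = d. c e) * laurent d s)"
    if "finite S" "\<kappa> ` S \<subseteq> D" for S :: "(nat \<times> nat \<times> nat) set" and c \<kappa> s
  proof -
    have "(\<Sum>e\<in>S. c e * laurent (\<kappa> e) s) = (\<Sum>d\<in>D. \<Sum>e | e \<in> S \<and> \<kappa> e = d. c e * laurent (\<kappa> e) s)"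
      using sum.group[OF that(1) D that(2), of "\<lambda>e. c e * laurent (\<kappa> e) s"] by simp
    also have "\<dots> = (\<Sum>d\<in>D. (\<Sum>e | e \<in> S \<and> \<kappa> e = d. c e) * laurent d s)"
      by (auto simp: sum_distrib_right intro!: sum.cong)
    finally show ?thesis .
  qed
  have fa: "f (generic (X, W, Z)) = (\<Sum>d\<in>D. a d * laurent d (X, W, Z))" if nz: "X \<noteq> 0" "W \<noteq> 0" "Z \<noteq> 0" for X W Z
  proof -
    obtain z where z: "generic (X, W, Z) = chart (N - 1) (\<lambda>_. 1) z"
      and m: "\<And>e. monomial3 e z = laurent (last_exponent e) (X, W, Z)"
      using generic_eq_last_chart[OF nz] by blast
    have "f (generic (X, W, Z)) = (\<Sum>e\<in>E. \<alpha> e * laurent (last_exponent e) (X, W, Z))"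
      by (simp only: z E(2) m)
    also have "\<dots> = (\<Sum>d\<in>D. a d * laurent d (X, W, Z))"
      unfolding a_def by (rule group[OF E(1)]) (simp add: D_def)
    finally show ?thesis .
  qed
  have fb: "f (generic (X, W, Z)) = (\<Sum>d\<in>D. b d * laurent d (X, W, Z))" if nz: "X \<noteq> 0" "W \<noteq> 0" "Z \<noteq> 0" for X W Z
  proof -
    obtain z g where g: "g \<in> torus" "act g (generic (X, W, Z)) = chart 0 (\<lambda>_. 1) z"
      and m: "\<And>e. g u / g v * monomial3 e z = laurent (first_exponent u v e) (X, W, Z)"
      using first_chart_act_generic[OF nz uv] by blast
    have "f (chart 0 (\<lambda>_. 1) z) = g v / g u * f (generic (X, W, Z))"
      using f(2) g generic_Rep_ss[OF nz(1)] unfolding semi_invariant_def by metis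
    then have "f (generic (X, W, Z)) = g u / g v * (\<Sum>e\<in>E'. \<beta> e * monomial3 e z)"
      using torus_nonzero[OF g(1)] uv by (simp add: E'(2))
    also have "\<dots> = (\<Sum>e\<in>E'. \<beta> e * (g u / g v * monomial3 e z))"
      by (simp add: sum_distrib_left mult_ac)
    also have "\<dots> = (\<Sum>e\<in>E'. \<beta> e * laurent (first_exponent u v e) (X, W, Z))"
      by (simp only: m)
    also have "\<dots> = (\<Sum>d\<in>D. b d * laurent d (X, W, Z))"
      unfolding b_def by (rule group[OF E'(1)]) (simp add: D_def)
    finally show ?thesis .
  qed
  have ab: "a d = b d" if d: "d \<in> D" for d
  proof -
    have "a d - b d = 0"
    proof (rule laurent_independent[OF D _ d])
      show "(\<Sum>d\<in>D. (a d - b d) * laurent d (X, W, Z)) = 0" if "X \<noteq> 0" "W \<noteq> 0" "Z \<noteq> 0" for X W Z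
        using fa[OF that] fb[OF that] by (simp add: left_diff_distrib sum_subtractf)
    qed
    then show ?thesis by simp
  qed
  define S where "S = {d \<in> D. a d \<noteq> 0}"
  \<comment> \<open>An exponent with nonzero coefficient comes from a monomial in each of the two
    charts: the chart N - 1 gives the forward bound \<open>fw\<close>, the chart 0 the backward
    bound \<open>bw\<close>.\<close>
  have "\<exists>p. walk u p v \<and> multidegree p = d" if d: "d \<in> S" for d
  proof -
    obtain k l m where klm: "d = (k, l, m)" by (cases d)
    have "{e. e \<in> E \<and> last_exponent e = d} \<noteq> {}"
    proof
      assume empty: "{e. e \<in> E \<and> last_exponent e = d} = {}"
      have "a d = 0" unfolding a_def empty by (rule sum.empty)
      with d show False by (simp add: S_def)
    qed
    then obtain e where "last_exponent e = (k, l, m)" using klm by blast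
    then have fw: "0 \<le> l \<and> 0 \<le> m" by (cases e) (auto simp: last_exponent_def split: if_splits)
    have "{e. e \<in> E' \<and> first_exponent u v e = d} \<noteq> {}"
    proof
      assume empty: "{e. e \<in> E' \<and> first_exponent u v e = d} = {}"
      have "b d = 0" unfolding b_def empty by (rule sum.empty)
      with d ab[of d] show False unfolding S_def by auto
    qed
    then obtain e' where "first_exponent u v e' = (k, l, m)" using klm by blast
    then have bw: "count 0 u - count 0 v - k * count 0 N \<le> l \<and> count 1 u - count 1 v - k * count 1 N \<le> m"
      by (cases e') (auto simp: first_exponent_def Let_def split: if_splits)
    show ?thesis using walk_of_degree[OF uv] fw bw unfolding klm by blast
  qed
  then obtain pd where pd: "\<And>d. d \<in> S \<Longrightarrow> walk u (pd d) v \<and> multidegree (pd d) = d" by metis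
  define h where "h = (\<lambda>(u', p, v'). if u' = u \<and> v' = v \<and> p \<in> pd ` S then a (multidegree p) else 0)"
  have S: "finite S" using D by (simp add: S_def)
  have inj: "inj_on pd S" by (rule inj_on_inverseI[of _ multidegree]) (use pd in blast)
  have h: "h \<in> carrier (path_algebra Q)"
    unfolding path_algebra_carrier
  proof
    have sub: "{w. h w \<noteq> 0} \<subseteq> (\<lambda>p. (u, p, v)) ` pd ` S" by (auto simp: h_def split: if_splits)
    then show "finite {w. h w \<noteq> 0}" using S by (auto intro: finite_subset)
    show "{w. h w \<noteq> 0} \<subseteq> paths Q" using sub pd by (auto simp: paths_Q)
  qed
  have action: "path_action h x u v = (\<Sum>d\<in>S. a d * path_value x (pd d))" for x
  proof -
    have "path_action h x u v = (\<Sum>p\<in>pd ` S. h (u, p, v) * path_value x p)"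
      by (rule path_action_superset) (use S in \<open>auto simp: h_def split: if_splits\<close>)
    also have "\<dots> = (\<Sum>d\<in>S. h (u, pd d, v) * path_value x (pd d))"
      by (simp add: sum.reindex[OF inj])
    also have "\<dots> = (\<Sum>d\<in>S. a d * path_value x (pd d))"
      by (rule sum.cong) (use pd in \<open>auto simp: h_def\<close>)
    finally show ?thesis .
  qed
  have "path_action h x u v = f x" if x: "x \<in> Rep_ss" for x
  proof (rule semi_invariant_eqI[OF _ semi_invariant_path_action[OF h] f _ x])
    show "regular_on Rep_ss (\<lambda>x. path_action h x u v)"
      by (intro regular_on_poly_fun poly_fun_path_action h)
    fix X W Z :: complex assume nz: "X \<noteq> 0" "W \<noteq> 0" "Z \<noteq> 0"
    have "path_action h (generic (X, W, Z)) u v = (\<Sum>d\<in>S. a d * laurent d (X, W, Z))"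
      unfolding action
      by (rule sum.cong[OF refl], subst generic_value[OF nz])
         (use pd in \<open>auto simp: pre_digraph.awalk_def\<close>)
    also have "\<dots> = (\<Sum>d\<in>D. a d * laurent d (X, W, Z))"
      by (rule sum.mono_neutral_left) (use D in \<open>auto simp: S_def\<close>)
    finally show "path_action h (generic (X, W, Z)) u v = f (generic (X, W, Z))"
      by (simp add: fa[OF nz])
  qed
  with h show ?thesis by blast
qed

section \<open>Sections of the tautological bundle\<close>

lemma regular_onE:
  assumes "regular_on W f" and "x \<in> W"
  obtains p q where "poly_fun p" "poly_fun q" "q x \<noteq> 0" "\<forall>y\<in>W. q y \<noteq> 0 \<longrightarrow> f y = p y / q y"
proof -
  have "\<exists>p q. poly_fun p \<and> poly_fun q \<and> q x \<noteq> 0 \<and> (\<forall>y\<in>W. q y \<noteq> 0 \<longrightarrow> f y = p y / q y)"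
    using assms unfolding regular_on_def by (rule bspec)
  then show thesis by (elim exE conjE) (rule that)
qed

lemma regular_onI:
  assumes "\<And>x. x \<in> W \<Longrightarrow> \<exists>p q. poly_fun p \<and> poly_fun q \<and> q x \<noteq> 0 \<and> (\<forall>y\<in>W. q y \<noteq> 0 \<longrightarrow> f y = p y / q y)"
  shows "regular_on W f"
  unfolding regular_on_def using assms by (rule ballI)

lemma regular_on_subset:
  assumes "regular_on W f" and "W' \<subseteq> W"
  shows "regular_on W' f"
proof (rule regular_onI)
  fix x assume "x \<in> W'"
  then have "x \<in> W" using assms(2) by (rule rev_subsetD)
  then obtain p q where "poly_fun p" "poly_fun q" "q x \<noteq> 0" "\<forall>y\<in>W. q y \<noteq> 0 \<longrightarrow> f y = p y / q y"
    by (rule regular_onE[OF assms(1)])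
  with assms(2) show "\<exists>p q. poly_fun p \<and> poly_fun q \<and> q x \<noteq> 0 \<and> (\<forall>y\<in>W'. q y \<noteq> 0 \<longrightarrow> f y = p y / q y)"
    by (intro exI[of _ p] exI[of _ q]) auto
qed

lemma regular_on_cong:
  assumes "\<And>x. x \<in> W \<Longrightarrow> f x = h x"
  shows "regular_on W f \<longleftrightarrow> regular_on W h"
  using assms by (simp add: regular_on_def)

lemma regular_on_add:
  assumes "regular_on W f" "regular_on W h"
  shows "regular_on W (\<lambda>x. f x + h x)"
proof (rule regular_onI)
  fix x assume "x \<in> W"
  obtain p q where "poly_fun p" "poly_fun q" "q x \<noteq> 0" "\<forall>y\<in>W. q y \<noteq> 0 \<longrightarrow> f y = p y / q y"
    by (rule regular_onE[OF assms(1) \<open>x \<in> W\<close>])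
  moreover obtain p' q' where "poly_fun p'" "poly_fun q'" "q' x \<noteq> 0" "\<forall>y\<in>W. q' y \<noteq> 0 \<longrightarrow> h y = p' y / q' y"
    by (rule regular_onE[OF assms(2) \<open>x \<in> W\<close>])
  ultimately show "\<exists>p q. poly_fun p \<and> poly_fun q \<and> q x \<noteq> 0 \<and> (\<forall>y\<in>W. q y \<noteq> 0 \<longrightarrow> f y + h y = p y / q y)"
    by (intro exI[of _ "\<lambda>x. p x * q' x + p' x * q x"] exI[of _ "\<lambda>x. q x * q' x"])
       (auto intro!: poly_fun.intros simp: add_frac_eq)
qed

lemma regular_on_mult:
  assumes "regular_on W f" "regular_on W h"
  shows "regular_on W (\<lambda>x. f x * h x)"
proof (rule regular_onI)
  fix x assume "x \<in> W"
  obtain p q where "poly_fun p" "poly_fun q" "q x \<noteq> 0" "\<forall>y\<in>W. q y \<noteq> 0 \<longrightarrow> f y = p y / q y"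
    by (rule regular_onE[OF assms(1) \<open>x \<in> W\<close>])
  moreover obtain p' q' where "poly_fun p'" "poly_fun q'" "q' x \<noteq> 0" "\<forall>y\<in>W. q' y \<noteq> 0 \<longrightarrow> h y = p' y / q' y"
    by (rule regular_onE[OF assms(2) \<open>x \<in> W\<close>])
  ultimately show "\<exists>p q. poly_fun p \<and> poly_fun q \<and> q x \<noteq> 0 \<and> (\<forall>y\<in>W. q y \<noteq> 0 \<longrightarrow> f y * h y = p y / q y)"
    by (intro exI[of _ "\<lambda>x. p x * p' x"] exI[of _ "\<lambda>x. q x * q' x"])
       (auto intro!: poly_fun.intros)
qed

lemma regular_on_sum:
  assumes "\<And>i. i \<in> I \<Longrightarrow> regular_on W (f i)"
  shows "regular_on W (\<lambda>x. \<Sum>i\<in>I. f i x)"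
  using assms
  by (induction I rule: infinite_finite_induct)
     (auto intro: regular_on_add regular_on_poly_fun poly_fun.const)

text \<open>For quotients by the value of a trivializing path, which may change from point to
  point.\<close>

lemma regular_on_local_divide:
  assumes "\<And>x. x \<in> W \<Longrightarrow> \<exists>h p. regular_on W h \<and> poly_fun p \<and> p x \<noteq> 0 \<and> (\<forall>y\<in>W. p y \<noteq> 0 \<longrightarrow> f y = h y / p y)"
  shows "regular_on W f"
proof (rule regular_onI)
  fix x assume x: "x \<in> W"
  from assms[OF this] obtain h p where hp: "regular_on W h" "poly_fun p" "p x \<noteq> 0" "\<forall>y\<in>W. p y \<noteq> 0 \<longrightarrow> f y = h y / p y"
    by blast
  obtain p' q' where "poly_fun p'" "poly_fun q'" "q' x \<noteq> 0" "\<forall>y\<in>W. q' y \<noteq> 0 \<longrightarrow> h y = p' y / q' y"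
    by (rule regular_onE[OF hp(1) x])
  with hp show "\<exists>p q. poly_fun p \<and> poly_fun q \<and> q x \<noteq> 0 \<and> (\<forall>y\<in>W. q y \<noteq> 0 \<longrightarrow> f y = p y / q y)"
    by (intro exI[of _ p'] exI[of _ "\<lambda>x. q' x * p x"]) (auto intro!: poly_fun.intros)
qed

section \<open>Open sets of the moduli space\<close>

lemma union_Y: "\<Union>Y = Rep_ss"
  using mem_union_orbits[of Y] by (auto simp: Y_def)

lemma Y_opens: "Y \<in> opens"
proof -
  have "zariski_open (\<Union>Y)"
    unfolding zariski_open_def union_Y
    by (rule exI[of _ "{\<lambda>x. 1}"]) (auto intro: poly_fun.const)
  then show ?thesis by (simp add: opens_def)
qed

lemma opens_Y: "U \<in> opens \<Longrightarrow> U \<subseteq> Y"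
  by (simp add: opens_def)

lemma union_Rep_ss: "U \<in> opens \<Longrightarrow> x \<in> \<Union>U \<Longrightarrow> x \<in> Rep_ss"
  using mem_union_orbits[OF opens_Y] by blast

lemma walk_arcs: "walk u p v \<Longrightarrow> set p \<subseteq> arcs Q"
  by (simp add: pre_digraph.awalk_def)

text \<open>The value of a path changes only by a nonzero factor along an orbit, so its nonvanishing
  locus is a union of orbits and descends to the quotient.\<close>

lemma principal_open:
  assumes U: "U \<in> opens" and p: "walk 0 p u"
  obtains V where "V \<in> opens" "V \<subseteq> U" "\<Union>V = {x \<in> \<Union>U. path_value x p \<noteq> 0}"
proof -
  define V where "V = {b \<in> U. \<exists>y\<in>b. path_value y p \<noteq> 0}"
  have VU: "V \<subseteq> U" by (auto simp: V_def)
  then have VY: "V \<subseteq> Y" using opens_Y[OF U] by blast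
  have union: "\<Union>V = {x \<in> \<Union>U. path_value x p \<noteq> 0}"
  proof (rule Set.set_eqI, rule iffI)
    fix x assume x: "x \<in> \<Union>V"
    then have xss: "x \<in> Rep_ss" and "orbit x \<in> V" using mem_union_orbits[OF VY] by blast+
    then obtain g where "g \<in> torus" "path_value (act g x) p \<noteq> 0" by (auto simp: V_def orbit_def)
    then have "path_value x p \<noteq> 0" using act_value[OF p] by auto
    with x VU show "x \<in> {x \<in> \<Union>U. path_value x p \<noteq> 0}" by blast
  next
    fix x assume "x \<in> {x \<in> \<Union>U. path_value x p \<noteq> 0}"
    then obtain b where "b \<in> U" "x \<in> b" "path_value x p \<noteq> 0" by auto
    then have "b \<in> V" unfolding V_def by blast
    with \<open>x \<in> b\<close> show "x \<in> \<Union>V" by blast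
  qed
  have "zariski_open (\<Union>U)" using U by (simp add: opens_def)
  then obtain P where P: "\<forall>q\<in>P. poly_fun q" "\<Union>U = {x \<in> Rep_ss. \<exists>q\<in>P. q x \<noteq> 0}"
    unfolding zariski_open_def by (elim exE conjE)
  have "zariski_open (\<Union>V)"
    unfolding zariski_open_def
  proof (intro exI[of _ "(\<lambda>q x. q x * path_value x p) ` P"] conjI)
    show "\<forall>q\<in>(\<lambda>q x. q x * path_value x p) ` P. poly_fun q"
      using P(1) poly_fun_path_value[OF walk_arcs[OF p]] by (auto intro: poly_fun.mult)
    show "\<Union>V = {x \<in> Rep_ss. \<exists>q\<in>(\<lambda>q x. q x * path_value x p) ` P. q x \<noteq> 0}"
      unfolding union P(2) by auto
  qed
  with VY have "V \<in> opens" by (simp add: opens_def)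
  then show thesis using VU union by (rule that)
qed

section \<open>Sections over an open set\<close>

lemma L_sectionsI:
  assumes "s \<in> extensional (\<Union>U)" "regular_on (\<Union>U) s"
    and "\<And>g x. g \<in> torus \<Longrightarrow> x \<in> \<Union>U \<Longrightarrow> s (act g x) = g k / g 0 * s x"
  shows "s \<in> L_sections k U"
  using assms unfolding L_sections_def by blast

lemma L_sectionsD:
  assumes "s \<in> L_sections k U"
  shows "regular_on (\<Union>U) s" "g \<in> torus \<Longrightarrow> x \<in> \<Union>U \<Longrightarrow> s (act g x) = g k / g 0 * s x"
  using assms by (auto simp: L_sections_def)

lemma restrict_L_sections:
  assumes U: "U \<in> opens" and "regular_on (\<Union>U) s"
    and eq: "\<And>g x. g \<in> torus \<Longrightarrow> x \<in> \<Union>U \<Longrightarrow> s (act g x) = g k / g 0 * s x"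
  shows "restrict s (\<Union>U) \<in> L_sections k U"
proof (rule L_sectionsI)
  show "regular_on (\<Union>U) (restrict s (\<Union>U))"
    using assms(2) by (subst regular_on_cong[of _ _ s]) auto
  show "restrict s (\<Union>U) (act g x) = g k / g 0 * restrict s (\<Union>U) x" if "g \<in> torus" "x \<in> \<Union>U" for g x
    using act_union_orbits[OF opens_Y[OF U] that(2,1)] eq[OF that] that(2) by (simp del: Union_iff)
qed simp

lemma zero_L_sections: "U \<in> opens \<Longrightarrow> (\<lambda>x\<in>\<Union>U. 0) \<in> L_sections k U"
  by (rule restrict_L_sections) (auto intro: regular_on_poly_fun poly_fun.const)

lemma L_component: "s \<in> L U \<Longrightarrow> k < N \<Longrightarrow> s k \<in> L_sections k U"
  by (auto simp: L_def)

lemma L_I: "(\<And>k. k < N \<Longrightarrow> s k \<in> L_sections k U) \<Longrightarrow> restrict s {..<N} \<in> L U"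
  by (auto simp: L_def)

lemma L_eqI:
  assumes s: "s \<in> L U" and t: "t \<in> L U" and eq: "\<And>k x. k < N \<Longrightarrow> x \<in> \<Union>U \<Longrightarrow> s k x = t k x"
  shows "s = t"
proof (rule PiE_ext[OF s[unfolded L_def] t[unfolded L_def]])
  fix k assume k: "k \<in> {..<N}"
  then have "s k \<in> extensional (\<Union>U)" "t k \<in> extensional (\<Union>U)"
    using L_component[OF s] L_component[OF t] by (auto simp: L_sections_def)
  then show "s k = t k" by (rule extensionalityI) (use eq k in auto)
qed

lemma sec_add_L:
  assumes U: "U \<in> opens" and s: "s \<in> L U" and t: "t \<in> L U"
  shows "sec_add U s t \<in> L U"
  unfolding sec_add_def
proof (rule L_I)
  fix k assume k: "k < N"
  note sk = L_sectionsD[OF L_component[OF s k]] and tk = L_sectionsD[OF L_component[OF t k]]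
  show "(\<lambda>x\<in>\<Union>U. s k x + t k x) \<in> L_sections k U"
    by (rule restrict_L_sections[OF U regular_on_add[OF sk(1) tk(1)]])
       (simp add: sk(2) tk(2) distrib_left del: Union_iff)
qed

lemma sec_smult_L:
  assumes U: "U \<in> opens" and f: "f \<in> O_Y U" and s: "s \<in> L U"
  shows "sec_smult U f s \<in> L U"
  unfolding sec_smult_def
proof (rule L_I)
  fix k assume k: "k < N"
  note sk = L_sectionsD[OF L_component[OF s k]]
  have f: "regular_on (\<Union>U) (\<lambda>x. f (orbit x))" using f by (simp add: O_Y_def)
  show "(\<lambda>x\<in>\<Union>U. f (orbit x) * s k x) \<in> L_sections k U"
    by (rule restrict_L_sections[OF U regular_on_mult[OF f sk(1)]])
       (simp add: sk(2) orbit_act union_Rep_ss[OF U] del: Union_iff)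
qed

lemma sec_restrict_L:
  assumes U: "U \<in> opens" and V: "V \<in> opens" "V \<subseteq> U" and s: "s \<in> L U"
  shows "sec_restrict V s \<in> L V"
  unfolding sec_restrict_def
proof (rule L_I)
  fix k assume k: "k < N"
  note sk = L_sectionsD[OF L_component[OF s k]]
  have sub: "\<Union>V \<subseteq> \<Union>U" using V(2) by blast
  show "restrict (s k) (\<Union>V) \<in> L_sections k V"
  proof (rule restrict_L_sections[OF V(1) regular_on_subset[OF sk(1) sub]])
    fix g x assume g: "g \<in> torus" and "x \<in> \<Union>V"
    then have "x \<in> \<Union>U" using sub by blast
    then show "s k (act g x) = g k / g 0 * s k x" by (rule sk(2)[OF g])
  qed
qed

definition at_vertex :: "nat \<Rightarrow> rep set set \<Rightarrow> (rep \<Rightarrow> complex) \<Rightarrow> bundle_section" where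
  "at_vertex u U s = (\<lambda>k\<in>{..<N}. \<lambda>x\<in>\<Union>U. if k = u then s x else 0)"

lemma at_vertex_L:
  assumes U: "U \<in> opens" and "regular_on (\<Union>U) s"
    and "\<And>g x. g \<in> torus \<Longrightarrow> x \<in> \<Union>U \<Longrightarrow> s (act g x) = g u / g 0 * s x"
  shows "at_vertex u U s \<in> L U"
  unfolding at_vertex_def
proof (rule L_I)
  fix k assume "k < N"
  show "(\<lambda>x\<in>\<Union>U. if k = u then s x else 0) \<in> L_sections k U"
  proof (cases "k = u")
    case True
    with restrict_L_sections[OF U assms(2,3)] show ?thesis by simp
  next
    case False
    with zero_L_sections[OF U] show ?thesis by simp
  qed
qed

lemma sec_apply:
  assumes "k < N" "x \<in> \<Union>U"
  shows "sec_add U s t k x = s k x + t k x" "sec_smult U f s k x = f (orbit x) * s k x"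
    "sec_restrict U s k x = s k x" "at_vertex u U s' k x = (if k = u then s' x else 0)"
  using assms by (simp_all add: sec_add_def sec_smult_def sec_restrict_def at_vertex_def del: Union_iff)

lemma at_vertex_path_L:
  assumes U: "U \<in> opens" and p: "walk 0 p u"
  shows "at_vertex u U (\<lambda>x. path_value x p) \<in> L U"
  by (rule at_vertex_L[OF U])
     (auto intro!: regular_on_poly_fun poly_fun_path_value walk_arcs[OF p] simp: act_value[OF p])

section \<open>The tautological homomorphism\<close>

lemma path_tautological_apply:
  assumes "U \<in> opens" "s \<in> L U" "v < N" "x \<in> \<Union>U"
  shows "path_tautological f U s v x = (\<Sum>u<N. path_action f x u v * s u x)"
  using assms by (simp add: path_tautological_def del: Union_iff)

lemma path_tautological_L:
  assumes f: "f \<in> carrier (path_algebra Q)" and U: "U \<in> opens" and s: "s \<in> L U"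
  shows "path_tautological f U s \<in> L U"
proof -
  have "(\<lambda>v\<in>{..<N}. \<lambda>x\<in>\<Union>U. \<Sum>u<N. path_action f x u v * s u x) \<in> L U"
  proof (rule L_I)
    fix v assume v: "v < N"
    note sk = L_sectionsD[OF L_component[OF s]]
    show "(\<lambda>x\<in>\<Union>U. \<Sum>u<N. path_action f x u v * s u x) \<in> L_sections v U"
    proof (rule restrict_L_sections[OF U])
      show "regular_on (\<Union>U) (\<lambda>x. \<Sum>u<N. path_action f x u v * s u x)"
        by (intro regular_on_sum regular_on_mult regular_on_poly_fun poly_fun_path_action f sk(1)) simp
      fix g x assume g: "g \<in> torus" and x: "x \<in> \<Union>U"
      have "path_action f (act g x) u v * s u (act g x) = g v / g 0 * (path_action f x u v * s u x)" if u: "u < N" for u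
        using semi_invariant_path_action[OF f, of u v] g union_Rep_ss[OF U x] sk(2)[OF u g x] torus_nonzero[OF g u]
        by (simp add: semi_invariant_def)
      then show "(\<Sum>u<N. path_action f (act g x) u v * s u (act g x)) = g v / g 0 * (\<Sum>u<N. path_action f x u v * s u x)"
        by (simp add: sum_distrib_left)
    qed
  qed
  then show ?thesis using U s by (simp add: path_tautological_def)
qed

lemma End_eqI:
  assumes \<phi>: "\<phi> \<in> (\<Pi>\<^sub>E U\<in>opens. L U \<rightarrow>\<^sub>E L U)" and \<psi>: "\<psi> \<in> (\<Pi>\<^sub>E U\<in>opens. L U \<rightarrow>\<^sub>E L U)"
    and eq: "\<And>U s v x. U \<in> opens \<Longrightarrow> s \<in> L U \<Longrightarrow> v < N \<Longrightarrow> x \<in> \<Union>U \<Longrightarrow> \<phi> U s v x = \<psi> U s v x"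
  shows "\<phi> = \<psi>"
proof (rule PiE_ext[OF \<phi> \<psi>])
  fix U assume U: "U \<in> opens"
  then have "\<phi> U \<in> L U \<rightarrow>\<^sub>E L U" "\<psi> U \<in> L U \<rightarrow>\<^sub>E L U" using \<phi> \<psi> by auto
  then show "\<phi> U = \<psi> U"
  proof (rule PiE_ext)
    fix s assume s: "s \<in> L U"
    have "\<phi> U s \<in> L U" "\<psi> U s \<in> L U" using \<phi> \<psi> U s by (auto dest!: PiE_mem)
    then show "\<phi> U s = \<psi> U s" by (rule L_eqI) (use eq U s in blast)
  qed
qed

lemma path_tautological_PiE:
  "f \<in> carrier (path_algebra Q) \<Longrightarrow> path_tautological f \<in> (\<Pi>\<^sub>E U\<in>opens. L U \<rightarrow>\<^sub>E L U)"
  using path_tautological_L by (auto simp: path_tautological_def)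

lemma path_tautological_End:
  assumes f: "f \<in> carrier (path_algebra Q)"
  shows "path_tautological f \<in> carrier End_L"
proof -
  note app = path_tautological_apply and mem = path_tautological_L[OF f]
  have "path_tautological f U (sec_add U s t) = sec_add U (path_tautological f U s) (path_tautological f U t)"
    if U: "U \<in> opens" and s: "s \<in> L U" and t: "t \<in> L U" for U s t
    by (rule L_eqI[OF mem[OF U sec_add_L[OF U s t]] sec_add_L[OF U mem[OF U s] mem[OF U t]]])
       (simp add: app U s t sec_add_L[OF U s t] sec_apply sum.distrib distrib_left del: Union_iff)
  moreover have "path_tautological f U (sec_smult U h s) = sec_smult U h (path_tautological f U s)"
    if U: "U \<in> opens" and h: "h \<in> O_Y U" and s: "s \<in> L U" for U h s
    by (rule L_eqI[OF mem[OF U sec_smult_L[OF U h s]] sec_smult_L[OF U h mem[OF U s]]])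
       (simp add: app U s sec_smult_L[OF U h s] sec_apply sum_distrib_left mult_ac del: Union_iff)
  moreover have "path_tautological f V (sec_restrict V s) = sec_restrict V (path_tautological f U s)"
    if U: "U \<in> opens" and V: "V \<in> opens" "V \<subseteq> U" and s: "s \<in> L U" for U V s
  proof (rule L_eqI[OF mem[OF V(1) sec_restrict_L[OF U V s]] sec_restrict_L[OF U V mem[OF U s]]])
    fix v x assume vx: "v < N" "x \<in> \<Union>V"
    have "x \<in> \<Union>U" using vx V by blast
    then show "path_tautological f V (sec_restrict V s) v x = sec_restrict V (path_tautological f U s) v x"
      using vx by (simp add: app U V s sec_restrict_L[OF U V s] sec_apply del: Union_iff)
  qed
  ultimately show ?thesis
    using path_tautological_PiE[OF f] by (simp add: End_L_def End_L_carrier_def)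
qed

lemma End_L_PiE: "\<phi> \<in> carrier End_L \<Longrightarrow> \<phi> \<in> (\<Pi>\<^sub>E U\<in>opens. L U \<rightarrow>\<^sub>E L U)"
  by (simp add: End_L_def End_L_carrier_def)

lemma path_tautological_mult:
  assumes f: "f \<in> carrier (path_algebra Q)" and g: "g \<in> carrier (path_algebra Q)"
  shows "path_tautological (f \<otimes>\<^bsub>path_algebra Q\<^esub> g) = path_tautological f \<otimes>\<^bsub>End_L\<^esub> path_tautological g"
proof (rule End_eqI[OF path_tautological_PiE[OF path.m_closed[OF f g]]])
  show "path_tautological f \<otimes>\<^bsub>End_L\<^esub> path_tautological g \<in> (\<Pi>\<^sub>E U\<in>opens. L U \<rightarrow>\<^sub>E L U)"
    using path_tautological_L f g by (auto simp: End_L_def)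
  fix U s v x assume U: "U \<in> opens" and s: "s \<in> L U" and v: "v < N" and x: "x \<in> \<Union>U"
  have "(path_tautological f \<otimes>\<^bsub>End_L\<^esub> path_tautological g) U s v x =
      (\<Sum>m<N. path_action f x m v * (\<Sum>u<N. path_action g x u m * s u x))"
    using U s v x path_tautological_L[OF g U s]
    by (simp add: End_L_def path_tautological_apply del: Union_iff)
  also have "\<dots> = (\<Sum>u<N. (\<Sum>m<N. path_action f x m v * path_action g x u m) * s u x)"
    by (simp add: sum_distrib_left sum_distrib_right mult.assoc) (rule sum.swap)
  also have "\<dots> = path_tautological (f \<otimes>\<^bsub>path_algebra Q\<^esub> g) U s v x"
    by (simp add: path_tautological_apply[OF U s v x] path_action_mult[OF f g])
  finally show "path_tautological (f \<otimes>\<^bsub>path_algebra Q\<^esub> g) U s v x =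
      (path_tautological f \<otimes>\<^bsub>End_L\<^esub> path_tautological g) U s v x" ..
qed

lemma path_tautological_add:
  assumes f: "f \<in> carrier (path_algebra Q)" and g: "g \<in> carrier (path_algebra Q)"
  shows "path_tautological (f \<oplus>\<^bsub>path_algebra Q\<^esub> g) = path_tautological f \<oplus>\<^bsub>End_L\<^esub> path_tautological g"
proof (rule End_eqI[OF path_tautological_PiE[OF path.a_closed[OF f g]]])
  show "path_tautological f \<oplus>\<^bsub>End_L\<^esub> path_tautological g \<in> (\<Pi>\<^sub>E U\<in>opens. L U \<rightarrow>\<^sub>E L U)"
    using path_tautological_L f g sec_add_L by (auto simp: End_L_def)
  fix U s v x assume U: "U \<in> opens" and s: "s \<in> L U" and v: "v < N" and x: "x \<in> \<Union>U"
  show "path_tautological (f \<oplus>\<^bsub>path_algebra Q\<^esub> g) U s v x =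
      (path_tautological f \<oplus>\<^bsub>End_L\<^esub> path_tautological g) U s v x"
    using U s v x
    by (simp add: End_L_def sec_apply path_tautological_apply path_algebra_add path_action_add[OF f g]
        sum.distrib distrib_right del: Union_iff)
qed

lemma path_action_one: "u < N \<Longrightarrow> path_action \<one>\<^bsub>path_algebra Q\<^esub> x u v = (if v = u then 1 else 0)"
  by (subst path_action_superset[of "{[]}"]) (auto simp: path_algebra_one)

lemma path_tautological_one: "path_tautological \<one>\<^bsub>path_algebra Q\<^esub> = \<one>\<^bsub>End_L\<^esub>"
proof (rule End_eqI[OF path_tautological_PiE[OF path.one_closed]])
  show "\<one>\<^bsub>End_L\<^esub> \<in> (\<Pi>\<^sub>E U\<in>opens. L U \<rightarrow>\<^sub>E L U)" by (simp add: End_L_def)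
  fix U s v x assume U: "U \<in> opens" and s: "s \<in> L U" and v: "v < N" and x: "x \<in> \<Union>U"
  have "path_tautological \<one>\<^bsub>path_algebra Q\<^esub> U s v x = (\<Sum>u<N. if v = u then s u x else 0)"
    unfolding path_tautological_apply[OF U s v x] by (rule sum.cong) (auto simp: path_action_one)
  then show "path_tautological \<one>\<^bsub>path_algebra Q\<^esub> U s v x = \<one>\<^bsub>End_L\<^esub> U s v x"
    using U s v by (simp add: End_L_def)
qed

text \<open>The global section given by a path from 0 to u that is nonzero at x isolates the matrix
  entries out of u at x. So equal endomorphisms have equal matrices, in particular on generic
  modules. Conversely, the ideal acts as zero on all modules.\<close>

theorem path_tautological_eq_iff:
  assumes f: "f \<in> carrier (path_algebra Q)" and g: "g \<in> carrier (path_algebra Q)"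
  shows "path_tautological f = path_tautological g \<longleftrightarrow> f \<ominus>\<^bsub>path_algebra Q\<^esub> g \<in> rel_ideal"
proof
  assume eq: "path_tautological f = path_tautological g"
  have "path_action f x u v = path_action g x u v" if x: "x \<in> Rep_ss" and u: "u < N" and v: "v < N" for x u v
  proof -
    obtain p where p: "walk 0 p u" "path_value x p \<noteq> 0" using Rep_ss_walk[OF x u] by blast
    note s = at_vertex_path_L[OF Y_opens p(1)]
    have xY: "x \<in> \<Union>Y" using x by (simp add: union_Y)
    have "path_tautological h Y (at_vertex u Y (\<lambda>x. path_value x p)) v x = path_action h x u v * path_value x p" for h
    proof -
      have "path_tautological h Y (at_vertex u Y (\<lambda>x. path_value x p)) v x =
          (\<Sum>u'<N. if u' = u then path_action h x u v * path_value x p else 0)"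
        unfolding path_tautological_apply[OF Y_opens s v xY]
        by (rule sum.cong[OF refl]) (simp add: sec_apply[OF _ xY])
      with u show ?thesis by simp
    qed
    with eq p(2) show ?thesis by (metis mult_right_cancel)
  qed
  then have "path_action (f \<ominus>\<^bsub>path_algebra Q\<^esub> g) (generic (X, W, Z)) u v = 0"
    if "X \<noteq> 0" "u < N" "v < N" for X W Z u v
    using generic_Rep_ss[OF that(1)] that f g
    by (simp add: path_algebra_minus[OF path_ring] path_action_diff)
  then show "f \<ominus>\<^bsub>path_algebra Q\<^esub> g \<in> rel_ideal"
    using f g by (intro rel_ideal_if_generic_action_zero) auto
next
  assume I: "f \<ominus>\<^bsub>path_algebra Q\<^esub> g \<in> rel_ideal"
  have eq: "path_action f x u v = path_action g x u v" if "x \<in> Rep_ss" for x u v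
    using rel_ideal_action[OF I, of x u v] that f g
    by (simp add: Rep_ss_iff path_algebra_minus[OF path_ring] path_action_diff)
  show "path_tautological f = path_tautological g"
  proof (rule End_eqI[OF path_tautological_PiE[OF f] path_tautological_PiE[OF g]])
    fix U s v x assume U: "U \<in> opens" and s: "s \<in> L U" and v: "v < N" and x: "x \<in> \<Union>U"
    show "path_tautological f U s v x = path_tautological g U s v x"
      using eq[OF union_Rep_ss[OF U x]] by (simp add: path_tautological_apply[OF U s v x])
  qed
qed

text \<open>
  Near a point x the bundle at u is trivialized by the action of a path p from 0 to u with
  nonzero value at x, so an endomorphism is determined by the images of these sections.
\<close>
lemma End_L_at_vertex:
  assumes \<phi>: "\<phi> \<in> carrier End_L" and U: "U \<in> opens" and s: "regular_on (\<Union>U) s"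
    and s_act: "\<And>g x. g \<in> torus \<Longrightarrow> x \<in> \<Union>U \<Longrightarrow> s (act g x) = g u / g 0 * s x"
    and p: "walk 0 p u" and x: "x \<in> \<Union>U" "path_value x p \<noteq> 0" and v: "v < N"
  shows "\<phi> U (at_vertex u U s) v x = s x / path_value x p * \<phi> Y (at_vertex u Y (\<lambda>x. path_value x p)) v x"
proof -
  let ?\<sigma> = "at_vertex u Y (\<lambda>x. path_value x p)"
  have u: "u < N" using walk_ends[OF p] by simp
  obtain V where V: "V \<in> opens" "V \<subseteq> U" and VU: "\<Union>V = {x \<in> \<Union>U. path_value x p \<noteq> 0}"
    using principal_open[OF U p] by blast
  have xV: "x \<in> \<Union>V" using x VU by blast
  \<comment> \<open>Numerator and denominator have the same character, so the representative chosen
    in the orbit b does not matter.\<close>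
  define h where "h = (\<lambda>b\<in>V. s (SOME y. y \<in> b) / path_value (SOME y. y \<in> b) p)"
  have h: "h (orbit y) = s y / path_value y p" if y: "y \<in> \<Union>V" for y
  proof -
    have yss: "y \<in> Rep_ss" and "orbit y \<in> V" using mem_union_orbits[OF opens_Y[OF V(1)]] y by blast+
    have "(SOME z. z \<in> orbit y) \<in> orbit y" using orbit_self[OF yss] by (rule someI[of "\<lambda>z. z \<in> orbit y"])
    then obtain g where g: "g \<in> torus" "(SOME z. z \<in> orbit y) = act g y" by (auto simp: orbit_def)
    have yU: "y \<in> \<Union>U" using y V(2) by blast
    have "h (orbit y) = s (act g y) / path_value (act g y) p"
      using \<open>orbit y \<in> V\<close> by (simp add: h_def g(2))
    also have "\<dots> = (g u / g 0 * s y) / (g u / g 0 * path_value y p)"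
      by (simp only: s_act[OF g(1) yU] act_value[OF p g(1)])
    also have "\<dots> = s y / path_value y p"
      using torus_nonzero[OF g(1)] u N_pos by simp
    finally show ?thesis .
  qed
  have hO: "h \<in> O_Y V"
  proof -
    have "regular_on (\<Union>V) (\<lambda>y. s y / path_value y p)"
    proof (rule regular_on_local_divide)
      fix y assume y: "y \<in> \<Union>V"
      have "\<Union>V \<subseteq> \<Union>U" using V(2) by blast
      from regular_on_subset[OF s this] y VU poly_fun_path_value[OF walk_arcs[OF p]]
      show "\<exists>h q. regular_on (\<Union>V) h \<and> poly_fun q \<and> q y \<noteq> 0 \<and>
          (\<forall>y\<in>\<Union>V. q y \<noteq> 0 \<longrightarrow> s y / path_value y p = h y / q y)"
        by (intro exI[of _ s] exI[of _ "\<lambda>y. path_value y p"]) (simp del: Union_iff)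
    qed
    then have "regular_on (\<Union>V) (\<lambda>x. h (orbit x))"
      using regular_on_cong[of "\<Union>V" "\<lambda>x. h (orbit x)" "\<lambda>y. s y / path_value y p"] h by blast
    then show ?thesis by (simp add: O_Y_def h_def)
  qed
  have VY: "V \<subseteq> Y" using opens_Y[OF V(1)] .
  have \<sigma>: "?\<sigma> \<in> L Y" by (rule at_vertex_path_L[OF Y_opens p])
  have s_L: "at_vertex u U s \<in> L U" by (rule at_vertex_L[OF U s s_act])
  have \<phi>L: "\<phi> W t \<in> L W" if "W \<in> opens" "t \<in> L W" for W t
    using End_L_PiE[OF \<phi>] that by (auto dest!: PiE_mem)
  have res: "\<phi> V (sec_restrict V t) = sec_restrict V (\<phi> W t)" if "W \<in> opens" "V \<subseteq> W" "t \<in> L W" for W t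
    using \<phi> that V(1) by (simp add: End_L_def End_L_carrier_def)
  note \<sigma>V = sec_restrict_L[OF Y_opens V(1) VY \<sigma>]
  \<comment> \<open>Over V the given section is h times the trivializing one; now linearity over the
    structure sheaf and compatibility with restriction apply.\<close>
  have "sec_restrict V (at_vertex u U s) = sec_smult V h (sec_restrict V ?\<sigma>)"
  proof (rule L_eqI[OF sec_restrict_L[OF U V s_L] sec_smult_L[OF V(1) hO \<sigma>V]])
    fix k y assume k: "k < N" and y: "y \<in> \<Union>V"
    have "y \<in> \<Union>U" "y \<in> \<Union>Y" "path_value y p \<noteq> 0" using y VU VY by blast+
    then show "sec_restrict V (at_vertex u U s) k y = sec_smult V h (sec_restrict V ?\<sigma>) k y"
      using k y h[OF y] by (simp add: sec_apply del: Union_iff)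
  qed
  then have "sec_restrict V (\<phi> U (at_vertex u U s)) = \<phi> V (sec_smult V h (sec_restrict V ?\<sigma>))"
    using res[OF U V(2) s_L] by simp
  also have "\<dots> = sec_smult V h (\<phi> V (sec_restrict V ?\<sigma>))"
    using \<phi> V(1) hO \<sigma>V by (simp add: End_L_def End_L_carrier_def)
  also have "\<dots> = sec_smult V h (sec_restrict V (\<phi> Y ?\<sigma>))"
    by (simp add: res[OF Y_opens VY \<sigma>])
  finally have "sec_restrict V (\<phi> U (at_vertex u U s)) v x = sec_smult V h (sec_restrict V (\<phi> Y ?\<sigma>)) v x"
    by simp
  then show ?thesis
    using v xV h[OF xV] by (simp add: sec_apply del: Union_iff)
qed

text \<open>The matrix entry \<open>F u v\<close> is the image of a trivializing section divided by
  that section. By \<open>End_L_at_vertex\<close> the choice of the path has no influence, so near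
  each point one path serves and \<open>F u v\<close> is regular. As a semi-invariant it is then the
  action of an element of the path algebra.\<close>

theorem path_tautological_surj:
  assumes \<phi>: "\<phi> \<in> carrier End_L"
  obtains f where "f \<in> carrier (path_algebra Q)" "path_tautological f = \<phi>"
proof -
  define \<Phi> where "\<Phi> u v p x = \<phi> Y (at_vertex u Y (\<lambda>x. path_value x p)) v x" for u v p x
  define P where "P u x = (SOME p. walk 0 p u \<and> path_value x p \<noteq> 0)" for u x
  define F where "F u v x = \<Phi> u v (P u x) x / path_value x (P u x)" for u v x
  have P: "walk 0 (P u x) u \<and> path_value x (P u x) \<noteq> 0" if xu: "x \<in> Rep_ss" "u < N" for x u
    unfolding P_def by (rule someI_ex) (use Rep_ss_walk[OF xu] in blast)
  have \<phi>L: "\<phi> U t \<in> L U" if "U \<in> opens" "t \<in> L U" for U t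
    using End_L_PiE[OF \<phi>] that by (auto dest!: PiE_mem)
  have \<Phi>F: "\<Phi> u v p x = path_value x p * F u v x" if x: "x \<in> Rep_ss" and p: "walk 0 p u" and v: "v < N" for u v p x
  proof -
    have u: "u < N" using walk_ends[OF p] by simp
    have "\<Phi> u v p x = path_value x p / path_value x (P u x) * \<Phi> u v (P u x) x"
      unfolding \<Phi>_def
      by (rule End_L_at_vertex[OF \<phi> Y_opens])
         (use P[OF x u] x v in \<open>auto intro!: regular_on_poly_fun poly_fun_path_value walk_arcs[OF p]
            simp: act_value[OF p] union_Y simp del: Union_iff\<close>)
    then show ?thesis by (simp add: F_def)
  qed
  have \<Phi>L: "\<phi> Y (at_vertex u Y (\<lambda>x. path_value x p)) v \<in> L_sections v Y" if "walk 0 p u" "v < N" for u v p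
    using L_component[OF \<phi>L[OF Y_opens at_vertex_path_L[OF Y_opens that(1)]] that(2)] .
  have F_regular: "regular_on Rep_ss (F u v)" if u: "u < N" and v: "v < N" for u v
  proof (rule regular_on_local_divide)
    fix x assume x: "x \<in> Rep_ss"
    let ?p = "P u x"
    note p = P[OF x u]
    have "regular_on Rep_ss (\<Phi> u v ?p)"
      using L_sectionsD(1)[OF \<Phi>L[OF conjunct1[OF p] v]] by (simp add: \<Phi>_def[abs_def] union_Y)
    moreover have "poly_fun (\<lambda>x. path_value x ?p)"
      using p by (intro poly_fun_path_value walk_arcs) blast
    moreover have "\<forall>y\<in>Rep_ss. path_value y ?p \<noteq> 0 \<longrightarrow> F u v y = \<Phi> u v ?p y / path_value y ?p"
      using \<Phi>F[of _ ?p u v] p v by simp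
    ultimately show "\<exists>h q. regular_on Rep_ss h \<and> poly_fun q \<and> q x \<noteq> 0 \<and> (\<forall>y\<in>Rep_ss. q y \<noteq> 0 \<longrightarrow> F u v y = h y / q y)"
      using p by blast
  qed
  have F_semi: "semi_invariant u v (F u v)" if u: "u < N" and v: "v < N" for u v
    unfolding semi_invariant_def
  proof (intro ballI)
    fix g x assume g: "g \<in> torus" and x: "x \<in> Rep_ss"
    let ?p = "P u x"
    note p = P[OF x u]
    have nz: "g 0 \<noteq> 0" "g u \<noteq> 0" "g v \<noteq> 0" using torus_nonzero[OF g] N_pos u v by auto
    have "\<Phi> u v ?p (act g x) = g v / g 0 * \<Phi> u v ?p x"
      using L_sectionsD(2)[OF \<Phi>L[OF conjunct1[OF p] v] g] x by (simp add: \<Phi>_def union_Y)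
    then have "g u / g 0 * path_value x ?p * F u v (act g x) = g v / g 0 * (path_value x ?p * F u v x)"
      using \<Phi>F[OF act_Rep_ss[OF x g] conjunct1[OF p] v] \<Phi>F[OF x conjunct1[OF p] v] act_value[OF conjunct1[OF p] g]
      by simp
    with nz p show "F u v (act g x) = g v / g u * F u v x"
      by (simp add: field_simps)
  qed
  have \<phi>_apply: "\<phi> U s v x = (\<Sum>u<N. F u v x * s u x)"
    if U: "U \<in> opens" and s: "s \<in> L U" and v: "v < N" and x: "x \<in> \<Union>U" for U s v x
  proof -
    \<comment> \<open>Truncations of s, which build it up one vertex at a time by
      additivity.\<close>
    define T where "T n = (\<lambda>k\<in>{..<N}. \<lambda>x\<in>\<Union>U. if k < n then s k x else 0)" for n
    have sk: "regular_on (\<Union>U) (s k)" "\<And>g x. g \<in> torus \<Longrightarrow> x \<in> \<Union>U \<Longrightarrow> s k (act g x) = g k / g 0 * s k x"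
      if "k < N" for k
      using L_sectionsD[OF L_component[OF s that]] by blast+
    have at: "at_vertex n U (s n) \<in> L U" if "n < N" for n
      by (rule at_vertex_L[OF U sk(1)[OF that] sk(2)[OF that]])
    have T: "T n \<in> L U" for n
      unfolding T_def
    proof (rule L_I)
      fix k assume "k < N"
      show "(\<lambda>x\<in>\<Union>U. if k < n then s k x else 0) \<in> L_sections k U"
      proof (cases "k < n")
        case True
        with restrict_L_sections[OF U sk(1)[OF \<open>k < N\<close>] sk(2)[OF \<open>k < N\<close>]] show ?thesis by simp
      next
        case False
        with zero_L_sections[OF U] show ?thesis by simp
      qed
    qed
    have "n \<le> N \<Longrightarrow> \<phi> U (T n) v x = (\<Sum>u<n. F u v x * s u x)" for n
    proof (induction n)
      case 0
      \<comment> \<open>The zero section is 0 times itself, so linearity over the structure sheaf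
        shows that its image is zero.\<close>
      define z where "z = (\<lambda>b\<in>U. 0 :: complex)"
      have orbit_U: "orbit y \<in> U" if "y \<in> \<Union>U" for y
        using mem_union_orbits[OF opens_Y[OF U]] that by blast
      have "regular_on (\<Union>U) (\<lambda>x. z (orbit x))"
        using regular_on_cong[of "\<Union>U" "\<lambda>x. z (orbit x)" "\<lambda>x. 0"] orbit_U
          regular_on_poly_fun[OF poly_fun.const] by (simp add: z_def)
      then have z: "z \<in> O_Y U" by (simp add: O_Y_def z_def)
      have "T 0 = sec_smult U z (T 0)"
        by (rule L_eqI[OF T sec_smult_L[OF U z T]]) (simp add: T_def sec_apply z_def del: Union_iff)
      moreover have "\<phi> U (sec_smult U z (T 0)) = sec_smult U z (\<phi> U (T 0))"
        using \<phi> U z T[of 0] by (simp add: End_L_def End_L_carrier_def)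
      ultimately have "\<phi> U (T 0) = sec_smult U z (\<phi> U (T 0))" by metis
      then have "\<phi> U (T 0) v x = sec_smult U z (\<phi> U (T 0)) v x" by simp
      also have "\<dots> = 0" using v x orbit_U[OF x] by (simp add: sec_apply z_def del: Union_iff)
      finally show ?case by simp
    next
      case (Suc n)
      then have n: "n < N" by simp
      have "T (Suc n) = sec_add U (T n) (at_vertex n U (s n))"
        by (rule L_eqI[OF T sec_add_L[OF U T at[OF n]]])
           (auto simp: T_def sec_apply less_Suc_eq simp del: Union_iff)
      then have "\<phi> U (T (Suc n)) = sec_add U (\<phi> U (T n)) (\<phi> U (at_vertex n U (s n)))"
        using \<phi> U T at[OF n] by (simp add: End_L_def End_L_carrier_def)
      then have "\<phi> U (T (Suc n)) v x = \<phi> U (T n) v x + \<phi> U (at_vertex n U (s n)) v x"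
        using v x by (simp add: sec_apply del: Union_iff)
      moreover have "\<phi> U (at_vertex n U (s n)) v x = F n v x * s n x"
      proof -
        have xss: "x \<in> Rep_ss" by (rule union_Rep_ss[OF U x])
        note p = P[OF xss n]
        show ?thesis
          using End_L_at_vertex[OF \<phi> U sk[OF n] conjunct1[OF p] x conjunct2[OF p] v]
          by (simp add: F_def \<Phi>_def)
      qed
      ultimately show ?case using Suc by simp
    qed
    moreover have "T N = s"
      by (rule L_eqI[OF T s]) (simp add: T_def del: Union_iff)
    ultimately show ?thesis by (metis order_refl)
  qed
  define good where "good u v h \<longleftrightarrow> h \<in> carrier (path_algebra Q) \<and> (\<forall>x\<in>Rep_ss. path_action h x u v = F u v x)" for u v h
  define h where "h u v = (SOME h. good u v h)" for u v
  have "good u v (h u v)" if uv: "u < N" "v < N" for u v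
    unfolding h_def
  proof (rule someI_ex[of "good u v"])
    show "\<exists>h. good u v h"
      using semi_invariant_is_path_action[OF F_regular[OF uv] F_semi[OF uv] uv] by (auto simp: good_def)
  qed
  then have h: "\<And>u v. u < N \<Longrightarrow> v < N \<Longrightarrow>
      h u v \<in> carrier (path_algebra Q) \<and> (\<forall>x\<in>Rep_ss. path_action (h u v) x u v = F u v x)"
    by (simp add: good_def)
  \<comment> \<open>\<open>h u v\<close> is controlled only between u and v, so f takes from it just
    the paths from u to v.\<close>
  define f where "f = (\<lambda>(u, p, v). if u < N \<and> v < N then h u v (u, p, v) else 0)"
  have f: "f \<in> carrier (path_algebra Q)"
  proof -
    have sub: "{w. f w \<noteq> 0} \<subseteq> (\<Union>u<N. \<Union>v<N. {w. h u v w \<noteq> 0})"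
    proof
      fix w assume "w \<in> {w. f w \<noteq> 0}"
      moreover obtain u p v where "w = (u, p, v)" by (cases w)
      ultimately have "u \<in> {..<N}" "v \<in> {..<N}" "w \<in> {w. h u v w \<noteq> 0}"
        by (auto simp: f_def split: if_splits)
      then show "w \<in> (\<Union>u<N. \<Union>v<N. {w. h u v w \<noteq> 0})" by blast
    qed
    have fin: "finite (\<Union>u<N. \<Union>v<N. {w. h u v w \<noteq> 0})"
      using h by (simp add: path_algebra_carrier)
    have "(\<Union>u<N. \<Union>v<N. {w. h u v w \<noteq> 0}) \<subseteq> paths Q"
      using h by (intro UN_least) (simp add: path_algebra_carrier)
    with finite_subset[OF sub fin] subset_trans[OF sub] show ?thesis
      by (simp add: path_algebra_carrier)
  qed
  have f_action: "path_action f x u v = F u v x" if "u < N" "v < N" "x \<in> Rep_ss" for u v x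
  proof -
    have "path_action f x u v = path_action (h u v) x u v"
      using that by (simp add: path_action_def f_def)
    with h that show ?thesis by simp
  qed
  have "path_tautological f = \<phi>"
  proof (rule End_eqI[OF path_tautological_PiE[OF f] End_L_PiE[OF \<phi>]])
    fix U s v x assume U: "U \<in> opens" and s: "s \<in> L U" and v: "v < N" and x: "x \<in> \<Union>U"
    show "path_tautological f U s v x = \<phi> U s v x"
      unfolding path_tautological_apply[OF U s v x] \<phi>_apply[OF U s v x]
      by (rule sum.cong) (simp_all add: f_action v union_Rep_ss[OF U x])
  qed
  with f that show thesis by blast
qed

section \<open>Passage to the quotient by the relations\<close>

text \<open>Well-definedness: \<open>path_tautological\<close> is constant on a coset, so
  \<open>the_elem\<close> in the definition of \<open>tautological\<close> picks its only
  value.\<close>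

theorem tautological_coset:
  assumes f: "f \<in> carrier (path_algebra Q)"
  shows "tautological (rel_ideal +>\<^bsub>path_algebra Q\<^esub> f) = path_tautological f"
proof -
  have "path_tautological g = path_tautological f" if "g \<in> rel_ideal +>\<^bsub>path_algebra Q\<^esub> f" for g
  proof -
    from that obtain i where i: "i \<in> rel_ideal" "g = i \<oplus>\<^bsub>path_algebra Q\<^esub> f"
      by (auto simp: a_r_coset_def')
    have "i \<in> carrier (path_algebra Q)" using i(1) by (rule rel.Icarr)
    then have "g \<ominus>\<^bsub>path_algebra Q\<^esub> f = i" "g \<in> carrier (path_algebra Q)"
      using f i(2) by (simp_all add: a_minus_def path.a_assoc path.r_neg)
    with i(1) f show ?thesis by (simp add: path_tautological_eq_iff)
  qed
  moreover have "f \<in> rel_ideal +>\<^bsub>path_algebra Q\<^esub> f"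
    using rel.a_rcos_self[OF f] .
  ultimately have "path_tautological ` (rel_ideal +>\<^bsub>path_algebra Q\<^esub> f) = {path_tautological f}" by blast
  then show ?thesis by (simp add: tautological_def)
qed

theorem tautological_ring_iso: "tautological \<in> ring_iso A End_L"
proof -
  have carrier_A: "X \<in> carrier A \<longleftrightarrow> (\<exists>f\<in>carrier (path_algebra Q). X = rel_ideal +>\<^bsub>path_algebra Q\<^esub> f)" for X
    by (auto simp: A_def FactRing_def A_RCOSETS_def')
  have "tautological \<in> ring_hom A End_L"
  proof (rule ring_hom_memI)
    show "tautological X \<in> carrier End_L" if "X \<in> carrier A" for X
      using that by (auto simp: carrier_A tautological_coset path_tautological_End)
    fix X X' assume "X \<in> carrier A" "X' \<in> carrier A"
    then obtain f g where f: "f \<in> carrier (path_algebra Q)" "X = rel_ideal +>\<^bsub>path_algebra Q\<^esub> f"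
      and g: "g \<in> carrier (path_algebra Q)" "X' = rel_ideal +>\<^bsub>path_algebra Q\<^esub> g" by (auto simp: carrier_A)
    have "X \<otimes>\<^bsub>A\<^esub> X' = rel_ideal +>\<^bsub>path_algebra Q\<^esub> (f \<otimes>\<^bsub>path_algebra Q\<^esub> g)"
      by (simp add: A_def FactRing_def f g rel.rcoset_mult_add)
    then show "tautological (X \<otimes>\<^bsub>A\<^esub> X') = tautological X \<otimes>\<^bsub>End_L\<^esub> tautological X'"
      by (simp add: f g tautological_coset path_tautological_mult)
    have "X \<oplus>\<^bsub>A\<^esub> X' = rel_ideal +>\<^bsub>path_algebra Q\<^esub> (f \<oplus>\<^bsub>path_algebra Q\<^esub> g)"
      by (simp add: A_def FactRing_def f g rel.a_rcos_sum)
    then show "tautological (X \<oplus>\<^bsub>A\<^esub> X') = tautological X \<oplus>\<^bsub>End_L\<^esub> tautological X'"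
      by (simp add: f g tautological_coset path_tautological_add)
  next
    have "\<one>\<^bsub>A\<^esub> = rel_ideal +>\<^bsub>path_algebra Q\<^esub> \<one>\<^bsub>path_algebra Q\<^esub>"
      by (simp add: A_def FactRing_def)
    then show "tautological \<one>\<^bsub>A\<^esub> = \<one>\<^bsub>End_L\<^esub>"
      by (simp add: tautological_coset path_tautological_one)
  qed
  moreover have "bij_betw tautological (carrier A) (carrier End_L)"
  proof (rule bij_betw_imageI)
    show "inj_on tautological (carrier A)"
    proof (rule inj_onI)
      fix X X' assume "X \<in> carrier A" "X' \<in> carrier A" and eq: "tautological X = tautological X'"
      then obtain f g where f: "f \<in> carrier (path_algebra Q)" "X = rel_ideal +>\<^bsub>path_algebra Q\<^esub> f"
        and g: "g \<in> carrier (path_algebra Q)" "X' = rel_ideal +>\<^bsub>path_algebra Q\<^esub> g" by (auto simp: carrier_A)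
      with eq show "X = X'"
        by (simp add: tautological_coset path_tautological_eq_iff path.quotient_eq_iff_same_a_r_cos[OF rel.is_ideal])
    qed
    show "tautological ` carrier A = carrier End_L"
    proof
      show "tautological ` carrier A \<subseteq> carrier End_L"
        by (auto simp: carrier_A tautological_coset path_tautological_End)
      show "carrier End_L \<subseteq> tautological ` carrier A"
      proof
        fix \<phi> assume "\<phi> \<in> carrier End_L"
        then obtain f where f: "f \<in> carrier (path_algebra Q)" "path_tautological f = \<phi>"
          by (rule path_tautological_surj)
        then have "\<phi> = tautological (rel_ideal +>\<^bsub>path_algebra Q\<^esub> f)" by (simp add: tautological_coset)
        moreover have "rel_ideal +>\<^bsub>path_algebra Q\<^esub> f \<in> carrier A"
          using f(1) carrier_A by blast
        ultimately show "\<phi> \<in> tautological ` carrier A" by (rule image_eqI)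
      qed
    qed
  qed
  ultimately show ?thesis by (simp add: ring_iso_def)
qed

end

text \<open>The second conjunct certifies that the isomorphism is the tautological one: on the coset
  of f it is the fibrewise action of f, whereas \<open>the_elem\<close> alone would not guarantee
  this.\<close>

theorem theorem1p20:
  fixes N0 N1 :: nat and sx :: "nat \<Rightarrow> int" and sy :: "nat \<Rightarrow> nat" and \<theta> :: "nat \<Rightarrow> real"
  assumes "0 < N0" and "N1 \<le> N0"
    and "is_partition N0 N1 sx sy"
    and "(\<Sum>k<N0 + N1. \<theta> k) = 0"
    and "\<And>k. 0 < k \<Longrightarrow> k < N0 + N1 \<Longrightarrow> \<theta> k < 0"
  shows "quiver_data.tautological (N0 + N1) sy \<theta>
           \<in> ring_iso (quiver_data.A (N0 + N1) sy) (quiver_data.End_L (N0 + N1) sy \<theta>) \<and>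
         (\<forall>f\<in>carrier (path_algebra (quiver_data.Q (N0 + N1) sy)).
            quiver_data.tautological (N0 + N1) sy \<theta>
              (quiver_data.rel_ideal (N0 + N1) sy +>\<^bsub>path_algebra (quiver_data.Q (N0 + N1) sy)\<^esub> f)
            = quiver_data.path_tautological (N0 + N1) sy \<theta> f)"
proof -
  interpret chamber "N0 + N1" sy \<theta>
  proof
    show "0 < N0 + N1" using assms(1) by simp
    show "sy j = 0 \<or> sy j = 1" if "j < N0 + N1" for j
    proof -
      have "(sx j, sy j) \<in> {0..<int N0} \<times> {0} \<union> {0..<int N1} \<times> {1}"
        using assms(3) that unfolding is_partition_def bij_betw_def by blast
      then show ?thesis by auto
    qed
  qed (use assms(4,5) in auto)
  show ?thesis
    using tautological_ring_iso tautological_coset by blast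
qed

end
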